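(* Let $B\in E_K$ with fundamental solution $\gamma$. For each $v\in[\mathcal{I}_L(B),\mathcal{I}_U(B)]$ and each $u>0$, there is a sequence of integers $m_k\to+\infty$ such that $$\lim_{k\to+\infty}\frac{i_1(\gamma,[0,um_k])}{um_k}=v.$$
   Context: Let $d\ge 1$, $I$ the identity matrix, $J=\begin{pmatrix}0&-I\\ I&0\end{pmatrix}$ the standard $2d\times 2d$ symplectic matrix, $\mathrm{Sp}(2d)=\{M\in GL(\mathbb{R}^{2d}): M^TJM=J\}$, $\mathbb{U}$ the unit circle in $\mathbb{C}$, and $\mathrm{Sym}(2d,\mathbb{R})$ the real symmetric $2d\times 2d$ matrices. For $K>0$, $E_K=\{B\in C^0(\mathbb{R},\mathrm{Sym}(2d,\mathbb{R})): \|B\|=\sup_t\|B(t)\|\le K\}$ (operator norm). For $B\in E_K$, $\gamma=\gamma_B$ is the fundamental solution: $\dot\gamma(t)=JB(t)\gamma(t)$, $\gamma(0)=I$. Maslov-type index: for $\omega\in\mathbb{U}$ let $\mathrm{Sp}(2d)^0_\omega=\{M\in\mathrm{Sp}(2d):\det(M-\omega I)=0\}$, a codimension-one hypersurface co-oriented at $M$ by the direction $\frac{d}{dt}Me^{tJ}|_{t=0}$. For a continuous path $\gamma:[a,b]\to\mathrm{Sp}(2d)$ and $M\in\mathrm{Sp}(2d)$, $\iota(\omega M,\gamma,[a,b])\in\mathbb{Z}$ is the intersection number of the path $t\mapsto e^{-\epsilon J}\gamma(t)M^{-1}$, $t\in[a,b]$, with the co-oriented hypersurface $\mathrm{Sp}(2d)^0_\omega$,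 for $\epsilon>0$ sufficiently small. For a path on $[0,T]$ with $\gamma(0)=I$, $i_\omega(\gamma,[0,T])=\iota(\omega I,\gamma,[0,T])-\frac12\dim_{\mathbb{C}}\ker(I-\omega I)$; thus $i_1(\gamma,[0,T])=\iota(I,\gamma,[0,T])-d$. Mean indices: $\mathcal{I}_U(B)=\limsup_{l\to+\infty}\frac{i_1(\gamma,[0,l])}{l}$, $\mathcal{I}_L(B)=\liminf_{l\to+\infty}\frac{i_1(\gamma,[0,l])}{l}$. *)

theory Defs
  imports "HOL-Analysis.Analysis"
begin

text \<open>The index type \<^typ>\<open>'d + 'd\<close> has \<open>2d\<close> elements for \<open>d = CARD('d) \<ge> 1\<close>; the summands index the
  two blocks.\<close>

type_synonym 'd mat2 = "real ^ ('d + 'd) ^ ('d + 'd)"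

definition J_mat :: "('d::finite) mat2" where
  "J_mat = (\<chi> i j. case (i, j) of
       (Inl k, Inr l) \<Rightarrow> if k = l then - 1 else 0
     | (Inr k, Inl l) \<Rightarrow> if k = l then 1 else 0
     | _ \<Rightarrow> 0)"

definition mexp :: "real ^ 'n ^ 'n \<Rightarrow> real ^ ('n::finite) ^ 'n" where
  "mexp A = (\<Sum>k. (((**) A ^^ k) (mat 1)) /\<^sub>R fact k)"

definition cmat :: "real ^ 'n ^ 'm \<Rightarrow> complex ^ 'n ^ 'm" where
  "cmat M = (\<chi> i j. complex_of_real (M $ i $ j))"

definition Sp :: "('d::finite) mat2 set" where
  "Sp = {M. invertible M \<and> transpose M ** J_mat ** M = J_mat}"

definition Sp0 :: "complex \<Rightarrow> ('d::finite) mat2 set" where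
  "Sp0 \<omega> = {M \<in> Sp. det (cmat M - mat \<omega>) = 0}"

text \<open>A defining function of \<^term>\<open>Sp0 \<omega>\<close> inside \<^term>\<open>Sp\<close>. For \<open>M\<close> symplectic and \<open>\<bar>\<omega>\<bar> = 1\<close> the
  number \<open>det (M - \<omega>) / \<omega>^d\<close> is real, because the characteristic polynomial of \<open>M\<close> is real and
  palindromic; so taking the real part loses nothing.\<close>

definition sp_det :: "complex \<Rightarrow> ('d::finite) mat2 \<Rightarrow> real" where
  "sp_det \<omega> M = Re (det (cmat M - mat \<omega>) / \<omega> ^ CARD('d))"

text \<open>Derivative of the defining function at \<open>M\<close> in the co-orienting direction
  \<open>d/dt M exp(tJ)\<close> at \<open>t = 0\<close>. At points of the hypersurface it is nonzero exactly on the smooth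
  part (one-dimensional kernel of \<open>M - \<omega>\<close>; the rest has codimension 3 or more), where its sign
  tells which side of the hypersurface is the positive one.\<close>

definition coorient :: "complex \<Rightarrow> ('d::finite) mat2 \<Rightarrow> real" where
  "coorient \<omega> M = deriv (\<lambda>t. sp_det \<omega> (M ** mexp (t *\<^sub>R J_mat))) 0"

definition crossings :: "complex \<Rightarrow> (real \<Rightarrow> ('d::finite) mat2) \<Rightarrow> real set" where
  "crossings \<omega> q = {t \<in> {0..1}. q t \<in> Sp0 \<omega>}"

definition crossing_rate :: "complex \<Rightarrow> (real \<Rightarrow> ('d::finite) mat2) \<Rightarrow> real \<Rightarrow> real" where
  "crossing_rate \<omega> q t = deriv (\<lambda>s. sp_det \<omega> (q s)) t"

text \<open>Paths on \<open>[0,1]\<close> with end points off the hypersurface which meet it only at smooth points and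
  transversally.\<close>

definition transverse_path :: "complex \<Rightarrow> (real \<Rightarrow> ('d::finite) mat2) \<Rightarrow> bool" where
  "transverse_path \<omega> q \<longleftrightarrow>
     q 0 \<notin> Sp0 \<omega> \<and> q 1 \<notin> Sp0 \<omega> \<and> finite (crossings \<omega> q) \<and>
     (\<forall>t \<in> crossings \<omega> q.
        q differentiable (at t) \<and> coorient \<omega> (q t) \<noteq> 0 \<and> crossing_rate \<omega> q t \<noteq> 0)"

text \<open>A crossing counts \<open>+1\<close> if the path goes to the side of \<open>M exp(tJ)\<close>, \<open>t > 0\<close>, and \<open>-1\<close> otherwise.\<close>

definition signed_crossings :: "complex \<Rightarrow> (real \<Rightarrow> ('d::finite) mat2) \<Rightarrow> real" where
  "signed_crossings \<omega> q =
     (\<Sum>t \<in> crossings \<omega> q. sgn (crossing_rate \<omega> q t) * sgn (coorient \<omega> (q t)))"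

text \<open>Intersection number of a continuous path \<open>p\<close> on \<open>[0,1]\<close> in \<^term>\<open>Sp\<close>, with end points off the
  hypersurface: the signed count for any transverse path homotopic to \<open>p\<close> in \<^term>\<open>Sp\<close> with fixed
  end points.\<close>

definition intersection_number :: "complex \<Rightarrow> (real \<Rightarrow> ('d::finite) mat2) \<Rightarrow> int" where
  "intersection_number \<omega> p =
     (THE n. \<exists>q. homotopic_paths Sp p q \<and> transverse_path \<omega> q \<and>
                 real_of_int n = signed_crossings \<omega> q)"

text \<open>\<open>iota \<omega> M \<gamma> a b\<close> is \<open>\<iota>(\<omega>M, \<gamma>, [a,b])\<close>; \<^const>\<open>subpath\<close> rescales \<open>[a,b]\<close> to \<open>[0,1]\<close>.\<close>

definition iota ::
  "complex \<Rightarrow> ('d::finite) mat2 \<Rightarrow> (real \<Rightarrow> 'd mat2) \<Rightarrow> real \<Rightarrow> real \<Rightarrow> int" where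
  "iota \<omega> M \<gamma> a b =
     (THE n. \<forall>\<^sub>F \<epsilon> in at_right 0.
        intersection_number \<omega>
          (subpath a b (\<lambda>t. mexp (- \<epsilon> *\<^sub>R J_mat) ** \<gamma> t ** matrix_inv M)) = n)"

definition maslov_index :: "complex \<Rightarrow> (real \<Rightarrow> ('d::finite) mat2) \<Rightarrow> real \<Rightarrow> real" where
  "maslov_index \<omega> \<gamma> T =
     real_of_int (iota \<omega> (mat 1) \<gamma> 0 T)
     - real (vec.dim {v :: complex ^ ('d + 'd). (mat 1 - mat \<omega>) *v v = 0}) / 2"

definition E_bound :: "real \<Rightarrow> (real \<Rightarrow> ('d::finite) mat2) set" where
  "E_bound K = {B. continuous_on UNIV B \<and> (\<forall>t. transpose (B t) = B t) \<and>
                   (\<forall>t. onorm ((*v) (B t)) \<le> K)}"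

definition is_fundamental_solution ::
  "(real \<Rightarrow> ('d::finite) mat2) \<Rightarrow> (real \<Rightarrow> 'd mat2) \<Rightarrow> bool" where
  "is_fundamental_solution B \<gamma> \<longleftrightarrow>
     (\<forall>t. (\<gamma> has_vector_derivative (J_mat ** B t ** \<gamma> t)) (at t)) \<and> \<gamma> 0 = mat 1"

definition fundamental_solution :: "(real \<Rightarrow> ('d::finite) mat2) \<Rightarrow> real \<Rightarrow> 'd mat2" where
  "fundamental_solution B = (THE \<gamma>. is_fundamental_solution B \<gamma>)"

definition mean_index_U :: "(real \<Rightarrow> ('d::finite) mat2) \<Rightarrow> ereal" where
  "mean_index_U B =
     Limsup at_top (\<lambda>l::real. ereal (maslov_index 1 (fundamental_solution B) l / l))"

definition mean_index_L :: "(real \<Rightarrow> ('d::finite) mat2) \<Rightarrow> ereal" where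
  "mean_index_L B =
     Liminf at_top (\<lambda>l::real. ereal (maslov_index 1 (fundamental_solution B) l / l))"

end

theory Submission
  imports Defs "HOL-Computational_Algebra.Fundamental_Theorem_Algebra"
begin

text \<open>
  Exchanging input and output of a symplectic matrix \<open>M\<close> on one eigenspace of \<open>J\<close> turns it into a
  unitary matrix \<open>S\<close> (the Potapov-Ginzburg transform) with \<open>ker (S - 1)\<close> isomorphic to \<open>ker (M - 1)\<close>,
  and \<open>exp (tJ)\<close> rotates the spectrum of \<open>S\<close> by the angle \<open>t\<close>. Clearing denominators,
  \<open>det (1 - r S)\<close> becomes a polynomial in \<open>r\<close> and \<open>M\<close> which vanishes for no \<open>r\<close> in the open unit disc and
  is, for \<open>r = 1\<close>, a real multiple of \<open>det (M - 1)\<close>. The change of its argument along a path with end points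
  off the hypersurface, taken through \<open>r < 1\<close>, is therefore a homotopy invariant; for transverse paths a local
  computation at each crossing identifies it with \<open>- \<pi>\<close> times the signed count.

  Transverse representatives come from symplectic transvections \<open>1 + s J v v\<^sup>T\<close>: the determinant
  is affine in \<open>s\<close>, so a transvection segment with regular end points crosses at most once, transversally.

  For a fundamental solution the index differs by a bounded amount from \<open>- arg / \<pi>\<close> of the value at \<open>r = 0\<close>,
  whose logarithmic derivative is bounded because \<open>B\<close> is. Hence \<open>i\<^sub>1 / l\<close>, sampled at the multiples of \<open>u\<close>,
  has steps tending to \<open>0\<close> and attains every value between its lower and upper limit as a limit.
\<close>

section \<open>Matrices\<close>

text \<open>The integer to be estimated is a definite description over all transverse
  representatives of a homotopy class, for a hypersurface that is singular where the kernel has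
  dimension above one. No stratified transversality is invoked: the argument gives uniqueness of the
  count, explicit transvections give existence. The detour through \<open>r < 1\<close> is forced,
  because \<open>det (M - 1)\<close> is real: at a zero its argument jumps by half a turn, and the
  function itself does not say in which direction. The side \<open>r < 1\<close> decides that. Only
  growth of order \<open>l\<close> matters for the quotient by \<open>l\<close>, so bounded errors
  are harmless. Passing from \<open>r = 1\<close> to \<open>r = 0\<close> turns the argument by at
  most pi per root of a polynomial of degree at most \<open>2d\<close>, whatever \<open>M\<close>
  is. That the logarithmic derivative at \<open>r = 0\<close> is bounded is not obvious, since the
  fundamental solution may grow exponentially. It enters only through the product of
  \<open>M\<close> with the inverse of \<open>Pplus + Pminus M\<close>, and this product is bounded
  on the whole noncompact group, because symplectic matrices preserve the difference of the squared
  norms of the two \<open>J\<close>-components.\<close>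

lemma matrix_mul_scaleR_left: "(r *\<^sub>R A) ** B = r *\<^sub>R (A ** B)"
  for A :: "'a::real_algebra_1 ^ 'n ^ 'm"
  by (simp add: vec_eq_iff matrix_matrix_mult_def scaleR_sum_right)

lemma matrix_mul_scaleR_right: "A ** (r *\<^sub>R B) = r *\<^sub>R (A ** B)"
  for A :: "'a::real_algebra_1 ^ 'n ^ 'm"
  by (simp add: vec_eq_iff matrix_matrix_mult_def scaleR_sum_right)

lemma matrix_add_rdistrib: "(A + B) ** C = A ** C + B ** C"
  by (simp add: vec_eq_iff matrix_matrix_mult_def distrib_right sum.distrib)

lemma matrix_diff_ldistrib: "A ** (B - C) = A ** B - A ** C"
  for A :: "'a::ring_1 ^ 'n ^ 'm"
  by (simp add: vec_eq_iff matrix_matrix_mult_def right_diff_distrib sum_subtractf)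

lemma matrix_diff_rdistrib: "(A - B) ** C = A ** C - B ** C"
  for A :: "'a::ring_1 ^ 'n ^ 'm"
  by (simp add: vec_eq_iff matrix_matrix_mult_def left_diff_distrib sum_subtractf)

lemma matrix_minus_left: "(- A) ** B = - (A ** B)"
  for A :: "'a::ring_1 ^ 'n ^ 'm"
  by (simp add: vec_eq_iff matrix_matrix_mult_def sum_negf)

lemma matrix_minus_right: "A ** (- B) = - (A ** B)"
  for A :: "'a::ring_1 ^ 'n ^ 'm"
  by (simp add: vec_eq_iff matrix_matrix_mult_def sum_negf)

lemmas matrix_ring = matrix_mul_scaleR_left matrix_mul_scaleR_right matrix_add_ldistrib
  matrix_add_rdistrib matrix_diff_ldistrib matrix_diff_rdistrib matrix_minus_left matrix_minus_right

lemma bounded_bilinear_matrix_mult: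
  "bounded_bilinear ((**) :: 'a::{real_normed_field,euclidean_space}^'n^'m \<Rightarrow> 'a^'p^'n \<Rightarrow> 'a^'p^'m)"
  unfolding bilinear_conv_bounded_bilinear[symmetric] bilinear_def
  by (auto intro!: linearI simp: matrix_ring)

lemmas continuous_on_matrix_mult [continuous_intros] =
  bounded_bilinear.continuous_on [OF bounded_bilinear_matrix_mult]

lemma det_has_derivative:
  fixes A :: "'a::{real_normed_field,euclidean_space}^'n^'n"
  shows "\<exists>D. (det has_derivative D) (at A)"
proof -
  have nth: "((\<lambda>A::'a^'n^'n. A $ i $ j) has_derivative (\<lambda>H. H $ i $ j)) (at A)" for i j
    by (intro bounded_linear_imp_has_derivative bounded_linear_compose[OF bounded_linear_vec_nth]
        bounded_linear_vec_nth)
  show ?thesis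
    unfolding det_def
    by (rule exI, (rule has_derivative_sum has_derivative_mult has_derivative_const
          has_derivative_prod nth)+)
qed

lemma continuous_on_det [continuous_intros]:
  fixes f :: "'b::topological_space \<Rightarrow> 'a::{real_normed_field,euclidean_space}^'n^'n"
  assumes "continuous_on S f" shows "continuous_on S (\<lambda>x. det (f x))"
  unfolding det_def by (intro continuous_intros assms)

section \<open>Determinants under rank-one perturbations\<close>

definition outer :: "real ^ 'm \<Rightarrow> real ^ 'n \<Rightarrow> real ^ 'n ^ 'm" where
  "outer u v = (\<chi> i j. u $ i * v $ j)"

lemma outer_vector: "outer u v *v x = (v \<bullet> x) *\<^sub>R u"
  by (simp add: outer_def matrix_vector_mult_def vec_eq_iff inner_vec_def sum_distrib_left
      sum_distrib_right mult_ac)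

lemma matrix_mult_outer: "A ** outer u v = outer (A *v u) v"
  by (simp add: outer_def matrix_vector_mult_def matrix_matrix_mult_def vec_eq_iff
      sum_distrib_left sum_distrib_right mult_ac)

lemma outer_mult_matrix: "outer u v ** A = outer u (transpose A *v v)"
  by (simp add: outer_def matrix_vector_mult_def matrix_matrix_mult_def transpose_def vec_eq_iff
      sum_distrib_left mult_ac)

text \<open>In a basis whose \<open>k\<close>-th vector is \<open>u\<close> the perturbation affects
  row \<open>k\<close> alone, and the determinant is linear in each row. \<open>A\<close> may be
  singular, as it is at a crossing.\<close>

lemma det_add_rank_one:
  fixes A :: "real ^ 'n ^ 'n"
  shows "\<exists>b. \<forall>s. det (A + s *\<^sub>R outer u v) = det A + s * b"
proof (cases "u = 0")
  case True
  then have "outer u v = 0" by (simp add: outer_def vec_eq_iff)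
  then show ?thesis by (intro exI[of _ 0]) simp
next
  case False
  then obtain k where k: "u $ k \<noteq> 0" by (auto simp: vec_eq_iff)
  \<comment> \<open>The identity with column \<open>k\<close> replaced by \<open>u\<close>, the
    matrix of Cramer's rule: its determinant is \<open>u $ k\<close>.\<close>
  define P :: "real ^ 'n ^ 'n" where
    "P = (\<chi> i j. if j = k then (mat 1 *v u) $ i else mat 1 $ i $ j)"
  have "det P = u $ k" unfolding P_def cramer_lemma by simp
  then have "invertible P" using k by (simp add: invertible_det_nz)
  then obtain Q where Q: "Q ** P = mat 1" "P ** Q = mat 1" by (auto simp: invertible_def)
  have "P *v axis k 1 = u"
    unfolding P_def matrix_vector_mul_lid
    by (simp add: matrix_vector_mult_def axis_def vec_eq_iff if_distrib cong: if_cong)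
  then have Qu: "Q *v u = axis k 1"
    using Q(1) by (metis matrix_vector_mul_assoc matrix_vector_mul_lid)
  define C where "C = Q ** A"
  have A: "A = P ** C" by (simp add: C_def matrix_mul_assoc Q)
  have u: "outer u v = P ** outer (axis k 1) v"
    by (simp add: matrix_mult_outer \<open>P *v axis k 1 = u\<close>)
  have row: "C + s *\<^sub>R outer (axis k 1) v = (\<chi> i. if i = k then C $ i + s *s v else C $ i)" for s
    by (auto simp: vec_eq_iff outer_def axis_def)
  have C: "C = (\<chi> i. if i = k then C $ i else C $ i)"
    by (auto simp: vec_eq_iff)
  have "det (A + s *\<^sub>R outer u v) = det A + s * (det P * det (\<chi> i. if i = k then v else C $ i))" for s
  proof -
    have "det (A + s *\<^sub>R outer u v) = det (P ** (C + s *\<^sub>R outer (axis k 1) v))"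
      by (simp add: A u matrix_ring)
    also have "\<dots> = det P * (det C + s * det (\<chi> i. if i = k then v else C $ i))"
      using C unfolding row det_mul det_row_add det_row_mul by simp
    finally show ?thesis by (simp add: A det_mul algebra_simps)
  qed
  then show ?thesis by blast
qed

section \<open>The symplectic group and transvections\<close>

lemma matrix_vector_mult_minus_left: "(- A) *v x = - (A *v x)"
  for A :: "'a::ring_1 ^ 'n ^ 'm"
  by (simp add: matrix_vector_mult_def vec_eq_iff sum_negf)

lemma matrix_vector_mult_minus_right: "A *v (- x) = - (A *v x)"
  for A :: "'a::ring_1 ^ 'n ^ 'm"
  by (simp add: matrix_vector_mult_def vec_eq_iff sum_negf)

lemma transpose_add: "transpose (A + B) = transpose A + transpose B"
  and transpose_scaleR: "transpose (r *\<^sub>R C) = r *\<^sub>R transpose C"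
  by (simp_all add: transpose_def vec_eq_iff)

lemma J_mat_vector_Inl: "(J_mat *v x) $ Inl k = - x $ Inr k"
  and J_mat_vector_Inr: "(J_mat *v x) $ Inr k = x $ Inl k"
  for x :: "real ^ ('d::finite + 'd)"
  by (auto simp: J_mat_def matrix_vector_mult_def UNIV_Plus_UNIV[symmetric] sum.Plus if_distrib[of "\<lambda>c. c * _"] cong: if_cong simp del: UNIV_Plus_UNIV)

lemma J_mat_mult_J_mat: "J_mat ** J_mat = - mat 1"
proof -
  have "J_mat *v (J_mat *v x) = - x" for x :: "real ^ ('a + 'a)"
    unfolding vec_eq_iff
  proof
    fix i :: "'a + 'a" show "(J_mat *v (J_mat *v x)) $ i = (- x) $ i"
      by (cases i) (simp_all add: J_mat_vector_Inl J_mat_vector_Inr)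
  qed
  then show ?thesis
    by (simp add: matrix_eq matrix_vector_mul_assoc[symmetric] matrix_vector_mult_minus_left)
qed

lemma transpose_J_mat: "transpose J_mat = - J_mat"
  by (auto simp: J_mat_def transpose_def vec_eq_iff split: sum.splits)

lemma inner_matrix_transpose: "(A *v x) \<bullet> y = x \<bullet> (transpose A *v y)"
  for A :: "real ^ 'n ^ 'm"
  using dot_lmul_matrix[of y A x] by (simp add: inner_commute)

lemma inner_J_mat: "(J_mat *v x) \<bullet> y = - (x \<bullet> (J_mat *v y))"
  by (simp add: inner_matrix_transpose transpose_J_mat matrix_vector_mult_minus_left)

lemma J_mat_J_mat_vector: "J_mat *v (J_mat *v x) = - x"
  by (simp add: matrix_vector_mul_assoc J_mat_mult_J_mat matrix_vector_mult_minus_left)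

lemma inner_J_mat_J_mat: "(J_mat *v x) \<bullet> (J_mat *v y) = x \<bullet> y"
  by (simp add: inner_J_mat J_mat_J_mat_vector)

lemma inner_J_mat_self: "x \<bullet> (J_mat *v x) = 0"
  using inner_J_mat[of x x] by (simp add: inner_commute)

lemma Sp_iff: "M \<in> Sp \<longleftrightarrow> transpose M ** J_mat ** M = J_mat"
proof -
  have "invertible M" if "transpose M ** J_mat ** M = J_mat"
  proof -
    have "(- (J_mat ** transpose M ** J_mat)) ** M = mat 1"
      using that
      by (simp add: matrix_minus_left matrix_mul_assoc[symmetric] J_mat_mult_J_mat)
    then show ?thesis by (meson invertible_left_inverse)
  qed
  then show ?thesis by (auto simp: Sp_def)
qed

lemma mat_1_in_Sp: "mat 1 \<in> Sp"
  by (simp add: Sp_iff transpose_mat)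

lemma Sp_mult: "M \<in> Sp \<Longrightarrow> N \<in> Sp \<Longrightarrow> M ** N \<in> Sp"
  by (simp add: Sp_iff matrix_transpose_mul matrix_mul_assoc)
    (simp add: matrix_mul_assoc[symmetric])

lemma Sp_invertible: "M \<in> Sp \<Longrightarrow> invertible M"
  by (simp add: Sp_def)

text \<open>As \<open>J\<close> squares to \<open>-1\<close>, multiplication by \<open>J\<close>
  exchanges the two summands up to sign, which is the recursion of the cosine and sine coefficients.
  In this form the exponential series is summed by two real power series.\<close>

lemma J_power: "((**) (t *\<^sub>R (J_mat :: 'd::finite mat2)) ^^ k) (mat 1) /\<^sub>R fact k
    = (cos_coeff k * t ^ k) *\<^sub>R mat 1 + (sin_coeff k * t ^ k) *\<^sub>R (J_mat :: 'd::finite mat2)"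
proof (induction k)
  case 0 show ?case by simp
next
  case (Suc k)
  have "((**) (t *\<^sub>R (J_mat :: 'd mat2)) ^^ Suc k) (mat 1) /\<^sub>R fact (Suc k)
      = (t / Suc k) *\<^sub>R ((J_mat :: 'd mat2) ** (((**) (t *\<^sub>R (J_mat :: 'd mat2)) ^^ k) (mat 1) /\<^sub>R fact k))"
    by (simp add: matrix_ring divide_simps)
  also have "\<dots> = (t / Suc k) *\<^sub>R ((cos_coeff k * t ^ k) *\<^sub>R (J_mat :: 'd mat2) - (sin_coeff k * t ^ k) *\<^sub>R mat 1)"
    unfolding Suc by (simp add: matrix_ring J_mat_mult_J_mat)
  also have "\<dots> = (cos_coeff (Suc k) * t ^ Suc k) *\<^sub>R mat 1 + (sin_coeff (Suc k) * t ^ Suc k) *\<^sub>R (J_mat :: 'd mat2)"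
    unfolding cos_coeff_Suc sin_coeff_Suc by (simp add: scaleR_diff_right algebra_simps)
  finally show ?case .
qed

lemma mexp_J: "mexp (t *\<^sub>R J_mat) = cos t *\<^sub>R mat 1 + sin t *\<^sub>R J_mat"
proof -
  have "(\<lambda>k. (cos_coeff k * t ^ k) *\<^sub>R mat 1 + (sin_coeff k * t ^ k) *\<^sub>R (J_mat :: 'a mat2)) sums
     (cos t *\<^sub>R mat 1 + sin t *\<^sub>R J_mat)"
    using cos_converges[of t] sin_converges[of t]
    by (intro sums_add bounded_linear.sums[OF bounded_linear_scaleR_left]) simp_all
  then show ?thesis unfolding mexp_def J_power by (simp add: sums_iff)
qed

lemma mexp_J_in_Sp: "mexp (t *\<^sub>R J_mat) \<in> Sp"
proof -
  have "(cos t * cos t) *\<^sub>R J_mat + (sin t * sin t) *\<^sub>R J_mat = (J_mat :: 'a mat2)"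
    by (metis scaleR_left_distrib scaleR_one sin_cos_squared_add3)
  then show ?thesis
    by (simp add: Sp_iff mexp_J transpose_add transpose_scaleR transpose_J_mat transpose_mat matrix_ring
      J_mat_mult_J_mat algebra_simps)
qed

definition transvection :: "real ^ ('d + 'd) \<Rightarrow> real \<Rightarrow> ('d::finite) mat2" where
  "transvection v s = mat 1 + s *\<^sub>R outer (J_mat *v v) v"

lemma transvection_vector: "transvection v s *v x = x + (s * (v \<bullet> x)) *\<^sub>R (J_mat *v v)"
  by (simp add: transvection_def matrix_vector_mult_add_rdistrib outer_vector
      scaleR_matrix_vector_assoc[symmetric])

lemma transvection_0: "transvection v 0 = mat 1"
  by (simp add: transvection_def)

text \<open>\<open>J v\<close> is orthogonal to \<open>v\<close>, so the rank-one part squares to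
  zero and the family is a one-parameter group.\<close>

lemma transvection_add: "transvection v s ** transvection v t = transvection v (s + t)"
  by (simp add: matrix_eq matrix_vector_mul_assoc[symmetric] transvection_vector
      inner_add_right inner_J_mat_self algebra_simps)

lemma transvection_in_Sp: "transvection v s \<in> Sp"
proof -
  have tr: "transpose (transvection v s) = mat 1 + s *\<^sub>R outer v (J_mat *v v)"
    by (simp add: transvection_def transpose_def outer_def vec_eq_iff mat_def)
  have "transpose (transvection v s) *v (J_mat *v (transvection v s *v x)) = J_mat *v x" for x
    by (simp add: tr transvection_vector matrix_vector_mult_add_rdistrib outer_vector
        scaleR_matrix_vector_assoc[symmetric] matrix_vector_right_distrib matrix_vector_mult_scaleR
        matrix_vector_mult_diff_distrib J_mat_J_mat_vector inner_add_right inner_diff_right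
        inner_J_mat_J_mat inner_commute[of "J_mat *v v" v] inner_J_mat_self)
  then show ?thesis by (simp add: Sp_iff matrix_eq matrix_vector_mul_assoc[symmetric])
qed

lemma continuous_on_transvection [continuous_intros]:
  "continuous_on S f \<Longrightarrow> continuous_on S (\<lambda>x. transvection v (f x))"
  unfolding transvection_def by (intro continuous_intros)

section \<open>The radial determinant\<close>

lemma cmat_mult: "cmat (A ** B) = cmat A ** cmat B"
  by (simp add: cmat_def matrix_matrix_mult_def vec_eq_iff)

lemma cmat_add: "cmat (A + B) = cmat A + cmat B"
  and cmat_diff: "cmat (A - B) = cmat A - cmat B"
  and cmat_minus: "cmat (- A) = - cmat A"
  and cmat_scaleR: "cmat (r *\<^sub>R A) = r *\<^sub>R cmat A"
  by (simp_all add: cmat_def vec_eq_iff scaleR_conv_of_real[where 'a=complex])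

lemma cmat_mat: "cmat (mat c) = mat (complex_of_real c)"
  by (simp add: cmat_def vec_eq_iff mat_def)

lemma det_cmat: "det (cmat A) = complex_of_real (det A)"
  by (simp add: det_def cmat_def of_int_eq_id)

lemma linear_cmat: "linear cmat"
  by (rule linearI) (simp_all add: cmat_add cmat_scaleR)

lemma bounded_linear_cmat: "bounded_linear (cmat :: real ^ 'n ^ 'm \<Rightarrow> complex ^ 'n ^ 'm)"
  using linear_cmat linear_conv_bounded_linear by blast

lemmas continuous_on_cmat [continuous_intros] = bounded_linear.continuous_on [OF bounded_linear_cmat]

lemma inner_cmul: "(of_real a * x) \<bullet> y = a * (x \<bullet> y)" "x \<bullet> (of_real a * y) = a * (x \<bullet> y)"
  for x y :: complex
  by (simp_all add: inner_complex_def algebra_simps)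

text \<open>The inner product of complex vectors is here the real part of the Hermitian one, for
  which a complexified real matrix has the complexified transpose as its adjoint.\<close>

lemma inner_cmat: "(cmat A *v x) \<bullet> y = x \<bullet> (cmat (transpose A) *v y)"
proof -
  have "(cmat A *v x) \<bullet> y = (\<Sum>i\<in>UNIV. \<Sum>j\<in>UNIV. A $ i $ j * (x $ j \<bullet> y $ i))"
    by (simp add: inner_vec_def matrix_vector_mult_def cmat_def inner_sum_left inner_cmul)
  also have "\<dots> = (\<Sum>j\<in>UNIV. \<Sum>i\<in>UNIV. A $ i $ j * (x $ j \<bullet> y $ i))"
    by (rule sum.swap)
  also have "\<dots> = x \<bullet> (cmat (transpose A) *v y)"
    by (simp add: inner_vec_def matrix_vector_mult_def cmat_def inner_sum_right inner_cmul transpose_def)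
  finally show ?thesis .
qed

definition cscale :: "complex \<Rightarrow> complex ^ 'n ^ 'm \<Rightarrow> complex ^ 'n ^ 'm" (infixr "*m" 75) where
  "c *m A = (\<chi> i j. c * A $ i $ j)"

lemma cscale_nth: "(c *m A) $ i $ j = c * A $ i $ j"
  by (simp add: cscale_def)

lemma mat_nth: "mat c $ i $ j = (if i = j then c else 0)"
  by (simp add: mat_def)

lemma cscale_mult_left: "(c *m A) ** B = c *m (A ** B)"
  and cscale_mult_right: "A ** (c *m B) = c *m (A ** B)"
  by (simp_all add: vec_eq_iff cscale_nth matrix_matrix_mult_def sum_distrib_left mult_ac)

lemma cscale_cscale: "a *m (b *m A) = (a * b) *m A"
  and cscale_one: "1 *m A = A"
  and cscale_zero: "0 *m A = 0" "c *m 0 = 0"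
  and cscale_add: "c *m (A + B) = c *m A + c *m B"
  and cscale_diff: "c *m (A - B) = c *m A - c *m B"
  and cscale_minus: "c *m (- A) = - (c *m A)"
  by (simp_all add: vec_eq_iff cscale_nth algebra_simps)

lemma cscale_vector: "(c *m A) *v x = c *s (A *v x)"
  by (simp add: vec_eq_iff cscale_nth matrix_vector_mult_def sum_distrib_left mult_ac)

lemmas cmatrix_ring = matrix_ring cscale_mult_left cscale_mult_right cscale_cscale cscale_one
  cscale_zero cscale_add cscale_diff cscale_minus

section \<open>Eigenprojections of \<open>J\<close>, the invariant indefinite form, and the radial
  determinant\<close>

definition Pplus :: "complex ^ ('d::finite + 'd) ^ ('d + 'd)" where
  "Pplus = (1/2) *m (mat 1 - \<i> *m cmat J_mat)"

definition Pminus :: "complex ^ ('d::finite + 'd) ^ ('d + 'd)" where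
  "Pminus = (1/2) *m (mat 1 + \<i> *m cmat J_mat)"

lemma cmat_J_J: "cmat J_mat ** cmat J_mat = - mat 1"
  by (simp add: cmat_mult[symmetric] J_mat_mult_J_mat cmat_minus cmat_mat)

lemma Pplus_idem: "Pplus ** Pplus = Pplus" 
  and Pminus_idem: "Pminus ** Pminus = Pminus"
  and Pplus_Pminus: "Pplus ** Pminus = 0"
  and Pminus_Pplus: "Pminus ** Pplus = 0"
  by (simp_all add: Pplus_def Pminus_def cmatrix_ring cmat_J_J)
    (simp_all add: vec_eq_iff cscale_nth mat_nth field_simps)

lemma Pplus_add_Pminus: "Pplus + Pminus = mat 1"
  by (simp add: Pplus_def Pminus_def vec_eq_iff cscale_nth mat_nth field_simps)

lemma cmat_J_eq: "cmat J_mat = \<i> *m (Pplus - Pminus)"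
  by (simp add: Pplus_def Pminus_def vec_eq_iff cscale_nth mat_nth field_simps)

text \<open>With \<open>w = M v\<close>, the two brackets send \<open>v\<close> to
  \<open>Pplus v + Pminus w\<close> and to \<open>Pplus w + Pminus v\<close>. The unitary transform
  \<open>S\<close> is the second after the inverse of the first, so the determinant equals
  \<open>radial_det 0 M * det (1 - r S)\<close>.\<close>

definition radial_matrix :: "complex \<Rightarrow> ('d::finite) mat2 \<Rightarrow> complex ^ ('d + 'd) ^ ('d + 'd)" where
  "radial_matrix r M = (Pplus + Pminus ** cmat M) - r *m (Pplus ** cmat M + Pminus)"

definition radial_det :: "complex \<Rightarrow> ('d::finite) mat2 \<Rightarrow> complex" where
  "radial_det r M = det (radial_matrix r M)"

text \<open>\<open>\<i> J\<close> is Hermitian, with eigenvalue \<open>-1\<close> on the range of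
  \<open>Pplus\<close> and \<open>1\<close> on that of \<open>Pminus\<close>. Expressed through
  \<open>J\<close>, the form is open to the symplectic identity.\<close>

lemma P_form:
  "(norm (Pplus *v v))\<^sup>2 - (norm (Pminus *v v))\<^sup>2 = - (v \<bullet> (\<i> *s (cmat J_mat *v v)))"
proof -
  define y where "y = \<i> *s (cmat J_mat *v v)"
  have "Pplus *v v = (1/2) *\<^sub>R (v - y)" "Pminus *v v = (1/2) *\<^sub>R (v + y)"
    by (simp_all add: Pplus_def Pminus_def y_def vec_eq_iff scaleR_conv_of_real[where 'a=complex] diff_divide_distrib add_divide_distrib
        matrix_vector_mult_add_rdistrib matrix_vector_mult_diff_rdistrib matrix_vector_mul_assoc[symmetric] cscale_vector)
  moreover have "(norm ((1/2) *\<^sub>R x))\<^sup>2 = (x \<bullet> x) / 4" for x :: "complex ^ ('a + 'a)"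
    by (simp add: power_divide power2_norm_eq_inner)
  ultimately show ?thesis unfolding y_def[symmetric]
    by (simp only: inner_diff_left inner_diff_right inner_add_left inner_add_right)
      (simp add: inner_commute field_simps)
qed

lemma P_form_Sp:
  assumes "M \<in> Sp"
  shows "(norm (Pplus *v (cmat M *v v)))\<^sup>2 - (norm (Pminus *v (cmat M *v v)))\<^sup>2
    = (norm (Pplus *v v))\<^sup>2 - (norm (Pminus *v v))\<^sup>2"
proof -
  have com: "cmat A *v (\<i> *s x) = \<i> *s (cmat A *v x)" for A x
    by (simp add: vector_scalar_commute)
  have "cmat (transpose M) *v (cmat J_mat *v (cmat M *v v)) = cmat J_mat *v v"
    using assms by (simp add: matrix_vector_mul_assoc cmat_mult[symmetric] Sp_iff matrix_mul_assoc)
  then show ?thesis unfolding P_form by (simp add: inner_cmat com)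
qed

text \<open>For a kernel vector \<open>v\<close> and \<open>w = M v\<close>, projecting gives
  \<open>Pplus v = r Pplus w\<close> and \<open>Pminus w = r Pminus v\<close>. The invariant form
  says that the squared norms of the two left sides add up to those of \<open>Pplus w\<close> and
  \<open>Pminus v\<close>, which for \<open>|r| < 1\<close> is possible only if all four
  vanish.\<close>

lemma radial_det_nonzero:
  assumes M: "M \<in> Sp" and r: "norm r < 1"
  shows "radial_det r M \<noteq> 0"
proof -
  have "v = 0" if v: "radial_matrix r M *v v = 0" for v
  proof -
    define w where "w = cmat M *v v"
    have eq: "Pplus *v v + Pminus *v w = r *s (Pplus *v w + Pminus *v v)"
      using v by (simp add: radial_matrix_def w_def matrix_vector_mult_add_rdistrib cscale_vector
          matrix_vector_mult_diff_rdistrib matrix_vector_mul_assoc[symmetric])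
    have 1: "Pplus *v v = r *s (Pplus *v w)"
      using arg_cong[OF eq, of "(*v) Pplus"]
      by (simp add: matrix_vector_right_distrib matrix_vector_mul_assoc Pplus_idem Pplus_Pminus
          vector_scalar_commute[symmetric])
    have 2: "Pminus *v w = r *s (Pminus *v v)"
      using arg_cong[OF eq, of "(*v) Pminus"]
      by (simp add: matrix_vector_right_distrib matrix_vector_mul_assoc Pminus_idem Pminus_Pplus
          vector_scalar_commute[symmetric])
    have n: "norm (c *s x) = norm c * norm x" for c and x :: "complex ^ ('a + 'a)"
      by (simp add: norm_vec_def L2_set_def norm_mult power_mult_distrib sum_distrib_left[symmetric]
          real_sqrt_mult)
    have "(norm (Pplus *v v))\<^sup>2 = (norm r)\<^sup>2 * (norm (Pplus *v w))\<^sup>2"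
      by (simp only: 1 n power_mult_distrib)
    moreover have "(norm (Pminus *v w))\<^sup>2 = (norm r)\<^sup>2 * (norm (Pminus *v v))\<^sup>2"
      by (simp only: 2 n power_mult_distrib)
    ultimately have "(1 - (norm r)\<^sup>2) * ((norm (Pplus *v w))\<^sup>2 + (norm (Pminus *v v))\<^sup>2) = 0"
      using P_form_Sp[OF M, of v, folded w_def]
      unfolding left_diff_distrib distrib_left by linarith
    moreover have "(norm r)\<^sup>2 < 1" using r by (simp add: abs_square_less_1)
    ultimately have "Pplus *v w = 0" "Pminus *v v = 0"
      by (auto simp: add_nonneg_eq_0_iff)
    with 1 have "(Pplus + Pminus) *v v = 0"
      by (simp add: matrix_vector_mult_add_rdistrib)
    then show "v = 0" by (simp add: Pplus_add_Pminus)
  qed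
  then have "invertible (radial_matrix r M)"
    by (metis invertible_left_inverse matrix_left_invertible_ker)
  then show ?thesis by (simp add: radial_det_def invertible_det_nz)
qed

text \<open>For \<open>|r| = 1\<close> the matrix in front of \<open>cmat M\<close> is a rotation
  \<open>exp (tJ)\<close>, so zeros on the unit circle are the angles at which the rotated matrix
  has eigenvalue 1.\<close>

lemma radial_matrix_factor:
  fixes M :: "('d::finite) mat2"
  assumes "r \<noteq> 0"
  shows "radial_matrix r M = (r *m Pminus - Pplus) ** ((r *m Pplus + (1 / r) *m Pminus) ** cmat M - mat 1)"
proof -
  have "(r *m Pminus - Pplus :: complex ^ ('d + 'd) ^ ('d + 'd)) ** (r *m Pplus + (1 / r) *m Pminus) = Pminus - r *m Pplus"
    using assms by (simp add: cmatrix_ring Pplus_idem Pminus_idem Pplus_Pminus Pminus_Pplus)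
  then have "(r *m Pminus - Pplus) ** ((r *m Pplus + (1 / r) *m Pminus) ** cmat M - mat 1)
    = (Pminus - r *m Pplus) ** cmat M - (r *m Pminus - Pplus)"
    by (simp add: matrix_diff_ldistrib matrix_mul_assoc)
  then show ?thesis by (simp add: radial_matrix_def cmatrix_ring)
qed

text \<open>The value is \<open>(-1) ^ d\<close>: the matrix is \<open>-1\<close> on the
  \<open>d\<close>-dimensional range of \<open>Pplus\<close> and \<open>1\<close> on the
  complementary eigenspace.\<close>

definition reflection_sign :: "'d::finite itself \<Rightarrow> real" where
  "reflection_sign _ = Re (det (Pminus - Pplus :: complex ^ ('d + 'd) ^ ('d + 'd)))"

lemma reflection_sign: "det (Pminus - Pplus :: complex ^ ('d::finite + 'd) ^ ('d + 'd)) = of_real (reflection_sign TYPE('d))"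
  "reflection_sign TYPE('d) = 1 \<or> reflection_sign TYPE('d) = - 1"
proof -
  let ?E = "Pminus - Pplus :: complex ^ ('d::finite + 'd) ^ ('d + 'd)"
  have "?E ** ?E = mat 1"
    by (simp add: matrix_ring Pplus_idem Pminus_idem Pplus_Pminus Pminus_Pplus Pplus_add_Pminus add.commute[of Pminus])
  then have "det ?E * det ?E = 1" by (metis det_I det_mul)
  then have "det ?E = 1 \<or> det ?E = -1" by (simp add: square_eq_1_iff)
  then show "det ?E = of_real (reflection_sign TYPE('d))" "reflection_sign TYPE('d) = 1 \<or> reflection_sign TYPE('d) = - 1"
    by (auto simp: reflection_sign_def)
qed

lemma radial_det_1: "radial_det 1 M = of_real (reflection_sign TYPE('d) * det (M - mat 1))" for M :: "('d::finite) mat2"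
proof -
  have "radial_matrix 1 M = (Pminus - Pplus) ** cmat (M - mat 1)"
    by (simp add: radial_matrix_factor cscale_one Pplus_add_Pminus cmat_diff cmat_mat)
  then show ?thesis by (simp add: radial_det_def det_mul reflection_sign det_cmat)
qed

lemma rot_cis: "cis t *m Pplus + (1 / cis t) *m Pminus = cmat (mexp (t *\<^sub>R J_mat) :: ('d::finite) mat2)"
proof -
  have *: "1 / cis t = cis (- t)" by (simp add: cis_inverse[symmetric] inverse_eq_divide)
  have "cmat (mexp (t *\<^sub>R J_mat) :: 'd mat2) = cos t *\<^sub>R (Pplus + Pminus) + sin t *\<^sub>R (\<i> *m (Pplus - Pminus))"
    by (simp add: mexp_J cmat_add cmat_scaleR cmat_mat cmat_J_eq Pplus_add_Pminus)
  then show ?thesis unfolding *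
    by (simp add: vec_eq_iff cscale_nth mat_nth cis.code Complex_eq scaleR_conv_of_real[where 'a=complex] algebra_simps)
qed

lemma radial_det_cis: "radial_det (cis t) M = det (cis t *m Pminus - Pplus :: complex ^ ('d::finite + 'd) ^ ('d + 'd)) * of_real (det (mexp (t *\<^sub>R J_mat) ** M - mat 1))"
  for M :: "('d::finite) mat2"
  by (simp add: radial_det_def radial_matrix_factor[of "cis t"] rot_cis det_mul cmat_mult[symmetric])
    (simp add: det_cmat[symmetric] cmat_diff cmat_mat)

lemma det_rot_commute: "det (mexp (t *\<^sub>R J_mat) ** M - mat 1) = det (M ** mexp (t *\<^sub>R J_mat) - mat 1)"
  for M :: "('d::finite) mat2"
proof -
  let ?R = "mexp (t *\<^sub>R J_mat) :: 'd mat2"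
  have "(?R ** M - mat 1) ** ?R = ?R ** (M ** ?R - mat 1)"
    by (simp add: matrix_ring matrix_mul_assoc)
  from arg_cong[OF this, of det] have "det (?R ** M - mat 1) * det ?R = det ?R * det (M ** ?R - mat 1)"
    by (simp add: det_mul)
  moreover have "det ?R \<noteq> 0"
    using Sp_invertible[OF mexp_J_in_Sp] by (simp add: invertible_det_nz)
  ultimately show ?thesis by simp
qed

text \<open>A rotation multiplies the \<open>Pminus\<close> block by a phase only, hence the value
  at \<open>r = 0\<close> by a factor independent of \<open>M\<close>. The small rotation in the
  definition of \<open>iota\<close> thus leaves the variation of the argument at
  \<open>r = 0\<close> unchanged.\<close>

lemma radial_det_0_rot: "radial_det 0 (mexp (t *\<^sub>R J_mat) ** M) = det (Pplus + (1 / cis t) *m Pminus :: complex ^ ('d + 'd) ^ ('d + 'd)) * radial_det 0 M"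
  for M :: "('d::finite) mat2"
proof -
  have "radial_matrix 0 (mexp (t *\<^sub>R J_mat) ** M) = (Pplus + (1 / cis t) *m Pminus) ** radial_matrix 0 M"
    by (simp add: radial_matrix_def cmat_mult rot_cis[symmetric] cmatrix_ring matrix_mul_assoc Pplus_idem 
        Pminus_idem Pplus_Pminus Pminus_Pplus)
  then show ?thesis by (simp add: radial_det_def det_mul)
qed

lemma det_polynomial:
  fixes X Y :: "complex ^ 'n ^ 'n"
  shows "\<exists>p. degree p \<le> CARD('n) \<and> (\<forall>r. det (X - r *m Y) = poly p r)"
proof -
  define p where "p = (\<Sum>q\<in>{q. q permutes UNIV}. smult (of_int (sign q)) (\<Prod>i\<in>(UNIV::'n set). [:X $ i $ q i, - Y $ i $ q i:]))"
  have "degree (\<Prod>i\<in>(UNIV::'n set). [:X $ i $ q i, - Y $ i $ q i:]) \<le> CARD('n)" for q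
  proof -
    have "degree (\<Prod>i\<in>(UNIV::'n set). [:X $ i $ q i, - Y $ i $ q i:]) \<le> (\<Sum>i\<in>(UNIV::'n set). degree [:X $ i $ q i, - Y $ i $ q i:])"
      using degree_prod_sum_le[of UNIV "\<lambda>i::'n. [:X $ i $ q i, - Y $ i $ q i:]"] by (simp add: o_def)
    also have "\<dots> \<le> (\<Sum>i\<in>(UNIV::'n set). 1)" by (intro sum_mono) simp
    finally show ?thesis by simp
  qed
  then have "degree p \<le> CARD('n)" unfolding p_def
    by (intro degree_sum_le) (auto intro: order_trans[OF degree_smult_le])
  moreover have "det (X - r *m Y) = poly p r" for r
    by (simp add: p_def det_def poly_sum poly_prod cscale_nth mat_nth)
  ultimately show ?thesis by blast
qed

lemma radial_det_polynomial: "\<exists>p. degree p \<le> CARD('d + 'd) \<and> (\<forall>r. radial_det r M = poly p r)"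
  for M :: "('d::finite) mat2"
  unfolding radial_det_def radial_matrix_def by (rule det_polynomial)

lemma continuous_on_cscale [continuous_intros]:
  "continuous_on S f \<Longrightarrow> continuous_on S g \<Longrightarrow> continuous_on S (\<lambda>x. f x *m g x)"
  unfolding cscale_def by (intro continuous_intros)

lemma continuous_on_radial_det [continuous_intros]:
  "continuous_on S f \<Longrightarrow> continuous_on S g \<Longrightarrow> continuous_on S (\<lambda>x. radial_det (f x) (g x))"
  unfolding radial_det_def radial_matrix_def by (intro continuous_intros)

lemma Sp0_iff: "M \<in> Sp0 1 \<longleftrightarrow> M \<in> Sp \<and> det (M - mat 1) = 0"
  using det_cmat[of "M - mat 1"] by (simp add: Sp0_def cmat_diff cmat_mat)

lemma sp_det_1: "sp_det 1 M = det (M - mat 1)"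
  using det_cmat[of "M - mat 1"] by (simp add: sp_det_def cmat_diff cmat_mat)

text \<open>The radial determinant is a polynomial in \<open>r\<close>, nonzero because its value at
  \<open>r = 0\<close> is. For small \<open>e > 0\<close> the point \<open>cis (- e)\<close> is
  close to 1 but different from it, hence avoids the finitely many roots.\<close>

lemma eventually_rot_notin_Sp0:
  assumes "M \<in> Sp"
  shows "\<forall>\<^sub>F e in at_right 0. det (mexp (- e *\<^sub>R J_mat) ** M - mat 1) \<noteq> 0"
proof -
  obtain p where p: "\<And>r. radial_det r M = poly p r" using radial_det_polynomial[of M] by blast
  have "p \<noteq> 0" using radial_det_nonzero[OF assms, of 0] p by auto
  then have "finite {r. poly p r = 0}" by (rule poly_roots_finite)
  then have "\<forall>\<^sub>F r in at 1. r \<notin> {r. poly p r = 0}"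
    by (metis finite_imp_closed islimpt_finite islimpt_iff_eventually)
  moreover have "filterlim (\<lambda>e. cis (- e)) (at 1) (at_right 0)"
  proof (rule filterlim_atI)
    have "isCont (\<lambda>e. Complex (cos (- e)) (sin (- e))) 0"
      unfolding Complex_eq by (intro continuous_intros)
    then have "isCont (\<lambda>e. cis (- e)) 0" by (simp add: cis.ctr)
    then show "((\<lambda>e. cis (- e)) \<longlongrightarrow> 1) (at_right 0)"
      by (auto simp: isCont_def intro: tendsto_mono[OF at_le])
    have "cis (- e) \<noteq> 1" if "0 < e" "e < 1" for e
    proof
      assume "cis (- e) = 1"
      then have "sin e = 0" by (simp add: complex_eq_iff)
      moreover have "sin e > 0" using that pi_gt3 by (intro sin_gt_zero) auto
      ultimately show False by simp
    qed
    then show "\<forall>\<^sub>F e in at_right 0. cis (- e) \<noteq> 1"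
      by (auto simp: eventually_at_right_field intro: exI[of _ 1])
  qed
  ultimately have "\<forall>\<^sub>F e in at_right 0. radial_det (cis (- e)) M \<noteq> 0"
    by (auto simp: p filterlim_iff)
  then show ?thesis by eventually_elim (auto simp: radial_det_cis simp del: scaleR_minus_left)
qed

section \<open>The crossing index\<close>

lemma exp_const_imp_constant_on:
  fixes f :: "'a::topological_space \<Rightarrow> complex"
  assumes "connected S" "continuous_on S f" "\<And>x y. x \<in> S \<Longrightarrow> y \<in> S \<Longrightarrow> exp (f x) = exp (f y)"
  shows "f constant_on S"
proof (rule continuous_discrete_range_constant[OF assms(1,2)])
  fix x assume x: "x \<in> S"
  have "2 * pi \<le> norm (f y - f x)" if "y \<in> S" "f y \<noteq> f x" for y
  proof -
    from assms(3)[OF that(1) x] obtain n :: int where n: "f y = f x + (of_int (2 * n) * pi) * \<i>"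
      unfolding exp_eq by blast
    with that have "n \<noteq> 0" by auto
    then have "1 \<le> \<bar>real_of_int n\<bar>" by linarith
    then show ?thesis by (simp add: n norm_mult)
  qed
  then show "\<exists>e>0. \<forall>y. y \<in> S \<and> f y \<noteq> f x \<longrightarrow> e \<le> norm (f y - f x)"
    by (intro exI[of _ "2 * pi"]) auto
qed

text \<open>Reality of the exponential confines the imaginary part to multiples of pi, a discrete
  set. On the edge \<open>r = 1\<close> this freezes the argument as long as the hypersurface is not
  met.\<close>

lemma exp_real_imp_Im_constant:
  fixes f :: "'a::topological_space \<Rightarrow> complex"
  assumes "connected S" "continuous_on S f" "\<And>x. x \<in> S \<Longrightarrow> exp (f x) \<in> \<real>"
    and "x \<in> S" "y \<in> S"
  shows "Im (f x) = Im (f y)"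
proof -
  have "exp (2 * \<i> * of_real (Im (f x))) = 1" if "x \<in> S" for x
  proof -
    have "sin (Im (f x)) = 0"
      using assms(3)[OF that] by (simp add: complex_is_Real_iff Im_exp)
    then obtain n :: int where "Im (f x) = of_int n * pi" unfolding sin_zero_iff_int2 by blast
    then show ?thesis unfolding exp_eq_1 by (auto intro!: exI[of _ n])
  qed
  then have "(\<lambda>x. 2 * \<i> * of_real (Im (f x))) constant_on S"
    using assms(1,2) by (intro exp_const_imp_constant_on continuous_intros) auto
  then obtain c where "\<And>x. x \<in> S \<Longrightarrow> 2 * \<i> * of_real (Im (f x)) = c" unfolding constant_on_def by blast
  from this[OF assms(4)] this[OF assms(5)]
  have "2 * \<i> * complex_of_real (Im (f x)) = 2 * \<i> * of_real (Im (f y))" by simp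
  then show ?thesis by simp
qed

text \<open>Along a symplectic path the radial determinant can vanish only on the edge
  \<open>r = 1\<close>, of which just the times in \<open>T\<close>, meant to be regular, are kept.
  Scaling towards the origin pushes \<open>r\<close> below 1, so the set is starlike for every
  \<open>T\<close>.\<close>

definition slit_square :: "real set \<Rightarrow> (real \<times> real) set" where
  "slit_square T = {(r, t). 0 \<le> r \<and> r \<le> 1 \<and> 0 \<le> t \<and> t \<le> 1 \<and> (r < 1 \<or> t \<in> T)}"

lemma slit_square_segment:
  assumes "z \<in> slit_square T" shows "closed_segment (0, 0) z \<subseteq> slit_square T"
proof
  fix w assume "w \<in> closed_segment (0, 0) z"
  then obtain u where u: "0 \<le> u" "u \<le> 1" "w = u *\<^sub>R z" 
    by (auto simp: closed_segment_def zero_prod_def[symmetric])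
  obtain r t where z: "z = (r, t)" by fastforce
  have "0 \<le> r" "r \<le> 1" "0 \<le> t" "t \<le> 1" "r < 1 \<or> t \<in> T"
    using assms by (auto simp: slit_square_def z)
  moreover from this u have "u * r \<le> 1 * 1" "u * t \<le> 1 * 1" by (intro mult_mono; simp)+
  moreover have "u * r < 1" if "u < 1"
    using that \<open>r \<le> 1\<close> u mult_left_le[of r u] by linarith
  ultimately show "w \<in> slit_square T"
    using u by (cases "u = 1") (auto simp: slit_square_def z)
qed

lemma zero_in_slit_square: "(0, 0) \<in> slit_square T"
  by (simp add: slit_square_def)

lemma starlike_slit_square: "starlike (slit_square T)"
  unfolding starlike_def using slit_square_segment zero_in_slit_square by blast

lemma starlike_Times_slit_square:
  assumes "convex S" "a \<in> S" shows "starlike (S \<times> slit_square T)"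
  unfolding starlike_def
proof (intro bexI ballI)
  show "(a, 0, 0) \<in> S \<times> slit_square T" using assms zero_in_slit_square by auto
  fix x assume x: "x \<in> S \<times> slit_square T"
  obtain s z where [simp]: "x = (s, z)" by (cases x)
  show "closed_segment (a, 0, 0) x \<subseteq> S \<times> slit_square T"
  proof
    fix w assume w: "w \<in> closed_segment (a, 0, 0) x"
    obtain s' z' where [simp]: "w = (s', z')" by (cases w)
    from w have "s' \<in> closed_segment a s" "z' \<in> closed_segment (0, 0) z"
      using closed_segment_PairD by fastforce+
    with x show "w \<in> S \<times> slit_square T"
      using slit_square_segment[of z T] closed_segment_subset[OF assms(2) _ assms(1), of s] by auto
  qed
qed

definition is_radial_log :: "real set \<Rightarrow> (real \<Rightarrow> ('d::finite) mat2) \<Rightarrow> (real \<times> real \<Rightarrow> complex) \<Rightarrow> bool" where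
  "is_radial_log T q L \<longleftrightarrow> continuous_on (slit_square T) L \<and>
     (\<forall>(r, t) \<in> slit_square T. radial_det (of_real r) (q t) = exp (L (r, t)))"

lemma is_radial_logD: "is_radial_log T q L \<Longrightarrow> (r, t) \<in> slit_square T \<Longrightarrow> radial_det (of_real r) (q t) = exp (L (r, t))"
  unfolding is_radial_log_def by blast

text \<open>The order of the difference reflects that a positive crossing lowers the argument by
  pi.\<close>

definition crossing_index :: "(real \<Rightarrow> ('d::finite) mat2) \<Rightarrow> real" where
  "crossing_index q = (THE x. \<exists>L. is_radial_log {0, 1} q L \<and> x = (Im (L (1, 0)) - Im (L (1, 1))) / pi)"

lemma crossing_index_eq:
  assumes "is_radial_log {0, 1} q L" shows "crossing_index q = (Im (L (1, 0)) - Im (L (1, 1))) / pi"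
  unfolding crossing_index_def
proof (rule the_equality)
  fix x assume "\<exists>L. is_radial_log {0, 1} q L \<and> x = (Im (L (1, 0)) - Im (L (1, 1))) / pi"
  then obtain L' where L': "is_radial_log {0, 1} q L'" "x = (Im (L' (1, 0)) - Im (L' (1, 1))) / pi" by blast
  have "(\<lambda>z. L' z - L z) constant_on slit_square {0, 1}"
  proof (rule exp_const_imp_constant_on)
    show "connected (slit_square {0, 1})" by (intro starlike_imp_connected starlike_slit_square)
    show "continuous_on (slit_square {0, 1}) (\<lambda>z. L' z - L z)"
      using assms L' by (auto simp: is_radial_log_def intro!: continuous_intros)
    have "exp (L' z - L z) = 1" if "z \<in> slit_square {0, 1}" for z
      using is_radial_logD[OF assms, of "fst z" "snd z"] is_radial_logD[OF L'(1), of "fst z" "snd z"] that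
      by (simp add: exp_diff)
    then show "\<And>z w. z \<in> slit_square {0, 1} \<Longrightarrow> w \<in> slit_square {0, 1} \<Longrightarrow> exp (L' z - L z) = exp (L' w - L w)"
      by auto
  qed
  then obtain c where "\<And>z. z \<in> slit_square {0, 1} \<Longrightarrow> L' z - L z = c"
    unfolding constant_on_def by blast
  from this[of "(1, 0)"] this[of "(1, 1)"] have "L' (1, 0) = L (1, 0) + c" "L' (1, 1) = L (1, 1) + c"
    by (auto simp: slit_square_def algebra_simps)
  then show "x = (Im (L (1, 0)) - Im (L (1, 1))) / pi" by (simp add: L')
qed (use assms in blast)

lemma is_radial_log_subset: "is_radial_log T q L \<Longrightarrow> T' \<subseteq> T \<Longrightarrow> is_radial_log T' q L"
  unfolding is_radial_log_def slit_square_def by (auto elim!: continuous_on_subset)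

lemma radial_det_nonzero_le1:
  assumes "M \<in> Sp" "0 \<le> r" "r \<le> 1" "r < 1 \<or> det (M - mat 1) \<noteq> 0"
  shows "radial_det (complex_of_real r) M \<noteq> 0"
proof (cases "r < 1")
  case True then show ?thesis using radial_det_nonzero[OF assms(1), of "of_real r"] assms(2) by simp
next
  case False then show ?thesis using assms reflection_sign(2)[where 'd='a] by (auto simp: radial_det_1)
qed

text \<open>The parameter \<open>s\<close> lets one continuous logarithm serve a whole homotopy; for
  a single path the dependence on \<open>s\<close> is constant.\<close>

lemma ex_log_param:
  fixes H :: "real \<times> real \<Rightarrow> ('d::finite) mat2"
  assumes S: "convex S" "a \<in> S" and H: "continuous_on (S \<times> {0..1}) H" "H ` (S \<times> {0..1}) \<subseteq> Sp"
    and T: "\<And>s t. s \<in> S \<Longrightarrow> t \<in> T \<inter> {0..1} \<Longrightarrow> det (H (s, t) - mat 1) \<noteq> 0"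
  obtains L where "continuous_on (S \<times> slit_square T) L"
    "\<And>s r t. s \<in> S \<Longrightarrow> (r, t) \<in> slit_square T \<Longrightarrow> radial_det (of_real r) (H (s, t)) = exp (L (s, r, t))"
proof -
  let ?f = "\<lambda>z. radial_det (of_real (fst (snd z))) (H (fst z, snd (snd z)))"
  have "continuous_on (S \<times> slit_square T) ?f"
  proof (intro continuous_intros)
    show "continuous_on (S \<times> slit_square T) (\<lambda>x. H (fst x, snd (snd x)))"
      by (rule continuous_on_compose2[OF H(1)]) (auto intro!: continuous_intros simp: slit_square_def)
  qed
  moreover have "?f z \<noteq> 0" if "z \<in> S \<times> slit_square T" for z
    using that T H(2) by (intro radial_det_nonzero_le1) (auto simp: slit_square_def)
  ultimately obtain L where L: "continuous_on (S \<times> slit_square T) L"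
    "\<And>z. z \<in> S \<times> slit_square T \<Longrightarrow> ?f z = exp (L z)"
    by (rule continuous_logarithm_on_contractible
      [OF _ starlike_imp_contractible[OF starlike_Times_slit_square[OF S]]]) blast+
  show ?thesis
  proof (rule that[OF L(1)])
    fix s r t assume "s \<in> S" "(r, t) \<in> slit_square T"
    then show "radial_det (of_real r) (H (s, t)) = exp (L (s, r, t))" using L(2)[of "(s, r, t)"] by simp
  qed
qed

lemma is_radial_log_slice:
  assumes "continuous_on (S \<times> slit_square T) L" "s \<in> S"
    "\<And>r t. (r, t) \<in> slit_square T \<Longrightarrow> radial_det (of_real r) (H (s, t)) = exp (L (s, r, t))"
  shows "is_radial_log T (\<lambda>t. H (s, t)) (\<lambda>z. L (s, z))"
  unfolding is_radial_log_def using assms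
  by (auto intro!: continuous_on_compose2[OF assms(1)] continuous_intros)

lemma ex_log:
  assumes "path q" "path_image q \<subseteq> Sp" "\<And>t. t \<in> T \<inter> {0..1} \<Longrightarrow> det (q t - mat 1) \<noteq> 0"
  obtains L where "is_radial_log T q L"
proof -
  have "continuous_on (UNIV \<times> {0..1}) (\<lambda>z :: real \<times> real. q (snd z))"
    using assms(1) unfolding path_def
    by (rule continuous_on_compose2) (auto intro!: continuous_intros)
  moreover have "(\<lambda>z :: real \<times> real. q (snd z)) ` (UNIV \<times> {0..1}) \<subseteq> Sp"
    using assms(2) by (auto simp: path_image_def)
  ultimately obtain L :: "real \<times> real \<times> real \<Rightarrow> complex" where "continuous_on (UNIV \<times> slit_square T) L"
    "\<And>s r t. s \<in> UNIV \<Longrightarrow> (r, t) \<in> slit_square T \<Longrightarrow> radial_det (of_real r) (q (snd (s, t))) = exp (L (s, r, t))"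
    by (rule ex_log_param[OF convex_UNIV UNIV_I, of _ T]) (use assms(3) in auto)
  from is_radial_log_slice[OF this(1) UNIV_I[of 0] this(2)[OF UNIV_I]] show ?thesis using that by simp
qed

text \<open>The end points may move as long as they stay regular: at \<open>r = 1\<close> the radial
  determinant is real and nonzero there, so its argument cannot change. This covers the variation of
  epsilon as well as homotopies with fixed ends.\<close>

lemma crossing_index_homotopy:
  fixes H :: "real \<times> real \<Rightarrow> ('d::finite) mat2"
  assumes S: "convex S" "a \<in> S" "b \<in> S"
    and H: "continuous_on (S \<times> {0..1}) H" "H ` (S \<times> {0..1}) \<subseteq> Sp"
    and e: "\<And>s. s \<in> S \<Longrightarrow> det (H (s, 0) - mat 1) \<noteq> 0" "\<And>s. s \<in> S \<Longrightarrow> det (H (s, 1) - mat 1) \<noteq> 0"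
  shows "crossing_index (\<lambda>t. H (a, t)) = crossing_index (\<lambda>t. H (b, t))"
proof -
  obtain L where L: "continuous_on (S \<times> slit_square {0, 1}) L"
    "\<And>s r t. s \<in> S \<Longrightarrow> (r, t) \<in> slit_square {0, 1} \<Longrightarrow> radial_det (of_real r) (H (s, t)) = exp (L (s, r, t))"
    using ex_log_param[OF S(1,2) H, of "{0, 1}"] e by auto
  have eq: "Im (L (a, 1, t)) = Im (L (b, 1, t))" if t: "t \<in> {0, 1}" for t
  proof (rule exp_real_imp_Im_constant[where f="\<lambda>s. L (s, 1, t)" and S=S])
    show "connected S" using S(1) by (rule convex_connected)
    show "continuous_on S (\<lambda>s. L (s, 1, t))"
      using t by (intro continuous_on_compose2[OF L(1)] continuous_intros) (auto simp: slit_square_def)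
    show "exp (L (s, 1, t)) \<in> \<real>" if "s \<in> S" for s
      using L(2)[OF that, of 1 t, symmetric] t by (auto simp: slit_square_def radial_det_1)
  qed (use S in auto)
  have "is_radial_log {0, 1} (\<lambda>t. H (s, t)) (\<lambda>z. L (s, z))" if "s \<in> S" for s
    using L that by (intro is_radial_log_slice) auto
  from crossing_index_eq[OF this[OF S(2)]] crossing_index_eq[OF this[OF S(3)]] show ?thesis
    using eq[of 0] eq[of 1] by simp
qed

lemma is_radial_log_cong: "(\<And>t. t \<in> {0..1} \<Longrightarrow> p t = q t) \<Longrightarrow> is_radial_log T p L = is_radial_log T q L"
  unfolding is_radial_log_def slit_square_def by (intro conj_cong ball_cong) auto

lemma crossing_index_cong: "(\<And>t. t \<in> {0..1} \<Longrightarrow> p t = q t) \<Longrightarrow> crossing_index p = crossing_index q"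
  unfolding crossing_index_def using is_radial_log_cong[of p q "{0,1}"] by simp

lemma crossing_index_homotopic_paths:
  assumes "homotopic_paths Sp p q" "det (p 0 - mat 1) \<noteq> 0" "det (p 1 - mat 1) \<noteq> 0"
  shows "crossing_index p = crossing_index q"
proof -
  obtain h :: "real \<times> real \<Rightarrow> _" where h: "continuous_on ({0..1} \<times> {0..1}) h" "h \<in> {0..1} \<times> {0..1} \<rightarrow> Sp"
    "\<forall>x \<in> {0..1}. h (0, x) = p x" "\<forall>x \<in> {0..1}. h (1, x) = q x"
    "\<forall>t \<in> {0..1}. h (t, 0) = p 0 \<and> h (t, 1) = p 1"
    using assms(1) unfolding homotopic_paths pathstart_def pathfinish_def o_def by blast
  have "crossing_index (\<lambda>t. h (0, t)) = crossing_index (\<lambda>t. h (1, t))"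
    using h(1,2,5) assms(2,3) by (intro crossing_index_homotopy[where S="{0..1}"]) (auto simp: image_subset_iff_funcset)
  then show ?thesis using crossing_index_cong[of "\<lambda>t. h (0, t)" p] crossing_index_cong[of "\<lambda>t. h (1, t)" q] h(3,4) by simp
qed

section \<open>Local computation at a transverse crossing\<close>

lemma has_vector_derivative_cis: "(cis has_vector_derivative (\<i> * cis t)) (at t)"
proof -
  have "((\<lambda>t. exp (\<i> * of_real t)) has_vector_derivative (of_real 1 * (\<i> * exp (\<i> * of_real t)))) (at t)"
    by (auto intro!: derivative_eq_intros has_vector_derivative_real_field simp: scaleR_conv_of_real)
  then show ?thesis by (simp add: cis_conv_exp[abs_def])
qed

lemma differentiable_det:
  fixes f :: "'b::real_normed_vector \<Rightarrow> 'a::{real_normed_field,euclidean_space}^'n^'n"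
  assumes "f differentiable (at x)"
  shows "(\<lambda>x. det (f x)) differentiable (at x)"
proof -
  obtain D where D: "(det has_derivative D) (at (f x))" using det_has_derivative by blast
  obtain f' where "(f has_derivative f') (at x)" using assms by (auto simp: differentiable_def)
  from diff_chain_at[OF this D] show ?thesis unfolding differentiable_def o_def by blast
qed

lemma differentiable_matrix_mult:
  fixes f :: "'b::real_normed_vector \<Rightarrow> 'a::{real_normed_field,euclidean_space}^'n^'m" and g :: "'b \<Rightarrow> 'a^'p^'n"
  assumes "f differentiable (at x)" "g differentiable (at x)"
  shows "(\<lambda>x. f x ** g x) differentiable (at x)"
  using assms bounded_bilinear.FDERIV[OF bounded_bilinear_matrix_mult]
  unfolding differentiable_def by blast

lemma bounded_bilinear_cscale: "bounded_bilinear ((*m) :: complex \<Rightarrow> complex^'n^'m \<Rightarrow> _)"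
  unfolding bilinear_conv_bounded_bilinear[symmetric] bilinear_def
  by (auto intro!: linearI simp: vec_eq_iff cscale_nth algebra_simps scaleR_conv_of_real[where 'a=complex])

lemma differentiable_cscale:
  assumes "f differentiable (at x)" "g differentiable (at x)"
  shows "(\<lambda>x. f x *m g x) differentiable (at x)"
  using assms bounded_bilinear.FDERIV[OF bounded_bilinear_cscale]
  unfolding differentiable_def by blast

lemma differentiable_bounded_linear:
  assumes "bounded_linear h" "f differentiable (at x)"
  shows "(\<lambda>x. h (f x)) differentiable (at x)"
  using assms bounded_linear.has_derivative unfolding differentiable_def by blast

lemma differentiable_radial_det:
  assumes f: "f differentiable (at x)" and g: "g differentiable (at x)"
  shows "(\<lambda>x. radial_det (f x) (g x)) differentiable (at x)"
  unfolding radial_det_def radial_matrix_def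
  by (intro differentiable_det differentiable_add differentiable_diff differentiable_matrix_mult
      differentiable_cscale differentiable_const f differentiable_bounded_linear[OF bounded_linear_cmat g])

lemma coorient_has_derivative:
  "((\<lambda>t. det (M ** mexp (t *\<^sub>R J_mat) - mat 1)) has_real_derivative coorient 1 M) (at 0)"
  for M :: "('d::finite) mat2"
proof -
  have "(\<lambda>t. det (M ** mexp (t *\<^sub>R J_mat) - mat 1)) differentiable (at 0)"
    unfolding mexp_J
    by (intro differentiable_det differentiable_diff differentiable_matrix_mult differentiable_add
        differentiable_scaleR differentiable_const)
      (auto simp: differentiable_def intro!: derivative_eq_intros exI)
  then show ?thesis
    unfolding coorient_def sp_det_1 by (simp add: DERIV_deriv_iff_real_differentiable)
qed

text \<open>The curve \<open>r = cis t\<close> turns the radial derivative of \<open>radial_det\<close> into the derivative in the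
  co-orienting direction.\<close>

lemma radial_det_radial_derivative:
  fixes M :: "('d::finite) mat2"
  assumes "det (M - mat 1) = 0"
  shows "((\<lambda>r. radial_det (of_real r) M) has_vector_derivative (- \<i> * of_real (reflection_sign TYPE('d) * coorient 1 M))) (at 1)"
proof -
  obtain p where p: "\<And>r. radial_det r M = poly p r" using radial_det_polynomial[of M] by blast
  obtain c where c: "\<And>r. det (- Pplus - r *m (- Pminus) :: complex ^ ('d + 'd) ^ ('d + 'd)) = poly c r"
    using det_polynomial by blast
  define g where "g t = det (M ** mexp (t *\<^sub>R J_mat) - mat 1)" for t
  have g: "(g has_real_derivative coorient 1 M) (at 0)" "g 0 = 0"
    using coorient_has_derivative[of M] assms by (simp_all add: g_def[abs_def] mexp_J)
  have c1: "poly c 1 = of_real (reflection_sign TYPE('d))"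
    unfolding c[symmetric] reflection_sign(1)[symmetric] by (simp add: cscale_one)
  \<comment> \<open>\<open>g\<close> vanishes at 0, so differentiating this product there leaves
    only \<open>poly c 1\<close> times the derivative of \<open>g\<close>; the derivative of
    \<open>c\<close> drops out.\<close>
  have eq: "poly p (cis t) = poly c (cis t) * of_real (g t)" for t
    unfolding p[symmetric] c[symmetric] radial_det_cis det_rot_commute g_def by (simp add: cscale_minus)
  have pc: "((\<lambda>t. poly q (cis t)) has_vector_derivative (\<i> * poly (pderiv q) 1)) (at 0)" for q
    using field_vector_diff_chain_at[OF has_vector_derivative_cis[of 0], of "poly q" "poly (pderiv q) 1"]
    by (simp add: o_def poly_DERIV)
  have "((\<lambda>t. complex_of_real (g t)) has_vector_derivative of_real (coorient 1 M)) (at 0)"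
    using g(1) has_vector_derivative_of_real has_real_derivative_iff_has_vector_derivative by blast
  from has_vector_derivative_mult[OF pc[of c] this]
  have "((\<lambda>t. poly p (cis t)) has_vector_derivative (poly c 1 * of_real (coorient 1 M))) (at 0)"
    by (simp add: eq g(2))
  then have "\<i> * poly (pderiv p) 1 = of_real (reflection_sign TYPE('d) * coorient 1 M)"
    using vector_derivative_unique_at[OF pc[of p]] by (simp add: c1)
  then have "poly (pderiv p) 1 = - \<i> * of_real (reflection_sign TYPE('d) * coorient 1 M)"
    by (metis mult.assoc mult_minus_left i_squared mult_1 minus_minus)
  moreover have "((\<lambda>r. poly p (of_real r)) has_vector_derivative (poly (pderiv p) 1)) (at 1)"
    using has_vector_derivative_real_field[OF poly_DERIV[of p "of_real 1"]] by simp
  ultimately show ?thesis by (simp add: p)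
qed

lemma Ln_imaginary:
  assumes "y \<noteq> 0" shows "Im (Ln (\<i> * of_real y)) = sgn y * pi / 2"
proof -
  have "Ln (\<i> * of_real y) = Complex (ln \<bar>y\<bar>) (sgn y * pi / 2)"
    using assms by (intro Ln_unique) (auto simp: exp_eq_polar complex_eq_iff sgn_real_def Re_exp Im_exp)
  then show ?thesis by simp
qed

text \<open>Near a crossing at time \<open>c\<close> the radial determinant is, up to sign and to first order,
  \<open>\<i> \<kappa> (1 - r) + \<rho> (t - c)\<close> with \<open>\<kappa>\<close> the co-orienting derivative and \<open>\<rho>\<close> the crossing rate, so on
  the side \<open>r < 1\<close> its argument turns by \<open>- \<pi> sgn \<kappa> sgn \<rho>\<close>.\<close>

lemma crossing_index_jump:
  fixes q :: "real \<Rightarrow> ('d::finite) mat2"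
  assumes c: "0 < c" "c < 1" "q c \<in> Sp0 1" and q: "q differentiable (at c)"
    and nz: "coorient 1 (q c) \<noteq> 0" "crossing_rate 1 q c \<noteq> 0"
    and T: "\<And>t. 0 \<le> t \<Longrightarrow> t \<le> 1 \<Longrightarrow> t \<noteq> c \<Longrightarrow> \<bar>t - c\<bar> < \<eta> \<Longrightarrow> t \<in> T" "0 < \<eta>"
    and L: "is_radial_log T q L"
  shows "\<exists>\<delta>>0. \<delta> \<le> \<eta> \<and> \<delta> \<le> c \<and> \<delta> \<le> 1 - c \<and> (\<forall>t t'. c - \<delta> < t \<and> t < c \<and> c < t' \<and> t' < c + \<delta> \<longrightarrow>
     Im (L (1, t)) - Im (L (1, t')) = pi * (sgn (crossing_rate 1 q c) * sgn (coorient 1 (q c))))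
     \<and> (\<forall>t t'. (c - \<delta> < t \<and> t < c \<and> c - \<delta> < t' \<and> t' < c \<or> c < t \<and> t < c + \<delta> \<and> c < t' \<and> t' < c + \<delta>) \<longrightarrow>
     Im (L (1, t)) = Im (L (1, t')))"
proof -
  define \<kappa> where "\<kappa> = coorient 1 (q c)"
  define \<rho> where "\<rho> = crossing_rate 1 q c"
  define s where "s = reflection_sign TYPE('d)"
  have s: "s \<noteq> 0" using reflection_sign(2)[where 'd='d] by (auto simp: s_def)
  define d where "d t = det (q t - mat 1)" for t
  have d0: "d c = 0" using c by (simp add: d_def Sp0_iff)
  define f where "f z = radial_det (of_real (fst z)) (q (snd z))" for z :: "real \<times> real"
  have f1: "f (1, t) = of_real (s * d t)" for t by (simp add: f_def radial_det_1 s_def d_def)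
  have "f differentiable (at (1, c))" unfolding f_def[abs_def]
  proof (rule differentiable_radial_det)
    show "(\<lambda>z :: real \<times> real. complex_of_real (fst z)) differentiable at (1, c)"
      by (intro differentiable_bounded_linear[OF bounded_linear_of_real]
          differentiable_bounded_linear[OF bounded_linear_fst] differentiable_ident)
    have "snd differentiable at (1 :: real, c)"
      by (simp add: bounded_linear_imp_differentiable bounded_linear_snd)
    with q show "(\<lambda>z :: real \<times> real. q (snd z)) differentiable at (1, c)"
      using differentiable_chain_at[of snd "(1 :: real, c)" q] by (simp add: o_def)
  qed
  then obtain D where D: "(f has_derivative D) (at (1, c))" unfolding differentiable_def by blast
  have "(\<lambda>t. d t) differentiable (at c)"
    unfolding d_def by (intro differentiable_det differentiable_diff q differentiable_const)
  then have dd: "(d has_real_derivative \<rho>) (at c)"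
    unfolding \<rho>_def crossing_rate_def sp_det_1 d_def[symmetric]
    using DERIV_deriv_iff_real_differentiable by blast
  have D01: "D (0, 1) = of_real (s * \<rho>)"
  proof -
    have "((\<lambda>t. (1 :: real, t)) has_vector_derivative (0, 1)) (at c)"
      by (intro has_vector_derivative_Pair has_vector_derivative_const has_vector_derivative_id)
    from vector_derivative_diff_chain_within[OF this has_derivative_at_withinI[OF D]]
    have "((\<lambda>t. f (1, t)) has_vector_derivative D (0, 1)) (at c)"
      by (simp add: o_def)
    moreover have "((\<lambda>t. complex_of_real (s * d t)) has_vector_derivative of_real (s * \<rho>)) (at c)"
      using dd by (intro has_vector_derivative_of_real)
        (auto simp: has_real_derivative_iff_has_vector_derivative[symmetric] intro!: derivative_eq_intros)
    ultimately show ?thesis unfolding f1 using vector_derivative_unique_at by blast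
  qed
  have D10: "D (1, 0) = - \<i> * of_real (s * \<kappa>)"
  proof -
    have "((\<lambda>r. (r, c)) has_vector_derivative (1, 0)) (at (1::real))"
      by (intro has_vector_derivative_Pair has_vector_derivative_const has_vector_derivative_id)
    from vector_derivative_diff_chain_within[OF this has_derivative_at_withinI[OF D]]
    have "((\<lambda>r. f (r, c)) has_vector_derivative D (1, 0)) (at 1)"
      by (simp add: o_def)
    moreover have "((\<lambda>r. f (r, c)) has_vector_derivative - \<i> * of_real (s * \<kappa>)) (at 1)"
      using radial_det_radial_derivative[of "q c"] d0 by (simp add: f_def d_def s_def \<kappa>_def)
    ultimately show ?thesis using vector_derivative_unique_at by blast
  qed
  have Dab: "D (a, b) = of_real s * (- \<i> * of_real \<kappa> * of_real a + of_real \<rho> * of_real b)" for a b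
  proof -
    have lin: "linear D" using D has_derivative_linear by blast
    have "D (a, b) = D (a *\<^sub>R (1, 0) + b *\<^sub>R (0, 1))" by simp
    also have "\<dots> = a *\<^sub>R D (1, 0) + b *\<^sub>R D (0, 1)"
      by (simp only: linear_add[OF lin] linear_scale[OF lin])
    finally show ?thesis by (simp add: D01 D10 scaleR_conv_of_real algebra_simps)
  qed
  define m where "m = \<rho> / \<kappa>"
  have m: "m \<noteq> 0" using nz by (simp add: m_def \<rho>_def \<kappa>_def)
  \<comment> \<open>Dividing by \<open>\<i> \<kappa> s\<close> turns the linear part into
    \<open>(1 - r) - \<i> m (t - c)\<close>, with nonnegative real part for
    \<open>r \<le> 1\<close>, so that the principal logarithm applies.\<close>
  define h where "h z = f z / (\<i> * of_real (\<kappa> * s))" for z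
  have \<kappa>: "\<kappa> \<noteq> 0" using nz by (simp add: \<kappa>_def)
  have h1: "h (1, t) = \<i> * of_real (- d t / \<kappa>)" for t
    using s \<kappa> by (simp add: h_def f1 field_simps)
  have "(h has_derivative (\<lambda>z. D z / (\<i> * of_real (\<kappa> * s)))) (at (1, c))"
    unfolding h_def[abs_def] divide_inverse
    by (intro bounded_linear.has_derivative[OF bounded_linear_mult_left D])
  moreover have "D (a, b) / (\<i> * of_real (\<kappa> * s)) = Complex (- a) (- m * b)" for a b
    using s \<kappa> by (simp add: Dab m_def Complex_eq field_simps)
  then have "(\<lambda>z. D z / (\<i> * of_real (\<kappa> * s))) = (\<lambda>(a, b). Complex (- a) (- m * b))" by auto
  ultimately have hd: "(h has_derivative (\<lambda>(a, b). Complex (- a) (- m * b))) (at (1, c))" by simp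
  have hc: "h (1, c) = 0" by (simp add: h1 d0)
  \<comment> \<open>If \<open>h\<close> took a nonpositive real value, both \<open>1 - r\<close> and
    \<open>|m| |t - c|\<close> would be at most the error. With this choice each of
    \<open>1 - r\<close> and \<open>|t - c|\<close> is then at most a quarter of their sum, so both
    vanish.\<close>
  define \<epsilon> where "\<epsilon> = min (1/4) (\<bar>m\<bar>/4)"
  have \<epsilon>: "\<epsilon> > 0" "\<epsilon> \<le> 1/4" "\<epsilon> \<le> \<bar>m\<bar>/4" using m by (auto simp: \<epsilon>_def)
  obtain \<delta>0 where \<delta>0: "\<delta>0 > 0" and \<delta>0h: "\<And>z. norm (z - (1, c)) < \<delta>0 \<Longrightarrow>
      norm (h z - (case z - (1, c) of (a, b) \<Rightarrow> Complex (- a) (- m * b))) \<le> \<epsilon> * norm (z - (1, c))"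
    using hd \<epsilon>(1) unfolding has_derivative_at_alt by (auto simp: hc)
  define \<delta> where "\<delta> = min (min (\<delta>0 / 2) \<eta>) (min c (1 - c))"
  have \<delta>: "\<delta> > 0" "\<delta> \<le> \<delta>0 / 2" "\<delta> \<le> \<eta>" "\<delta> \<le> c" "\<delta> \<le> 1 - c"
    unfolding \<delta>_def using \<delta>0 c T(2) by linarith+
  have est: "norm (h (r, t) - Complex (1 - r) (- m * (t - c))) \<le> \<epsilon> * (\<bar>r - 1\<bar> + \<bar>t - c\<bar>)"
    if "\<bar>r - 1\<bar> < \<delta>" "\<bar>t - c\<bar> < \<delta>" for r t
  proof -
    have n: "norm ((r, t) - (1, c)) \<le> \<bar>r - 1\<bar> + \<bar>t - c\<bar>"
      using norm_Pair_le[of "r - 1" "t - c"] by simp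
    with that \<delta> have "norm ((r, t) - (1, c)) < \<delta>0" by linarith
    from \<delta>0h[OF this]
    have "norm (h (r, t) - Complex (1 - r) (- m * (t - c))) \<le> \<epsilon> * norm ((r, t) - (1, c))"
      by simp
    also have "\<dots> \<le> \<epsilon> * (\<bar>r - 1\<bar> + \<bar>t - c\<bar>)"
      using \<epsilon>(1) by (intro mult_left_mono n) simp
    finally show ?thesis .
  qed
  \<comment> \<open>A half-neighbourhood of \<open>(1, c)\<close> without that point, where the
    determinant vanishes; it is starlike about \<open>(1 - \<delta> / 2, c)\<close>.\<close>
  define R where "R = {(r, t). 1 - \<delta> < r \<and> r \<le> 1 \<and> \<bar>t - c\<bar> < \<delta> \<and> (r, t) \<noteq> (1, c)}"
  have slit: "h z \<notin> \<real>\<^sub>\<le>\<^sub>0" if "z \<in> R" for z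
  proof
    assume neg: "h z \<in> \<real>\<^sub>\<le>\<^sub>0"
    obtain r t where z: "z = (r, t)" by (cases z)
    have rt: "\<bar>r - 1\<bar> < \<delta>" "\<bar>t - c\<bar> < \<delta>" "r \<le> 1" "(r, t) \<noteq> (1, c)"
      using that by (auto simp: R_def z)
    have neg': "Re (h (r, t)) \<le> 0" "Im (h (r, t)) = 0"
      using neg z by (auto simp: complex_nonpos_Reals_iff)
    note e = est[OF rt(1,2)]
    have "1 - r \<le> \<epsilon> * (\<bar>r - 1\<bar> + \<bar>t - c\<bar>)"
      using order_trans[OF abs_Re_le_cmod e] neg' rt by auto
    moreover have "\<bar>m\<bar> * \<bar>t - c\<bar> \<le> \<epsilon> * (\<bar>r - 1\<bar> + \<bar>t - c\<bar>)"
      using order_trans[OF abs_Im_le_cmod e] neg' by (simp add: abs_mult)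
    moreover have "\<epsilon> * (\<bar>r - 1\<bar> + \<bar>t - c\<bar>) \<le> 1/4 * (\<bar>r - 1\<bar> + \<bar>t - c\<bar>)"
      "\<epsilon> * (\<bar>r - 1\<bar> + \<bar>t - c\<bar>) \<le> \<bar>m\<bar>/4 * (\<bar>r - 1\<bar> + \<bar>t - c\<bar>)"
      using \<epsilon> by (intro mult_right_mono; simp)+
    ultimately have 3: "1 - r \<le> (\<bar>r - 1\<bar> + \<bar>t - c\<bar>) / 4" "\<bar>m\<bar> * \<bar>t - c\<bar> \<le> \<bar>m\<bar> * ((\<bar>r - 1\<bar> + \<bar>t - c\<bar>) / 4)"
      by simp_all
    then have "1 - r \<le> (\<bar>r - 1\<bar> + \<bar>t - c\<bar>) / 4" "\<bar>t - c\<bar> \<le> (\<bar>r - 1\<bar> + \<bar>t - c\<bar>) / 4"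
      using m by (simp_all only: mult_le_cancel_left_pos zero_less_abs_iff not_False_eq_True)
    moreover have "\<bar>r - 1\<bar> = 1 - r" using rt(3) by simp
    moreover have "x = 0 \<and> y = 0" if "x \<le> (x + y) / 4" "y \<le> (x + y) / 4" "0 \<le> x" "0 \<le> y" for x y :: real
      using that by (simp add: field_simps)
    ultimately have "\<bar>r - 1\<bar> = 0 \<and> \<bar>t - c\<bar> = 0" by (metis abs_ge_zero)
    with rt(4) show False by simp
  qed
  have Rsub: "R \<subseteq> slit_square T"
    using T \<delta> c by (auto simp: R_def slit_square_def)
  have "starlike R" unfolding starlike_def
  proof (intro bexI ballI subsetI)
    show p0: "(1 - \<delta> / 2, c) \<in> R" using \<delta> by (auto simp: R_def)
    fix x w assume x: "x \<in> R" and "w \<in> closed_segment (1 - \<delta> / 2, c) x"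
    then obtain u where u: "0 \<le> u" "u \<le> 1" "w = (1 - u) *\<^sub>R (1 - \<delta> / 2, c) + u *\<^sub>R x"
      by (auto simp: closed_segment_def)
    let ?K = "{1 - \<delta><..1} \<times> {c - \<delta><..<c + \<delta>}"
    have "convex ?K" by (intro convex_Times convex_real_interval)
    moreover have "(1 - \<delta> / 2, c) \<in> ?K" "x \<in> ?K" using x p0 by (auto simp: R_def abs_less_iff)
    ultimately have "w \<in> ?K" using u convexD_alt by blast
    moreover have "w \<noteq> (1, c)"
    proof (cases "u = 1")
      case True then show ?thesis using u x by (auto simp: R_def)
    next
      case False
      then have "(1 - u) * (1 - \<delta> / 2) + u * fst x < (1 - u) * 1 + u * 1"
        using u \<delta> x by (intro add_less_le_mono mult_strict_left_mono mult_left_mono) (auto simp: R_def)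
      then show ?thesis using u(3) by (cases x) auto
    qed
    ultimately show "w \<in> R" by (auto simp: R_def)
  qed
  then have conn: "connected R" by (rule starlike_imp_connected)
  have hL: "exp (L z) = \<i> * of_real (\<kappa> * s) * h z" if "z \<in> R" for z
    using is_radial_logD[OF L, of "fst z" "snd z"] Rsub that s \<kappa> by (auto simp: h_def f_def)
  have "(\<lambda>z. L z - Ln (h z)) constant_on R"
  proof (rule exp_const_imp_constant_on[OF conn])
    have "continuous_on R L" using L Rsub unfolding is_radial_log_def by (auto elim: continuous_on_subset)
    moreover have "continuous_on R h"
    proof -
      have "continuous_on R (\<lambda>z. exp (L z) / (\<i> * of_real (\<kappa> * s)))"
        using s \<kappa> \<open>continuous_on R L\<close> by (intro continuous_intros) auto
      then show ?thesis by (rule continuous_on_eq) (use hL s \<kappa> in auto)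
    qed
    ultimately show "continuous_on R (\<lambda>z. L z - Ln (h z))"
      using slit by (intro continuous_intros) auto
    have "exp (L z - Ln (h z)) = \<i> * of_real (\<kappa> * s)" if "z \<in> R" for z
    proof -
      have "h z \<noteq> 0" using slit[OF that] by auto
      then show ?thesis by (simp add: exp_diff hL[OF that])
    qed
    then show "\<And>x y. x \<in> R \<Longrightarrow> y \<in> R \<Longrightarrow> exp (L x - Ln (h x)) = exp (L y - Ln (h y))" by simp
  qed
  then obtain k where k: "\<And>z. z \<in> R \<Longrightarrow> L z - Ln (h z) = k" unfolding constant_on_def by blast
  \<comment> \<open>On the edge \<open>r = 1\<close> the value of \<open>h\<close> is purely
    imaginary, of sign opposite to \<open>m (t - c)\<close>, so its argument is exactly plus or
    minus pi/2.\<close>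
  have Im: "Im (L (1, t)) = Im k - sgn (m * (t - c)) * pi / 2" if t: "\<bar>t - c\<bar> < \<delta>" "t \<noteq> c" for t
  proof -
    have "(1, t) \<in> R" using t \<delta> by (auto simp: R_def)
    have nab: "norm (\<i> * of_real a - \<i> * of_real b) = \<bar>a - b\<bar>" for a b :: real
      unfolding right_diff_distrib[symmetric] of_real_diff[symmetric] norm_mult norm_of_real by simp
    have "Complex 0 (- m * (t - c)) = \<i> * of_real (- m * (t - c))" by (simp add: Complex_eq)
    then have "norm (\<i> * of_real (- d t / \<kappa>) - \<i> * of_real (- m * (t - c))) \<le> \<epsilon> * \<bar>t - c\<bar>"
      using est[of 1 t] t \<delta> by (simp add: h1)
    then have "\<bar>d t / \<kappa> - m * (t - c)\<bar> \<le> \<epsilon> * \<bar>t - c\<bar>"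
      unfolding nab by (simp add: abs_minus_commute)
    also have "\<dots> \<le> \<bar>m\<bar> / 4 * \<bar>t - c\<bar>" using \<epsilon> by (intro mult_right_mono) auto
    also have "\<dots> < \<bar>m * (t - c)\<bar>" using m t by (simp add: abs_mult)
    finally have "sgn (d t / \<kappa>) = sgn (m * (t - c))" and "d t / \<kappa> \<noteq> 0"
      by (auto simp: sgn_real_def abs_if split: if_splits)
    moreover from this have "Im (Ln (h (1, t))) = sgn (- d t / \<kappa>) * pi / 2"
      unfolding h1 by (intro Ln_imaginary) auto
    ultimately show ?thesis
      using k[OF \<open>(1, t) \<in> R\<close>] by (auto simp: sgn_minus algebra_simps dest: arg_cong[where f=Im])
  qed
  have sm: "sgn m = sgn \<rho> * sgn \<kappa>" by (simp add: m_def sgn_divide)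
  show ?thesis
    unfolding \<rho>_def[symmetric] \<kappa>_def[symmetric] sm[symmetric]
  proof (intro exI[of _ \<delta>] conjI allI impI)
    have l: "Im (L (1, t)) = Im k + sgn m * pi / 2" if "c - \<delta> < t" "t < c" for t
      using Im[of t] that by (simp add: sgn_mult)
    have r: "Im (L (1, t)) = Im k - sgn m * pi / 2" if "c < t" "t < c + \<delta>" for t
      using Im[of t] that by (simp add: sgn_mult)
    show "Im (L (1, t)) - Im (L (1, t')) = pi * sgn m"
      if "c - \<delta> < t \<and> t < c \<and> c < t' \<and> t' < c + \<delta>" for t t'
      using that by (simp add: l r)
    show "Im (L (1, t)) = Im (L (1, t'))"
      if "c - \<delta> < t \<and> t < c \<and> c - \<delta> < t' \<and> t' < c \<or> c < t \<and> t < c + \<delta> \<and> c < t' \<and> t' < c + \<delta>" for t t'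
      using that by (auto simp: l r)
  qed (use \<delta> in auto)
qed

section \<open>From local jumps to the signed count\<close>

lemma finite_avoid:
  fixes a :: real
  assumes "finite C" shows "\<exists>\<eta>>0. \<forall>x\<in>C. x \<noteq> a \<longrightarrow> \<eta> \<le> \<bar>x - a\<bar>"
  using assms
proof (induction C)
  case empty show ?case by (intro exI[of _ 1]) simp
next
  case (insert y C)
  then obtain \<eta> where "\<eta> > 0" "\<forall>x\<in>C. x \<noteq> a \<longrightarrow> \<eta> \<le> \<bar>x - a\<bar>" by blast
  then show ?case
    by (intro exI[of _ "if y = a then \<eta> else min \<eta> \<bar>y - a\<bar>"]) auto
qed

lemma crossing_index_transverse:
  fixes q :: "real \<Rightarrow> ('d::finite) mat2"
  assumes q: "path q" "path_image q \<subseteq> Sp" and t: "transverse_path 1 q"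
  shows "crossing_index q = signed_crossings 1 q"
proof -
  define C where "C = crossings 1 q"
  define j where "j x = sgn (crossing_rate 1 q x) * sgn (coorient 1 (q x))" for x
  have C: "finite C" "0 \<notin> C" "1 \<notin> C" "C \<subseteq> {0..1}"
    using t by (auto simp: C_def transverse_path_def crossings_def)
  have Cd: "q differentiable (at x)" "coorient 1 (q x) \<noteq> 0" "crossing_rate 1 q x \<noteq> 0" "q x \<in> Sp0 1"
    if "x \<in> C" for x
    using t that by (auto simp: C_def transverse_path_def crossings_def)
  define T where "T = {0..1} - C"
  have "det (q t - mat 1) \<noteq> 0" if "t \<in> T \<inter> {0..1}" for t
    using that q(2) by (auto simp: T_def C_def crossings_def Sp0_iff path_image_def image_subset_iff)
  then obtain L where L: "is_radial_log T q L" by (rule ex_log[OF q])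
  \<comment> \<open>The drop of the argument up to time \<open>t\<close> minus the jumps already
    passed. At the crossings \<open>L (1, t)\<close> is arbitrary, so the connectedness argument
    compares \<open>F\<close> only outside \<open>C\<close>.\<close>
  define F where "F t = Im (L (1, 0)) - Im (L (1, t)) - pi * (\<Sum>x | x \<in> C \<and> x < t. j x)" for t
  have "F 0 = F 1"
  proof (rule connected_equivalence_relation_gen[where S="{0..1}" and P="\<lambda>x. x \<notin> C" and R="\<lambda>x y. F x = F y"])
    fix U a assume U: "openin (top_of_set {0..1::real}) U" "a \<in> U"
    have "a \<in> {0..1}" using openin_imp_subset[OF U(1)] U(2) by blast
    then have "infinite U" using U by (intro infinite_openin[of "{0..1}" U a]) simp_all
    then show "\<exists>z. z \<in> U \<and> z \<notin> C" using C(1) by (meson finite_subset subsetI)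
  next
    fix a :: real assume a: "a \<in> {0..1}"
    obtain \<eta> where \<eta>: "\<eta> > 0" "\<And>x. x \<in> C \<Longrightarrow> x \<noteq> a \<Longrightarrow> \<eta> \<le> \<bar>x - a\<bar>"
      using finite_avoid[OF C(1)] by blast
    show "\<exists>U. openin (top_of_set {0..1}) U \<and> a \<in> U \<and> (\<forall>x\<in>U. \<forall>y\<in>U. x \<notin> C \<and> y \<notin> C \<longrightarrow> F x = F y)"
    proof (cases "a \<in> C")
      case True
      have int: "0 < a" "a < 1" using a True C by (auto simp: order.strict_iff_order)
      have T': "t \<in> T" if "0 \<le> t" "t \<le> 1" "t \<noteq> a" "\<bar>t - a\<bar> < \<eta>" for t
        using that \<eta>(2)[of t] by (force simp: T_def)
      obtain \<delta> where \<delta>: "\<delta> > 0" "\<delta> \<le> \<eta>" "\<delta> \<le> a" "\<delta> \<le> 1 - a"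
        "\<And>t t'. a - \<delta> < t \<and> t < a \<and> a < t' \<and> t' < a + \<delta> \<Longrightarrow> Im (L (1, t)) - Im (L (1, t')) = pi * j a"
        "\<And>t t'. a - \<delta> < t \<and> t < a \<and> a - \<delta> < t' \<and> t' < a \<or> a < t \<and> t < a + \<delta> \<and> a < t' \<and> t' < a + \<delta> \<Longrightarrow>
          Im (L (1, t)) = Im (L (1, t'))"
        using crossing_index_jump[OF int Cd(4,1,2,3)[OF True] T' \<eta>(1) L] unfolding j_def by blast
      have s1: "{x. x \<in> C \<and> x < t} = {x. x \<in> C \<and> x < a}" if "a - \<delta> < t" "t < a" for t
      proof -
        have False if "x \<in> C" "x < a" "t \<le> x" for x
          using \<eta>(2)[of x] that \<open>a - \<delta> < t\<close> \<delta>(2) by auto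
        then show ?thesis using that by force
      qed
      have s2: "{x. x \<in> C \<and> x < t} = insert a {x. x \<in> C \<and> x < a}" if "a < t" "t < a + \<delta>" for t
      proof -
        have False if "x \<in> C" "a < x" "x < t" for x
          using \<eta>(2)[of x] that \<open>t < a + \<delta>\<close> \<delta>(2) by auto
        then show ?thesis using that True by force
      qed
      have fin: "finite {x. x \<in> C \<and> x < a}" using C(1) by simp
      have F1: "F x = F y" if "a - \<delta> < x" "x < a" "a < y" "y < a + \<delta>" for x y
        using \<delta>(5)[of x y] that unfolding F_def s1[OF that(1,2)] s2[OF that(3,4)]
        by (simp add: fin distrib_left)
      have F2: "F x = F y" if "a - \<delta> < x" "x < a" "a - \<delta> < y" "y < a" for x y
        using \<delta>(6)[of x y] that unfolding F_def s1[OF that(1,2)] s1[OF that(3,4)] by simp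
      have F3: "F x = F y" if "a < x" "x < a + \<delta>" "a < y" "y < a + \<delta>" for x y
        using \<delta>(6)[of x y] that unfolding F_def s2[OF that(1,2)] s2[OF that(3,4)] by simp
      show ?thesis
      proof (intro exI[of _ "{0..1} \<inter> ball a \<delta>"] conjI ballI impI)
        fix x y assume "x \<in> {0..1} \<inter> ball a \<delta>" "y \<in> {0..1} \<inter> ball a \<delta>" "x \<notin> C \<and> y \<notin> C"
        then have b: "x \<noteq> a" "y \<noteq> a" "a - \<delta> < x" "x < a + \<delta>" "a - \<delta> < y" "y < a + \<delta>"
          using True by (auto simp: dist_real_def)
        then consider "x < a" "y < a" | "x < a" "a < y" | "a < x" "y < a" | "a < x" "a < y" by linarith
        then show "F x = F y"
        proof cases
          case 1 show ?thesis by (intro F2 b 1)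
        next
          case 2 show ?thesis by (intro F1 b 2)
        next
          case 3 show ?thesis by (intro F1[symmetric] b 3)
        next
          case 4 show ?thesis by (intro F3 b 4)
        qed
      qed (use a \<delta> in \<open>auto simp: openin_open_Int\<close>)
    next
      case False
      let ?U = "{0..1} \<inter> ball a \<eta>"
      have noC: "x \<notin> C" if "x \<in> ?U" for x
        using that \<eta>(2)[of x] False by (cases "x = a") (auto simp: dist_real_def abs_minus_commute)
      have s: "{x. x \<in> C \<and> x < t} = {x. x \<in> C \<and> x < a}" if "t \<in> ?U" for t
      proof -
        have "x < t \<longleftrightarrow> x < a" if "x \<in> C" for x
        proof -
          have "x \<noteq> a" "\<bar>t - a\<bar> < \<eta>" using that False \<open>t \<in> ?U\<close> by (auto simp: dist_real_def)
          with \<eta>(2)[OF that] show ?thesis by linarith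
        qed
        then show ?thesis by blast
      qed
      have ImU: "Im (L (1, x)) = Im (L (1, y))" if "x \<in> ?U" "y \<in> ?U" for x y
      proof (rule exp_real_imp_Im_constant[where f="\<lambda>t. L (1, t)" and S="?U"])
        show "connected ?U" by (intro convex_connected convex_Int convex_real_interval convex_ball)
        have sub: "(1, t) \<in> slit_square T" if "t \<in> ?U" for t
          using that noC[OF that] by (auto simp: slit_square_def T_def)
        show "continuous_on ?U (\<lambda>t. L (1, t))"
          by (rule continuous_on_compose2[of "slit_square T" L])
            (use L sub in \<open>auto simp: is_radial_log_def intro!: continuous_intros\<close>)
        show "exp (L (1, t)) \<in> \<real>" if "t \<in> ?U" for t
          using is_radial_logD[OF L sub[OF that], symmetric] by (simp add: radial_det_1)
      qed (use that in auto)
      have "F x = F y" if "x \<in> ?U" "y \<in> ?U" for x y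
        unfolding F_def s[OF that(1)] s[OF that(2)] ImU[OF that] ..
      moreover have "openin (top_of_set {0..1}) ?U" "a \<in> ?U"
        using a \<eta>(1) by (auto simp: openin_open_Int)
      ultimately show ?thesis by blast
    qed
  qed (use C in auto)
  moreover have "{x. x \<in> C \<and> x < 0} = {}" "{x. x \<in> C \<and> x < 1} = C"
    using C by (auto simp: order.strict_iff_order)
  ultimately have "Im (L (1, 0)) - Im (L (1, 1)) = pi * (\<Sum>x\<in>C. j x)" by (simp add: F_def)
  moreover have "is_radial_log {0, 1} q L"
    using C by (intro is_radial_log_subset[OF L]) (auto simp: T_def)
  ultimately show ?thesis
    by (simp add: crossing_index_eq signed_crossings_def C_def j_def)
qed

lemma signed_crossings_Ints: "signed_crossings \<omega> q \<in> \<int>"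
proof -
  have "sgn x \<in> \<int>" for x :: real by (auto simp: sgn_real_def)
  then show ?thesis unfolding signed_crossings_def by (intro Ints_sum Ints_mult)
qed

text \<open>The uniqueness half of the definite description: every transverse representative has the
  signed count \<open>crossing_index p\<close>, which depends only on the homotopy class and is an
  integer because a signed count is.\<close>

lemma intersection_number_eq_crossing_index:
  fixes p :: "real \<Rightarrow> ('d::finite) mat2"
  assumes "det (p 0 - mat 1) \<noteq> 0" "det (p 1 - mat 1) \<noteq> 0"
    and q: "homotopic_paths Sp p q" "transverse_path 1 q"
  shows "real_of_int (intersection_number 1 p) = crossing_index p"
proof -
  have eq: "signed_crossings 1 q' = crossing_index p" if "homotopic_paths Sp p q'" "transverse_path 1 q'" for q'
    using crossing_index_homotopic_paths[OF that(1) assms(1,2)] crossing_index_transverse[OF _ _ that(2)]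
      homotopic_paths_imp_path[OF that(1)] homotopic_paths_imp_subset[OF that(1)] by simp
  obtain n where n: "crossing_index p = real_of_int n"
    using eq[OF q] signed_crossings_Ints by (metis Ints_cases)
  have "intersection_number 1 p = n"
    unfolding intersection_number_def
    by (rule the_equality) (use q eq n in \<open>auto\<close>)
  then show ?thesis by (simp add: n)
qed

section \<open>Transverse paths\<close>

lemma det_0_iff_fixed: "det (M - mat 1) = 0 \<longleftrightarrow> (\<exists>x. x \<noteq> 0 \<and> M *v x = x)"
  for M :: "real ^ 'n ^ 'n"
proof -
  have "det (M - mat 1) \<noteq> 0 \<longleftrightarrow> (\<forall>x. (M - mat 1) *v x = 0 \<longrightarrow> x = 0)"
    unfolding invertible_det_nz[symmetric] invertible_left_inverse matrix_left_invertible_ker ..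
  then show ?thesis by (auto simp: matrix_vector_mult_diff_rdistrib)
qed

lemma fixed_transpose:
  assumes "M \<in> Sp" "M *v x = x" shows "transpose M *v (J_mat *v x) = J_mat *v x"
  using assms by (metis Sp_iff matrix_vector_mul_assoc)

text \<open>\<open>J w\<close> is fixed by the transpose of \<open>M\<close>. Pairing it with
  \<open>x = M y\<close>, where \<open>y\<close> is the transvected \<open>x\<close>, leaves
  \<open>s (v \<bullet> x) (v \<bullet> w) = 0\<close>. So the fixed space of the product lies in
  the part of the old one orthogonal to \<open>v\<close>.\<close>

lemma transvection_fixed:
  assumes M: "M \<in> Sp" "M *v w = w" and v: "v \<bullet> w \<noteq> 0" "s \<noteq> 0"
    and x: "(M ** transvection v s) *v x = x"
  shows "v \<bullet> x = 0" "M *v x = x"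
proof -
  define y where "y = transvection v s *v x"
  have y: "y = x + (s * (v \<bullet> x)) *\<^sub>R (J_mat *v v)" by (simp add: y_def transvection_vector)
  have My: "M *v y = x" using x by (simp add: y_def matrix_vector_mul_assoc)
  have "(J_mat *v w) \<bullet> x = (J_mat *v w) \<bullet> y"
    using inner_matrix_transpose[of M y "J_mat *v w"] fixed_transpose[OF M] My
    by (simp add: inner_commute)
  then show "v \<bullet> x = 0"
    using v by (simp add: y inner_add_right inner_J_mat_J_mat inner_commute)
  then show "M *v x = x" using My y by simp
qed

lemma transvection_minus_1: "M ** transvection v s - mat 1 = (M - mat 1) + s *\<^sub>R outer (M *v (J_mat *v v)) v"
  by (simp add: transvection_def matrix_ring matrix_mult_outer)

lemma det_transvection_affine:
  "\<exists>b. \<forall>s. det (M ** transvection v s - mat 1) = det (M - mat 1) + s * b"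
  unfolding transvection_minus_1 by (rule det_add_rank_one)

lemma matrix_eq_sum_outer: "A = (\<Sum>k\<in>UNIV. outer (A *v axis k 1) (axis k 1))"
  for A :: "real ^ 'n ^ 'm"
  unfolding matrix_vector_mult_basis
  by (simp add: vec_eq_iff outer_def column_def axis_def if_distrib[of "\<lambda>x. _ * x"] cong: if_cong)

text \<open>The derivative of the determinant in the direction \<open>M J w w\<^sup>T\<close> is a quadratic form in \<open>w\<close> which
  vanishes only on the hyperplane orthogonal to the fixed vector, hence has constant sign off it; the
  co-orienting derivative is its sum over the standard basis.\<close>

lemma coorient_nonzero:
  fixes M :: "('d::finite) mat2"
  assumes M: "M \<in> Sp" and x: "M *v x = x" "x \<noteq> 0" and v: "det (M ** transvection v s - mat 1) \<noteq> 0"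
  shows "coorient 1 M \<noteq> 0"
proof -
  obtain D where D: "(det has_derivative D) (at (M - mat 1))" using det_has_derivative by blast
  have lin: "linear D" using D has_derivative_linear by blast
  define Q where "Q w = D (outer (M *v (J_mat *v w)) w)" for w
  have detQ: "det (M ** transvection w r - mat 1) = r * Q w" for w r
  proof -
    obtain b where b: "\<And>r. det (M ** transvection w r - mat 1) = det (M - mat 1) + r * b"
      using det_transvection_affine[of M w] by blast
    have "det (M - mat 1) = 0" using x det_0_iff_fixed by blast
    have "((\<lambda>r. (M - mat 1) + r *\<^sub>R outer (M *v (J_mat *v w)) w) has_vector_derivative
        outer (M *v (J_mat *v w)) w) (at 0)"
      by (auto intro!: derivative_eq_intros)
    from vector_derivative_diff_chain_within[OF this, of det D] D
    have "((\<lambda>r. det (M ** transvection w r - mat 1)) has_vector_derivative Q w) (at 0)"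
      by (simp add: o_def transvection_minus_1 has_derivative_at_withinI Q_def)
    moreover have "((\<lambda>r. det (M ** transvection w r - mat 1)) has_vector_derivative b) (at 0)"
      unfolding b by (auto intro!: derivative_eq_intros)
    ultimately have "Q w = b" using vector_derivative_unique_at by blast
    with b \<open>det (M - mat 1) = 0\<close> show ?thesis by simp
  qed
  have Q0: "Q w = 0" if "w \<bullet> x = 0" for w
  proof -
    have "(M ** transvection w 1) *v x = x"
      using that x by (simp add: matrix_vector_mul_assoc[symmetric] transvection_vector)
    then show ?thesis using detQ[of w 1] x(2) det_0_iff_fixed[of "M ** transvection w 1"] by auto
  qed
  \<comment> \<open>The fixed space of \<open>M\<close> meets the hyperplane orthogonal to
    \<open>v\<close> only in 0, hence is the line through \<open>x\<close>.\<close>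
  have Qv: "z = 0" if "M *v z = z" "v \<bullet> z = 0" for z
  proof -
    have "(M ** transvection v s) *v z = z"
      using that by (simp add: matrix_vector_mul_assoc[symmetric] transvection_vector)
    then show ?thesis using v det_0_iff_fixed[of "M ** transvection v s"] by auto
  qed
  have vx: "v \<bullet> x \<noteq> 0" using Qv x by blast
  have Qn: "Q w \<noteq> 0" if w: "w \<bullet> x \<noteq> 0" for w
  proof
    assume "Q w = 0"
    then obtain y where y: "y \<noteq> 0" "(M ** transvection w 1) *v y = y"
      using detQ[of w 1] det_0_iff_fixed[of "M ** transvection w 1"] by auto
    from transvection_fixed[OF M x(1) w one_neq_zero y(2)] have y': "w \<bullet> y = 0" "M *v y = y" .
    have "(v \<bullet> x) *\<^sub>R y - (v \<bullet> y) *\<^sub>R x = 0"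
      by (rule Qv) (simp_all add: x y' matrix_vector_mult_diff_distrib matrix_vector_mult_scaleR
          inner_diff_right mult.commute)
    then have e: "(v \<bullet> x) *\<^sub>R y = (v \<bullet> y) *\<^sub>R x" by simp
    from arg_cong[OF this, of "inner w"] have "v \<bullet> y = 0" using y' w by simp
    with e vx y show False by simp
  qed
  have cQ: "continuous_on S Q" for S
    unfolding Q_def outer_def matrix_vector_mul_assoc
    by (intro linear_continuous_on_compose[OF _ lin] continuous_intros
        linear_continuous_on matrix_vector_mul_bounded_linear)
  have Qm: "Q (- w) = Q w" for w
    by (simp add: Q_def outer_def matrix_vector_mult_minus_right)
  \<comment> \<open>Each open half-space is connected and \<open>Q\<close> has no zero on it, so its
    sign is constant there; evenness of \<open>Q\<close> makes the signs on the two sides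
    agree.\<close>
  have sgnQ: "Q w * Q w' > 0" if "w \<bullet> x \<noteq> 0" "w' \<bullet> x \<noteq> 0" for w w'
  proof -
    have pos: "Q w * Q w' > 0" if "w \<bullet> x > 0" "w' \<bullet> x > 0" for w w'
    proof -
      have c: "connected (Q ` {w. 0 < x \<bullet> w})"
        by (intro connected_continuous_image cQ convex_connected convex_halfspace_gt)
      have "0 \<notin> Q ` {w. 0 < x \<bullet> w}" using Qn by (force simp: inner_commute)
      then have "\<not> (Q a \<le> 0 \<and> 0 \<le> Q b)" if "x \<bullet> a > 0" "x \<bullet> b > 0" for a b
        using connectedD_interval[OF c, of "Q a" "Q b" 0] that by auto
      from this[of w w'] this[of w' w] show ?thesis
        using that by (auto simp: inner_commute zero_less_mult_iff not_le)
    qed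
    show ?thesis
      using pos[of w w'] pos[of "- w" w'] pos[of w "- w'"] pos[of "- w" "- w'"] that
      unfolding Qm inner_minus_left by linarith
  qed
  have "((\<lambda>t. M ** mexp (t *\<^sub>R J_mat) - mat 1) has_vector_derivative M ** J_mat) (at 0)"
  proof -
    have "((\<lambda>t. (cos t *\<^sub>R M + sin t *\<^sub>R (M ** J_mat)) - mat 1) has_vector_derivative M ** J_mat) (at 0)"
      by (auto intro!: derivative_eq_intros simp: has_real_derivative_iff_has_vector_derivative[symmetric])
    then show ?thesis by (simp add: mexp_J matrix_ring)
  qed
  moreover have "(det has_derivative D) (at (M ** mexp (0 *\<^sub>R J_mat) - mat 1) within S)" for S
    using D mexp_J[of 0, where 'a='d] by (simp add: has_derivative_at_withinI)
  ultimately have "((\<lambda>t. det (M ** mexp (t *\<^sub>R J_mat) - mat 1)) has_vector_derivative D (M ** J_mat)) (at 0)"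
    using vector_derivative_diff_chain_within[of "\<lambda>t. M ** mexp (t *\<^sub>R J_mat) - mat 1" _ 0 UNIV det D]
    by (simp only: o_def)
  then have co: "coorient 1 M = D (M ** J_mat)"
    using coorient_has_derivative[of M] vector_derivative_unique_at
    by (auto simp: has_real_derivative_iff_has_vector_derivative)
  have "M ** J_mat = (\<Sum>k\<in>UNIV. outer (M *v (J_mat *v axis k 1)) (axis k 1))"
    unfolding matrix_vector_mul_assoc by (rule matrix_eq_sum_outer)
  then have coQ: "coorient 1 M = (\<Sum>k\<in>UNIV. Q (axis k 1))"
    by (simp add: co Q_def linear_sum[OF lin])
  obtain k where k: "x $ k \<noteq> 0" using x(2) by (auto simp: vec_eq_iff)
  then have "axis k 1 \<bullet> x \<noteq> 0" by (simp add: inner_axis inner_commute)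
  then have "0 < Q (axis k 1) * Q (axis k 1)" "0 \<le> Q (axis k 1) * Q (axis l 1)" for l
    using sgnQ Q0[of "axis l 1"] by (cases "axis l 1 \<bullet> x = 0"; force)+
  then have "0 < (\<Sum>l\<in>UNIV. Q (axis k 1) * Q (axis l 1))"
    by (intro sum_pos2[of UNIV k]) auto
  then show ?thesis by (auto simp: coQ sum_distrib_left[symmetric])
qed

text \<open>The determinant is affine along the segment and nonzero at its start, so it has at most
  one zero, with nonzero slope. Transvecting back from the crossing to the regular matrix
  \<open>M\<close> supplies the hypothesis of \<open>coorient_nonzero\<close>.\<close>

lemma transvection_segment_transverse:
  fixes M :: "('d::finite) mat2"
  assumes M: "M \<in> Sp" and e: "det (M - mat 1) \<noteq> 0" "det (M ** transvection v s - mat 1) \<noteq> 0"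
  shows "transverse_path 1 (\<lambda>t. M ** transvection v (t * s))"
proof -
  let ?q = "\<lambda>t. M ** transvection v (t * s)"
  obtain b where b: "\<And>r. det (M ** transvection v r - mat 1) = det (M - mat 1) + r * b"
    using det_transvection_affine[of M v] by blast
  have Sp: "?q t \<in> Sp" for t using M by (simp add: Sp_mult transvection_in_Sp)
  have cr: "crossings 1 ?q = {t \<in> {0..1}. det (M - mat 1) + t * (s * b) = 0}"
    using Sp b by (auto simp: crossings_def Sp0_iff algebra_simps)
  have sub: "crossings 1 ?q \<subseteq> {- det (M - mat 1) / (s * b)}"
  proof
    fix t assume "t \<in> crossings 1 ?q"
    then have t: "t * (s * b) = - det (M - mat 1)" by (simp add: cr eq_neg_iff_add_eq_0 add.commute)
    with e(1) have "s * b \<noteq> 0" by auto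
    with t show "t \<in> {- det (M - mat 1) / (s * b)}" by (simp add: field_simps)
  qed
  have "?q differentiable (at t) \<and> coorient 1 (?q t) \<noteq> 0 \<and> crossing_rate 1 ?q t \<noteq> 0"
    if t: "t \<in> crossings 1 ?q" for t
  proof (intro conjI)
    show "?q differentiable at t"
      unfolding transvection_def
      by (intro differentiable_matrix_mult differentiable_add differentiable_scaleR
          differentiable_mult differentiable_const differentiable_ident)
    have "det (?q t - mat 1) = 0" using t by (simp add: crossings_def Sp0_iff)
    then obtain x where "x \<noteq> 0" "?q t *v x = x" using det_0_iff_fixed by blast
    moreover have "?q t ** transvection v (- (t * s)) = M"
      by (simp add: matrix_mul_assoc[symmetric] transvection_add transvection_0)
    ultimately show "coorient 1 (?q t) \<noteq> 0" using coorient_nonzero[OF Sp] e(1) by metis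
    have "crossing_rate 1 ?q t = s * b"
      unfolding crossing_rate_def sp_det_1 b
      by (intro DERIV_imp_deriv) (auto intro!: derivative_eq_intros)
    then show "crossing_rate 1 ?q t \<noteq> 0" using t e(1) by (auto simp: cr)
  qed
  then show ?thesis
    unfolding transverse_path_def
    using e finite_subset[OF sub] by (auto simp: Sp0_iff transvection_0)
qed

section \<open>Joins of transverse paths and homotopies of concatenations\<close>

lemma no_crossing_transverse:
  assumes "\<And>t. t \<in> {0..1} \<Longrightarrow> det (q t - mat 1) \<noteq> 0" shows "transverse_path 1 q"
proof -
  have "crossings 1 q = {}" using assms by (auto simp: crossings_def Sp0_iff)
  then show ?thesis using assms[of 0] assms[of 1] by (simp add: transverse_path_def Sp0_iff)
qed

lemma transverse_compose:
  fixes q :: "real \<Rightarrow> ('d::finite) mat2"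
  assumes q: "q differentiable (at (a * t + b))" "crossing_rate 1 q (a * t + b) \<noteq> 0" and a: "a \<noteq> 0"
    and ev: "\<forall>\<^sub>F s in nhds t. p s = q (a * s + b)"
  shows "p differentiable (at t)" "crossing_rate 1 p t \<noteq> 0"
proof -
  have "(\<lambda>s. a * s + b) differentiable at t" by simp
  from differentiable_chain_at[OF this q(1)] have "(\<lambda>s. q (a * s + b)) differentiable at t"
    by (simp add: o_def)
  then obtain D where D: "((\<lambda>s. q (a * s + b)) has_derivative D) (at t)" unfolding differentiable_def by blast
  have "(p has_derivative D) (at t)"
  proof (rule has_derivative_transform_eventually[OF D])
    show "\<forall>\<^sub>F s in at t. q (a * s + b) = p s"
      using ev unfolding eventually_at_filter by eventually_elim simp
    show "q (a * t + b) = p t" using eventually_nhds_x_imp_x[OF ev] by simp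
  qed simp
  then show "p differentiable (at t)" unfolding differentiable_def by blast
  have "(\<lambda>x. det (q x - mat 1)) differentiable (at (a * t + b))"
    by (intro differentiable_det differentiable_diff q differentiable_const)
  then have "((\<lambda>x. det (q x - mat 1)) has_real_derivative crossing_rate 1 q (a * t + b)) (at (a * t + b))"
    unfolding crossing_rate_def sp_det_1 by (simp add: DERIV_deriv_iff_real_differentiable)
  then have "((\<lambda>s. det (q (a * s + b) - mat 1)) has_real_derivative crossing_rate 1 q (a * t + b) * a) (at t)"
    by (rule DERIV_chain2) (auto intro!: derivative_eq_intros)
  moreover have "deriv (\<lambda>s. sp_det 1 (p s)) t = deriv (\<lambda>s. det (q (a * s + b) - mat 1)) t"
    using ev by (intro deriv_cong_ev) (auto simp: sp_det_1 elim: eventually_mono)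
  ultimately show "crossing_rate 1 p t \<noteq> 0"
    using q a by (simp add: crossing_rate_def DERIV_imp_deriv)
qed

lemma transverse_join:
  assumes t: "transverse_path 1 p" "transverse_path 1 q" and pq: "p 1 = q 0"
  shows "transverse_path 1 (p +++ q)"
proof -
  have end1: "p 0 \<notin> Sp0 1" "p 1 \<notin> Sp0 1" "q 0 \<notin> Sp0 1" "q 1 \<notin> Sp0 1"
    using t by (auto simp: transverse_path_def)
  have cr: "t < 1/2 \<and> 2 * t \<in> crossings 1 p \<or> t > 1/2 \<and> 2 * t - 1 \<in> crossings 1 q"
    if "t \<in> crossings 1 (p +++ q)" for t
  proof -
    \<comment> \<open>The junction is a regular end point, so every crossing lies inside one of the
      halves, where the join is locally an affine reparametrisation.\<close>
    have "t \<noteq> 1/2"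
    proof
      assume t: "t = 1/2"
      show False using that end1 unfolding t by (simp add: crossings_def joinpaths_def)
    qed
    then consider "t < 1/2" | "t > 1/2" by linarith
    then show ?thesis using that by cases (auto simp: crossings_def joinpaths_def)
  qed
  have "crossings 1 (p +++ q) \<subseteq> (\<lambda>t. t / 2) ` crossings 1 p \<union> (\<lambda>t. (t + 1) / 2) ` crossings 1 q"
  proof
    fix t assume "t \<in> crossings 1 (p +++ q)"
    from cr[OF this] show "t \<in> (\<lambda>t. t / 2) ` crossings 1 p \<union> (\<lambda>t. (t + 1) / 2) ` crossings 1 q"
    proof (elim disjE conjE)
      assume "2 * t \<in> crossings 1 p"
      then show ?thesis by (intro UnI1 image_eqI[of _ _ "2 * t"]) simp_all
    next
      assume "2 * t - 1 \<in> crossings 1 q"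
      then show ?thesis by (intro UnI2 image_eqI[of _ _ "2 * t - 1"]) simp_all
    qed
  qed
  then have "finite (crossings 1 (p +++ q))"
    using t by (auto simp: transverse_path_def elim!: finite_subset)
  moreover have "(p +++ q) differentiable (at t) \<and> coorient 1 ((p +++ q) t) \<noteq> 0 \<and> crossing_rate 1 (p +++ q) t \<noteq> 0"
    if tc: "t \<in> crossings 1 (p +++ q)" for t
    using cr[OF tc]
  proof (elim disjE conjE)
    assume lt: "t < 1/2" and c: "2 * t \<in> crossings 1 p"
    have ev: "\<forall>\<^sub>F s in nhds t. (p +++ q) s = p (2 * s + 0)"
      using eventually_nhds_in_open[of "{..<1/2}" t] lt by (auto simp: joinpaths_def elim!: eventually_mono)
    have "p differentiable (at (2 * t + 0))" "crossing_rate 1 p (2 * t + 0) \<noteq> 0" "coorient 1 (p (2 * t)) \<noteq> 0"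
      using c t(1) by (auto simp: transverse_path_def)
    then show ?thesis
      using transverse_compose[OF _ _ _ ev] lt by (simp add: joinpaths_def)
  next
    assume lt: "t > 1/2" and c: "2 * t - 1 \<in> crossings 1 q"
    have ev: "\<forall>\<^sub>F s in nhds t. (p +++ q) s = q (2 * s + (- 1))"
      using eventually_nhds_in_open[of "{1/2<..}" t] lt by (auto simp: joinpaths_def elim!: eventually_mono)
    have "q differentiable (at (2 * t + (- 1)))" "crossing_rate 1 q (2 * t + (- 1)) \<noteq> 0" "coorient 1 (q (2 * t - 1)) \<noteq> 0"
      using c t(2) by (auto simp: transverse_path_def)
    then show ?thesis
      using transverse_compose[OF _ _ _ ev] lt by (simp add: joinpaths_def)
  qed
  ultimately show ?thesis
    using end1 by (auto simp: transverse_path_def joinpaths_def)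
qed

lemma homotopic_paths_join_left:
  "homotopic_paths S q q' \<Longrightarrow> path p \<Longrightarrow> path_image p \<subseteq> S \<Longrightarrow> pathfinish p = pathstart q \<Longrightarrow>
    homotopic_paths S (p +++ q) (p +++ q')"
  by (intro homotopic_paths_join) auto

lemma homotopic_paths_reassoc:
  assumes "path a" "path b" "path c" "path d" "path e"
    and "path_image a \<subseteq> S" "path_image b \<subseteq> S" "path_image c \<subseteq> S" "path_image d \<subseteq> S" "path_image e \<subseteq> S"
    and "pathfinish a = pathstart b" "pathfinish b = pathstart c" "pathfinish c = pathstart d"
      "pathfinish d = pathstart e"
  shows "homotopic_paths S (a +++ ((b +++ (c +++ d)) +++ e)) ((a +++ b) +++ (c +++ (d +++ e)))"
proof -
  have "homotopic_paths S ((b +++ (c +++ d)) +++ e) (b +++ ((c +++ d) +++ e))"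
    using assms by (intro homotopic_paths_sym[OF homotopic_paths_assoc])
      (auto simp: path_image_join)
  moreover have "homotopic_paths S (b +++ ((c +++ d) +++ e)) (b +++ (c +++ (d +++ e)))"
    using assms by (intro homotopic_paths_join_left[OF homotopic_paths_sym[OF homotopic_paths_assoc]])
      (auto simp: path_image_join)
  ultimately have "homotopic_paths S ((b +++ (c +++ d)) +++ e) (b +++ (c +++ (d +++ e)))"
    by (rule homotopic_paths_trans)
  then have "homotopic_paths S (a +++ ((b +++ (c +++ d)) +++ e)) (a +++ (b +++ (c +++ (d +++ e))))"
    using assms by (intro homotopic_paths_join_left) auto
  moreover have "homotopic_paths S (a +++ (b +++ (c +++ (d +++ e)))) ((a +++ b) +++ (c +++ (d +++ e)))"
    using assms by (intro homotopic_paths_assoc) (auto simp: path_image_join)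
  ultimately show ?thesis by (rule homotopic_paths_trans)
qed

text \<open>Inserts \<open>z\<close> followed by its reverse between \<open>b\<close> and
  \<open>c\<close>; this moves a division point of a path to the far end of
  \<open>z\<close>.\<close>

lemma homotopic_paths_cancel:
  fixes a b c d z :: "real \<Rightarrow> 'a::real_normed_vector"
  assumes "path a" "path b" "path c" "path d" "path z"
    and "path_image a \<subseteq> S" "path_image b \<subseteq> S" "path_image c \<subseteq> S" "path_image d \<subseteq> S" "path_image z \<subseteq> S"
    and "pathfinish a = pathstart b" "pathfinish b = pathstart c" "pathfinish c = pathstart d"
      "pathstart z = pathfinish b"
  shows "homotopic_paths S (a +++ ((b +++ c) +++ d)) ((a +++ (b +++ z)) +++ (reversepath z +++ (c +++ d)))"
proof -
  let ?r = "c +++ d" and ?z = "reversepath z"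
  note simps = path_image_join assms
  have "homotopic_paths S ((b +++ c) +++ d) (b +++ ?r)"
    by (intro homotopic_paths_sym[OF homotopic_paths_assoc]) (simp_all add: simps)
  also have "homotopic_paths S (b +++ ?r) (b +++ (linepath (pathstart z) (pathstart z) +++ ?r))"
  proof (rule homotopic_paths_join_left)
    show "homotopic_paths S ?r (linepath (pathstart z) (pathstart z) +++ ?r)"
      using homotopic_paths_lid[of ?r S] by (intro homotopic_paths_sym[of S _ ?r]) (simp_all add: simps)
  qed (simp_all add: simps)
  also have "homotopic_paths S (b +++ (linepath (pathstart z) (pathstart z) +++ ?r)) (b +++ ((z +++ ?z) +++ ?r))"
    by (intro homotopic_paths_join_left homotopic_paths_join homotopic_paths_sym[OF homotopic_paths_rinv]) (simp_all add: simps)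
  also have "homotopic_paths S (b +++ ((z +++ ?z) +++ ?r)) (b +++ (z +++ (?z +++ ?r)))"
    by (intro homotopic_paths_join_left[OF homotopic_paths_sym[OF homotopic_paths_assoc]]) (simp_all add: simps)
  also have "homotopic_paths S (b +++ (z +++ (?z +++ ?r))) ((b +++ z) +++ (?z +++ ?r))"
    by (intro homotopic_paths_assoc) (simp_all add: simps)
  finally have "homotopic_paths S (a +++ ((b +++ c) +++ d)) (a +++ ((b +++ z) +++ (?z +++ ?r)))"
    by (intro homotopic_paths_join_left) (simp_all add: simps)
  also have "homotopic_paths S (a +++ ((b +++ z) +++ (?z +++ ?r))) ((a +++ (b +++ z)) +++ (?z +++ ?r))"
    by (intro homotopic_paths_assoc) (simp_all add: simps)
  finally show ?thesis .
qed

text \<open>Two paths with common ends in a convex set are linearly homotopic. Applied to a map on a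
  strip or square, this makes two ways around a rectangle homotopic.\<close>

lemma homotopic_paths_convex_image:
  fixes f :: "'a::real_normed_vector \<Rightarrow> 'b::topological_space"
  assumes "convex C" "continuous_on C f" "f ` C \<subseteq> S"
    and "path g" "path h" "path_image g \<subseteq> C" "path_image h \<subseteq> C"
      "pathstart g = pathstart h" "pathfinish g = pathfinish h"
  shows "homotopic_paths S (f \<circ> g) (f \<circ> h)"
proof (rule homotopic_paths_continuous_image)
  show "homotopic_paths C g h"
    using assms by (intro homotopic_paths_linear closed_segment_subset)
      (auto simp: path_image_def)
qed (use assms in auto)

section \<open>Paths composed of transvections\<close>

fun transvection_prod :: "((real ^ ('d + 'd)) \<times> real) list \<Rightarrow> ('d::finite) mat2" where
  "transvection_prod [] = mat 1"
| "transvection_prod ((v, s) # l) = transvection v s ** transvection_prod l"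

definition transvection_segment :: "('d::finite) mat2 \<Rightarrow> real ^ ('d + 'd) \<Rightarrow> real \<Rightarrow> real \<Rightarrow> 'd mat2" where
  "transvection_segment M v s = (\<lambda>t. M ** transvection v (t * s))"

fun transvection_path :: "((real ^ ('d + 'd)) \<times> real) list \<Rightarrow> ('d::finite) mat2 \<Rightarrow> real \<Rightarrow> 'd mat2" where
  "transvection_path [] M = (\<lambda>t. M)"
| "transvection_path ((v, s) # l) M = transvection_segment M v s +++ transvection_path l (M ** transvection v s)"

lemma transvection_prod_in_Sp: "transvection_prod l \<in> Sp"
  by (induction l rule: transvection_prod.induct) (auto simp: mat_1_in_Sp Sp_mult transvection_in_Sp)

lemma transvection_segment: "path (transvection_segment M v s)" "pathstart (transvection_segment M v s) = M"
  "pathfinish (transvection_segment M v s) = M ** transvection v s"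
  by (auto simp: transvection_segment_def path_def pathstart_def pathfinish_def transvection_0 intro!: continuous_intros)

lemma transvection_segment_image: "M \<in> Sp \<Longrightarrow> path_image (transvection_segment M v s) \<subseteq> Sp"
  by (auto simp: transvection_segment_def path_image_def Sp_mult transvection_in_Sp)

lemma transvection_path_ends: "pathstart (transvection_path l M) = M \<and> pathfinish (transvection_path l M) = M ** transvection_prod l"
  by (induction l arbitrary: M rule: transvection_prod.induct)
    (auto simp: transvection_segment matrix_mul_assoc, simp_all add: pathstart_def pathfinish_def)

lemmas transvection_path_start [simp] = transvection_path_ends[THEN conjunct1] and transvection_path_finish [simp] = transvection_path_ends[THEN conjunct2]

lemma path_transvection_path: "path (transvection_path l M)"
proof (induction l arbitrary: M rule: transvection_prod.induct)
  case 1 show ?case by (simp add: path_def continuous_on_const)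
qed (simp add: transvection_segment)

lemma transvection_path_image: "M \<in> Sp \<Longrightarrow> path_image (transvection_path l M) \<subseteq> Sp"
proof (induction l arbitrary: M rule: transvection_prod.induct)
  case 1 then show ?case by (auto simp: path_image_def)
next
  case (2 v s l)
  then have "path_image (transvection_path l (M ** transvection v s)) \<subseteq> Sp" by (simp add: Sp_mult transvection_in_Sp)
  with transvection_segment_image[OF 2(2)] show ?case by (simp add: path_image_join transvection_segment)
qed

lemma mult_transvection_path: "A ** transvection_path l M t = transvection_path l (A ** M) t"
  by (induction l arbitrary: M t rule: transvection_prod.induct) (auto simp: joinpaths_def transvection_segment_def matrix_mul_assoc)

text \<open>The left inverse \<open>- J N\<^sup>T J\<close> of \<open>N\<close> is also a right
  inverse.\<close>

lemma Sp_transpose: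
  assumes "N \<in> Sp" shows "N ** J_mat ** transpose N = J_mat"
proof -
  have "(- (J_mat ** transpose N ** J_mat)) ** N = mat 1"
    using assms by (simp add: Sp_iff matrix_minus_left matrix_mul_assoc[symmetric] J_mat_mult_J_mat)
  then have "N ** (- (J_mat ** transpose N ** J_mat)) = mat 1"
    using matrix_left_right_inverse by blast
  then have "N ** J_mat ** transpose N ** J_mat = - mat 1"
    by (simp add: matrix_minus_right matrix_mul_assoc minus_equation_iff)
  then have "N ** J_mat ** transpose N ** J_mat ** J_mat = - J_mat"
    by (simp add: matrix_minus_left)
  then show ?thesis by (simp add: matrix_mul_assoc[symmetric] J_mat_mult_J_mat matrix_minus_right)
qed

text \<open>Conjugation by a symplectic matrix takes transvections to transvections, because
  \<open>N\<close> maps \<open>J N\<^sup>T v\<close> to \<open>J v\<close>.\<close>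

lemma transvection_conj:
  assumes "N \<in> Sp" shows "transvection v s ** N = N ** transvection (transpose N *v v) s"
proof -
  have "N *v (J_mat *v (transpose N *v v)) = J_mat *v v"
    by (simp only: matrix_vector_mul_assoc matrix_mul_assoc Sp_transpose[OF assms])
  then show ?thesis
    by (simp add: transvection_def matrix_ring matrix_mult_outer outer_mult_matrix)
qed

lemma finite_affine_zero:
  fixes c :: real
  assumes "c \<noteq> 0" shows "finite {r. c + r * b = 0}"
proof (rule finite_subset)
  have "r = - c / b" if "c + r * b = 0" for r
    using that assms by (cases "b = 0") (auto simp: field_simps)
  then show "{r. c + r * b = 0} \<subseteq> {- c / b}" by blast
qed simp

text \<open>A bad first vertex is moved along the first transvection; the resulting displacement of the
  end point is undone by one more transvection, conjugated past the remaining factors.\<close>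

lemma transvection_path_homotopic_transverse:
  fixes M :: "('d::finite) mat2"
  assumes "M \<in> Sp" "det (M - mat 1) \<noteq> 0" "det (M ** transvection_prod l - mat 1) \<noteq> 0"
  shows "\<exists>q. homotopic_paths Sp (transvection_path l M) q \<and> transverse_path 1 q"
  using assms
proof (induction l arbitrary: M rule: transvection_prod.induct)
  case 1
  then have "homotopic_paths Sp (transvection_path [] M) (transvection_path [] M)"
    using transvection_path_image[of M "[]"] path_transvection_path[of "[]" M] by simp
  moreover have "transverse_path 1 (transvection_path [] M)" using 1 by (intro no_crossing_transverse) simp
  ultimately show ?case by blast
next
  case (2 v s l)
  define N where "N = (transvection_prod l :: 'd mat2)"
  define w where "w = transpose N *v v"
  have N: "N \<in> Sp" by (simp add: N_def transvection_prod_in_Sp)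
  have w: "transvection v r ** N = N ** transvection w r" for r
    unfolding w_def by (rule transvection_conj[OF N])
  obtain b where b: "\<And>r. det (M ** transvection v r - mat 1) = det (M - mat 1) + r * b"
    using det_transvection_affine[of M v] by blast
  define E where "E = M ** transvection v s ** N"
  obtain b' where b': "\<And>r. det (E ** transvection w r - mat 1) = det (E - mat 1) + r * b'"
    using det_transvection_affine[of E w] by blast
  have E: "det (E - mat 1) \<noteq> 0" using 2 by (simp add: E_def N_def matrix_mul_assoc)
  have "finite ({r. det (M - mat 1) + r * b = 0} \<union> {r. det (E - mat 1) + (r - s) * b' = 0})"
  proof -
    have "{r. det (E - mat 1) + (r - s) * b' = 0} = (\<lambda>r. r + s) ` {r. det (E - mat 1) + r * b' = 0}"
      by (force simp: image_iff)
    then show ?thesis using finite_affine_zero[of _ b] finite_affine_zero[of _ b'] E 2 by simp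
  qed
  \<comment> \<open>Excluded are the \<open>r\<close> at which the moved vertex or the end of the
    moved remainder is singular. Both determinants are affine in \<open>r\<close> and not
    identically zero: the first is regular at \<open>r = 0\<close>, the second at
    \<open>r = s\<close>.\<close>
  then obtain r where r: "r \<notin> {r. det (M - mat 1) + r * b = 0} \<union> {r. det (E - mat 1) + (r - s) * b' = 0}"
    using ex_new_if_finite[OF infinite_UNIV_char_0] by metis
  have Mr: "det (M ** transvection v r - mat 1) \<noteq> 0" using r b by simp
  have EM: "M ** transvection v a ** N = E ** transvection w (a - s)" for a
  proof -
    have "M ** transvection v a ** N = M ** transvection v s ** (transvection v (a - s) ** N)"
      by (simp add: matrix_mul_assoc[symmetric]) (simp add: matrix_mul_assoc transvection_add
          matrix_mul_assoc[of "transvection v s" "transvection v (a - s)"])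
    then show ?thesis by (simp only: w E_def matrix_mul_assoc)
  qed
  let ?M = "M ** transvection v r"
  have Er: "det (?M ** N - mat 1) \<noteq> 0" using r b' by (simp add: EM)
  have MSp: "?M \<in> Sp" "?M ** N \<in> Sp" using 2 N by (simp_all add: Sp_mult transvection_in_Sp)
  obtain q where q: "homotopic_paths Sp (transvection_path l ?M) q" "transverse_path 1 q"
    using 2(1)[OF MSp(1) Mr] Er by (auto simp: N_def)
  define q' where "q' = transvection_segment M v r +++ (transvection_path l ?M +++ transvection_segment (?M ** N) w (s - r))"
  \<comment> \<open>The first coordinate is the parameter of the first transvection, the second the
    time along the remaining path. The given path runs through \<open>(0, 0)\<close>,
    \<open>(s, 0)\<close>, \<open>(s, 1)\<close>, the new one through \<open>(0, 0)\<close>,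
    \<open>(r, 0)\<close>, \<open>(r, 1)\<close>, \<open>(s, 1)\<close>.\<close>
  define \<Phi> where "\<Phi> z = M ** transvection v (fst z) ** transvection_path l (mat 1) (snd z)" for z
  have e0: "transvection_path l (mat 1) 0 = (mat 1 :: 'd mat2)" and e1: "transvection_path l (mat 1) 1 = N"
    using transvection_path_start[of l "mat 1"] transvection_path_finish[of l "mat 1"] by (simp_all add: pathstart_def pathfinish_def N_def)
  have f1: "\<Phi> \<circ> linepath (0, 0) (a, 0) = transvection_segment M v a" for a
    by (rule ext) (simp add: \<Phi>_def transvection_segment_def linepath_def e0 algebra_simps)
  have f2: "\<Phi> \<circ> linepath (a, 0) (a, 1) = transvection_path l (M ** transvection v a)" for a
    by (rule ext) (simp add: \<Phi>_def linepath_def mult_transvection_path algebra_simps)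
  have f3: "\<Phi> \<circ> linepath (r, 1) (s, 1) = transvection_segment (?M ** N) w (s - r)"
  proof
    fix t
    have "(1 - t) *\<^sub>R (r, 1::real) + t *\<^sub>R (s, 1) = (r + t * (s - r), 1)" by (simp add: algebra_simps)
    then have "(\<Phi> \<circ> linepath (r, 1) (s, 1)) t = E ** transvection w (r + t * (s - r) - s)"
      by (simp add: \<Phi>_def linepath_def e1 EM)
    also have "\<dots> = E ** transvection w (r - s) ** transvection w (t * (s - r))"
      by (simp add: matrix_mul_assoc[symmetric] transvection_add algebra_simps)
    finally show "(\<Phi> \<circ> linepath (r, 1) (s, 1)) t = transvection_segment (?M ** N) w (s - r) t"
      by (simp add: transvection_segment_def EM)
  qed
  have "homotopic_paths Sp (\<Phi> \<circ> (linepath (0, 0) (s, 0) +++ linepath (s, 0) (s, 1)))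
     (\<Phi> \<circ> (linepath (0, 0) (r, 0) +++ (linepath (r, 0) (r, 1) +++ linepath (r, 1) (s, 1))))"
  proof (rule homotopic_paths_convex_image[where C="UNIV \<times> {0..1}"])
    show "convex (UNIV \<times> {0..1::real} :: (real \<times> real) set)" by (intro convex_Times) auto
    have "continuous_on {0..1} (transvection_path l (mat 1) :: _ \<Rightarrow> 'd mat2)" using path_transvection_path path_def by blast
    then have "continuous_on (UNIV \<times> {0..1}) (\<lambda>z :: real \<times> real. transvection_path l (mat 1) (snd z) :: 'd mat2)"
      by (rule continuous_on_compose2) (auto intro!: continuous_intros)
    then show "continuous_on (UNIV \<times> {0..1}) \<Phi>"
      unfolding \<Phi>_def by (intro continuous_intros)
    have "transvection_path l (mat 1) t \<in> Sp" if "t \<in> {0..1}" for t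
      using transvection_path_image[OF mat_1_in_Sp, of l] that by (auto simp: path_image_def)
    then show "\<Phi> ` (UNIV \<times> {0..1}) \<subseteq> Sp"
      using 2 by (auto simp: \<Phi>_def intro!: Sp_mult transvection_in_Sp)
    show "path_image (linepath (0, 0::real) (s, 0) +++ linepath (s, 0) (s, 1)) \<subseteq> UNIV \<times> {0..1}"
      "path_image (linepath (0, 0::real) (r, 0) +++ (linepath (r, 0) (r, 1) +++ linepath (r, 1) (s, 1))) \<subseteq> UNIV \<times> {0..1}"
      by (auto simp: path_image_join closed_segment_def algebra_simps)
  qed auto
  then have "homotopic_paths Sp (transvection_path ((v, s) # l) M) q'"
    by (simp add: path_compose_join f1 f2 f3 q'_def)
  moreover have "homotopic_paths Sp q' (transvection_segment M v r +++ (q +++ transvection_segment (?M ** N) w (s - r)))"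
    unfolding q'_def using q(1) MSp 2 transvection_segment_image[of M] transvection_segment_image[OF MSp(2)]
    by (intro homotopic_paths_join) (auto simp: transvection_segment N_def)
  moreover have "transverse_path 1 (transvection_segment M v r +++ (q +++ transvection_segment (?M ** N) w (s - r)))"
  proof (intro transverse_join)
    show "transverse_path 1 (transvection_segment M v r)"
      unfolding transvection_segment_def using 2 Mr by (intro transvection_segment_transverse) auto
    have "?M ** N ** transvection w (s - r) = E"
      unfolding EM by (simp add: matrix_mul_assoc[symmetric] transvection_add transvection_0)
    then show "transverse_path 1 (transvection_segment (?M ** N) w (s - r))"
      unfolding transvection_segment_def using Er E by (intro transvection_segment_transverse MSp) auto
    show "transverse_path 1 q" by (rule q)
    have qe: "q 0 = ?M" "q 1 = ?M ** N"
      using homotopic_paths_imp_pathstart[OF q(1), unfolded transvection_path_start]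
        homotopic_paths_imp_pathfinish[OF q(1), unfolded transvection_path_finish]
      by (simp_all add: N_def pathstart_def pathfinish_def)
    show "q 1 = transvection_segment (?M ** N) w (s - r) 0" by (simp add: qe transvection_segment_def transvection_0)
    show "transvection_segment M v r 1 = (q +++ transvection_segment (?M ** N) w (s - r)) 0" by (simp add: qe transvection_segment_def joinpaths_def)
  qed
  ultimately show ?case using homotopic_paths_trans by blast
qed

section \<open>Paths homotopic to transvection paths\<close>

lemma homotopic_paths_rid_const:
  fixes p :: "real \<Rightarrow> 'a::real_normed_vector"
  assumes "path p" "path_image p \<subseteq> S" "pathfinish p = x"
  shows "homotopic_paths S (p +++ (\<lambda>_. x)) p"
  using homotopic_paths_rid[OF assms(1,2)] assms(3) by (simp add: linepath_refl)

lemma homotopic_paths_lid_const: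
  fixes p :: "real \<Rightarrow> 'a::real_normed_vector"
  assumes "path p" "path_image p \<subseteq> S" "pathstart p = x"
  shows "homotopic_paths S ((\<lambda>_. x) +++ p) p"
  using homotopic_paths_lid[OF assms(1,2)] assms(3) by (simp add: linepath_refl)

text \<open>Taken up to homotopy, the class is closed under joins and reversal; its members serve as
  connectors to regular matrices.\<close>

definition elementary :: "(real \<Rightarrow> ('d::finite) mat2) \<Rightarrow> bool" where
  "elementary c \<longleftrightarrow> (\<exists>l M. M \<in> Sp \<and> homotopic_paths Sp c (transvection_path l M))"

lemma elementary_transvection_path: "M \<in> Sp \<Longrightarrow> elementary (transvection_path l M)"
  unfolding elementary_def using path_transvection_path transvection_path_image by (metis homotopic_paths_refl)

lemma elementary_path: "elementary c \<Longrightarrow> path c" "elementary c \<Longrightarrow> path_image c \<subseteq> Sp"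
  unfolding elementary_def by (blast dest: homotopic_paths_imp_path homotopic_paths_imp_subset)+

lemma transvection_path_append:
  assumes "M \<in> Sp"
  shows "homotopic_paths Sp (transvection_path l M +++ transvection_path l' (M ** transvection_prod l)) (transvection_path (l @ l') M)"
  using assms
proof (induction l arbitrary: M rule: transvection_prod.induct)
  case 1
  then show ?case
    using homotopic_paths_lid_const[OF path_transvection_path transvection_path_image, of M l' M] by simp
next
  case (2 v s l)
  let ?M = "M ** transvection v s"
  have M: "?M \<in> Sp" using 2(2) by (simp add: Sp_mult transvection_in_Sp)
  have M': "?M ** transvection_prod l \<in> Sp" using M by (simp add: Sp_mult transvection_prod_in_Sp)
  have "homotopic_paths Sp ((transvection_segment M v s +++ transvection_path l ?M) +++ transvection_path l' (?M ** transvection_prod l))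
     (transvection_segment M v s +++ (transvection_path l ?M +++ transvection_path l' (?M ** transvection_prod l)))"
    using 2(2) by (intro homotopic_paths_sym[OF homotopic_paths_assoc])
      (simp_all add: transvection_segment transvection_segment_image path_transvection_path transvection_path_image M M')
  also have "homotopic_paths Sp (transvection_segment M v s +++ (transvection_path l ?M +++ transvection_path l' (?M ** transvection_prod l)))
     (transvection_segment M v s +++ transvection_path (l @ l') ?M)"
    using 2(2) by (intro homotopic_paths_join_left 2(1) M) (simp_all add: transvection_segment transvection_segment_image)
  finally show ?case by (simp add: matrix_mul_assoc)
qed

lemma elementary_join:
  assumes "elementary c" "elementary c'" "pathfinish c = pathstart c'"
  shows "elementary (c +++ c')"
proof -
  obtain l M l' M' where c: "M \<in> Sp" "homotopic_paths Sp c (transvection_path l M)"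
    and c': "M' \<in> Sp" "homotopic_paths Sp c' (transvection_path l' M')"
    using assms unfolding elementary_def by blast
  have "M' = M ** transvection_prod l"
    using homotopic_paths_imp_pathfinish[OF c(2)] homotopic_paths_imp_pathstart[OF c'(2)] assms(3) by simp
  moreover have "homotopic_paths Sp (c +++ c') (transvection_path l M +++ transvection_path l' M')"
    by (intro homotopic_paths_join c c' assms)
  ultimately have "homotopic_paths Sp (c +++ c') (transvection_path (l @ l') M)"
    using transvection_path_append[OF c(1)] homotopic_paths_trans by blast
  with c(1) show ?thesis unfolding elementary_def by blast
qed

lemma elementary_homotopic: "elementary c \<Longrightarrow> homotopic_paths Sp c' c \<Longrightarrow> elementary c'"
  unfolding elementary_def using homotopic_paths_trans by blast

lemma elementary_transvection_segment:
  assumes "M \<in> Sp" shows "elementary (transvection_segment M v s)"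
proof -
  have "homotopic_paths Sp (transvection_path [(v, s)] M) (transvection_segment M v s)"
    using assms by (simp add: homotopic_paths_rid_const transvection_segment transvection_segment_image)
  then show ?thesis
    using elementary_homotopic[OF elementary_transvection_path[OF assms]] homotopic_paths_sym by blast
qed

lemma elementary_const: "M \<in> Sp \<Longrightarrow> elementary (\<lambda>_. M)"
  using elementary_transvection_path[of M "[]"] by simp

lemma elementary_reverse:
  assumes "elementary c" shows "elementary (reversepath c)"
proof -
  have "elementary (reversepath (transvection_path l M))" if "M \<in> Sp" for l M
    using that
  proof (induction l arbitrary: M rule: transvection_prod.induct)
    case 1 then show ?case by (simp add: reversepath_def elementary_const)
  next
    case (2 v s l)
    have M: "M ** transvection v s \<in> Sp" using 2(2) by (simp add: Sp_mult transvection_in_Sp)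
    have "transvection v s ** transvection v (- (t * s)) = transvection v ((1 - t) * s)" for t
      by (simp add: transvection_add algebra_simps)
    then have "reversepath (transvection_segment M v s) = transvection_segment (M ** transvection v s) v (- s)"
      by (simp add: reversepath_def transvection_segment_def matrix_mul_assoc[symmetric])
    then show ?case
      using elementary_join[OF 2(1)[OF M] elementary_transvection_segment[OF M, of v "- s"]]
      by (simp add: reversepath_joinpaths transvection_segment)
  qed
  moreover obtain l M where c: "M \<in> Sp" "homotopic_paths Sp c (transvection_path l M)"
    using assms unfolding elementary_def by blast
  ultimately show ?thesis
    using elementary_homotopic homotopic_paths_reversepath_D by blast
qed

lemma elementary_homotopic_transverse:
  assumes "elementary c" "det (pathstart c - mat 1) \<noteq> 0" "det (pathfinish c - mat 1) \<noteq> 0"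
  shows "\<exists>q. homotopic_paths Sp c q \<and> transverse_path 1 q"
proof -
  obtain l M where c: "M \<in> Sp" "homotopic_paths Sp c (transvection_path l M)"
    using assms unfolding elementary_def by blast
  have ends: "pathstart c = M" "pathfinish c = M ** transvection_prod l"
    using homotopic_paths_imp_pathstart[OF c(2)] homotopic_paths_imp_pathfinish[OF c(2)] by simp_all
  then obtain q where "homotopic_paths Sp (transvection_path l M) q" "transverse_path 1 q"
    using transvection_path_homotopic_transverse[OF c(1), of l] assms(2,3) unfolding ends by blast
  then show ?thesis using c(2) homotopic_paths_trans by blast
qed

text \<open>A transvection along a fixed vector \<open>w\<close> removes \<open>w\<close> from the
  fixed space and adds nothing to it, since \<open>w \<bullet> w \<noteq> 0\<close>; so the
  dimension drops until no fixed vector is left.\<close>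

lemma ex_transvection_prod_regular:
  fixes M :: "('d::finite) mat2"
  assumes "M \<in> Sp" shows "\<exists>l. det (M ** transvection_prod l - mat 1) \<noteq> 0"
  using assms
proof (induction "dim {x. M *v x = x}" arbitrary: M rule: less_induct)
  case less
  show ?case
  proof (cases "det (M - mat 1) = 0")
    case False then show ?thesis by (intro exI[of _ "[]"]) simp
  next
    case True
    then obtain w where w: "w \<noteq> 0" "M *v w = w" using det_0_iff_fixed by blast
    let ?M = "M ** transvection w 1"
    have sub: "x \<in> {x. M *v x = x} \<inter> {x. w \<bullet> x = 0}" if "?M *v x = x" for x
      using transvection_fixed[OF less(2) w(2) _ _ that] w(1) by simp
    have s: "subspace {x. A *v x = x}" for A :: "'d mat2"
      by (auto intro!: subspaceI simp: matrix_vector_right_distrib matrix_vector_mult_scaleR)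
    have "{x. ?M *v x = x} \<subset> {x. M *v x = x}"
    proof
      show "{x. ?M *v x = x} \<subseteq> {x. M *v x = x}" using sub by blast
      have "?M *v w \<noteq> w" using sub[of w] w(1) by auto
      with w(2) show "{x. ?M *v x = x} \<noteq> {x. M *v x = x}" by blast
    qed
    then have "dim {x. ?M *v x = x} < dim {x. M *v x = x}"
      by (intro dim_psubset) (simp add: span_eq_iff[THEN iffD2, OF s])
    moreover have "?M \<in> Sp" using less(2) by (simp add: Sp_mult transvection_in_Sp)
    ultimately obtain l where "det (?M ** transvection_prod l - mat 1) \<noteq> 0" using less(1) by blast
    then show ?thesis by (intro exI[of _ "(w, 1) # l"]) (simp add: matrix_mul_assoc)
  qed
qed

text \<open>On a short interval the translate by a suitable product stays off the hypersurface, so that only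
  the two transvection paths have crossings.\<close>

lemma subpath_homotopic_translate:
  fixes p :: "real \<Rightarrow> ('d::finite) mat2"
  assumes p: "path p" "path_image p \<subseteq> Sp" and ab: "a \<in> {0..1}" "b \<in> {0..1}"
  shows "homotopic_paths Sp (subpath a b p)
    (transvection_path l (p a) +++ ((\<lambda>t. subpath a b p t ** transvection_prod l) +++ reversepath (transvection_path l (p b))))"
proof -
  \<comment> \<open>On the unit square: the subpath on the bottom side, its translate on the top
    side, the transvection paths from \<open>p a\<close> and \<open>p b\<close> on the vertical
    sides.\<close>
  define \<Phi> where "\<Phi> z = subpath a b p (fst z) ** transvection_path l (mat 1) (snd z)" for z
  have e0: "transvection_path l (mat 1) 0 = (mat 1 :: 'd mat2)" and e1: "transvection_path l (mat 1) 1 = (transvection_prod l :: 'd mat2)"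
    using transvection_path_start[of l "mat 1"] transvection_path_finish[of l "mat 1"] by (simp_all add: pathstart_def pathfinish_def)
  have sp: "path (subpath a b p)" "path_image (subpath a b p) \<subseteq> Sp"
    using p ab path_image_subpath_subset[of a b p] by auto
  have f1: "\<Phi> \<circ> linepath (0, 0) (1, 0) = subpath a b p"
    by (rule ext) (simp add: \<Phi>_def linepath_def e0)
  have f2: "\<Phi> \<circ> linepath (0, 0) (0, 1) = transvection_path l (p a)"
    by (rule ext) (simp add: \<Phi>_def linepath_def mult_transvection_path subpath_def)
  have f3: "\<Phi> \<circ> linepath (0, 1) (1, 1) = (\<lambda>t. subpath a b p t ** transvection_prod l)"
    by (rule ext) (simp add: \<Phi>_def linepath_def e1)
  have f4: "\<Phi> \<circ> linepath (1, 1) (1, 0) = reversepath (transvection_path l (p b))"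
    by (rule ext) (simp add: \<Phi>_def linepath_def mult_transvection_path subpath_def reversepath_def)
  have "homotopic_paths Sp (\<Phi> \<circ> linepath (0, 0) (1, 0))
     (\<Phi> \<circ> (linepath (0, 0) (0, 1) +++ (linepath (0, 1) (1, 1) +++ linepath (1, 1) (1, 0))))"
  proof (rule homotopic_paths_convex_image[where C="{0..1} \<times> {0..1}"])
    show "convex ({0..1::real} \<times> {0..1::real})" by (intro convex_Times) auto
    have c: "continuous_on {0..1} (transvection_path l (mat 1) :: _ \<Rightarrow> 'd mat2)" "continuous_on {0..1} (subpath a b p)"
      using path_transvection_path sp path_def by blast+
    have "continuous_on ({0..1} \<times> {0..1}) (\<lambda>z :: real \<times> real. transvection_path l (mat 1) (snd z) :: 'd mat2)"
      by (rule continuous_on_compose2[OF c(1)]) (auto intro!: continuous_intros)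
    moreover have "continuous_on ({0..1} \<times> {0..1}) (\<lambda>z :: real \<times> real. subpath a b p (fst z))"
      by (rule continuous_on_compose2[OF c(2)]) (auto intro!: continuous_intros)
    ultimately show "continuous_on ({0..1} \<times> {0..1}) \<Phi>"
      unfolding \<Phi>_def by (intro continuous_intros)
    have "transvection_path l (mat 1) t \<in> Sp" "subpath a b p t \<in> Sp" if "t \<in> {0..1}" for t
      using transvection_path_image[OF mat_1_in_Sp, of l] that sp(2) by (auto simp: path_image_def)
    then show "\<Phi> ` ({0..1} \<times> {0..1}) \<subseteq> Sp"
      by (auto simp: \<Phi>_def intro!: Sp_mult)
    show "path_image (linepath (0::real, 0::real) (1, 0)) \<subseteq> {0..1} \<times> {0..1}"
      "path_image (linepath (0::real, 0::real) (0, 1) +++ (linepath (0, 1) (1, 1) +++ linepath (1, 1) (1, 0))) \<subseteq> {0..1} \<times> {0..1}"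
      by (auto simp: path_image_join closed_segment_def)
  qed auto
  then show ?thesis by (simp add: path_compose_join f1 f2 f3 f4)
qed

lemma ex_transverse:
  fixes p :: "real \<Rightarrow> ('d::finite) mat2"
  assumes p: "path p" "path_image p \<subseteq> Sp" and e: "det (p 0 - mat 1) \<noteq> 0" "det (p 1 - mat 1) \<noteq> 0"
  shows "\<exists>q. homotopic_paths Sp p q \<and> transverse_path 1 q"
proof -
  \<comment> \<open>Division points may be singular, and then a piece has no transverse
    representative of its own. So each piece is considered with connectors leading to regular
    matrices; quantifying over all connectors lets one and its reverse be inserted at a common
    division point.\<close>
  define P where "P a b \<longleftrightarrow> (a \<in> {0..1} \<and> b \<in> {0..1} \<longrightarrow> (\<forall>c c'. elementary c \<and> elementary c' \<and>
      pathfinish c = p a \<and> pathstart c' = p b \<and> det (pathstart c - mat 1) \<noteq> 0 \<and> det (pathfinish c' - mat 1) \<noteq> 0 \<longrightarrow>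
      (\<exists>q. homotopic_paths Sp (c +++ (subpath a b p +++ c')) q \<and> transverse_path 1 q)))" for a b
  have pSp: "p t \<in> Sp" if "t \<in> {0..1}" for t using p(2) that by (auto simp: path_image_def)
  have sub: "path (subpath a b p)" "path_image (subpath a b p) \<subseteq> Sp" if "a \<in> {0..1}" "b \<in> {0..1}" for a b
    using p that path_image_subpath_subset[of a b p] by auto
  have join: "transverse_path 1 (q +++ q')"
    if "homotopic_paths Sp r q" "homotopic_paths Sp r' q'" "transverse_path 1 q" "transverse_path 1 q'"
      "pathfinish r = pathstart r'" for q q' r r' :: "real \<Rightarrow> 'd mat2"
    using transverse_join[OF that(3,4)] homotopic_paths_imp_pathfinish[OF that(1)]
      homotopic_paths_imp_pathstart[OF that(2)] that(5) by (simp add: pathstart_def pathfinish_def)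
  have "P 0 1"
  proof (rule Bolzano)
    fix a b d assume P1: "P a b" and P2: "P b d" and le: "a \<le> b" "b \<le> d"
    show "P a d" unfolding P_def
    proof (intro impI allI, elim conjE)
      fix c c'
      assume ab: "a \<in> {0..1}" "d \<in> {0..1}" and c: "elementary c" "elementary c'" "pathfinish c = p a"
        "pathstart c' = p d" "det (pathstart c - mat 1) \<noteq> 0" "det (pathfinish c' - mat 1) \<noteq> 0"
      have b: "b \<in> {0..1}" using ab le by auto
      obtain l where l: "det (p b ** transvection_prod l - mat 1) \<noteq> 0" using ex_transvection_prod_regular[OF pSp[OF b]] by blast
      define z where "z = transvection_path l (p b)"
      have z: "elementary z" "pathstart z = p b" "det (pathfinish z - mat 1) \<noteq> 0"
        using l elementary_transvection_path[OF pSp[OF b]] by (simp_all add: z_def)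
      obtain q where q: "homotopic_paths Sp (c +++ (subpath a b p +++ z)) q" "transverse_path 1 q"
        using P1 ab b c z unfolding P_def by blast
      obtain q' where q': "homotopic_paths Sp (reversepath z +++ (subpath b d p +++ c')) q'" "transverse_path 1 q'"
        using P2 ab b c z elementary_reverse[OF z(1)] unfolding P_def by (metis pathfinish_reversepath pathstart_reversepath)
      note ep = elementary_path[OF c(1)] elementary_path[OF c(2)] elementary_path[OF z(1)]
      have "homotopic_paths Sp (c +++ (subpath a d p +++ c')) (c +++ ((subpath a b p +++ subpath b d p) +++ c'))"
        using homotopic_join_subpaths[OF p ab(1) b ab(2)] c ep
        by (intro homotopic_paths_join_left homotopic_paths_join)
          (auto simp: homotopic_paths_sym_eq)
      also have "homotopic_paths Sp (c +++ ((subpath a b p +++ subpath b d p) +++ c'))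
         ((c +++ (subpath a b p +++ z)) +++ (reversepath z +++ (subpath b d p +++ c')))"
        using ep c z sub ab b by (intro homotopic_paths_cancel) auto
      also have "homotopic_paths Sp ((c +++ (subpath a b p +++ z)) +++ (reversepath z +++ (subpath b d p +++ c'))) (q +++ q')"
        by (intro homotopic_paths_join q q') simp
      finally show "\<exists>q. homotopic_paths Sp (c +++ (subpath a d p +++ c')) q \<and> transverse_path 1 q"
        using join[OF q(1) q'(1) q(2) q'(2)] by auto
    qed
  next
    fix x :: real assume x: "0 \<le> x" "x \<le> 1"
    obtain l where l: "det (p x ** transvection_prod l - mat 1) \<noteq> 0" using ex_transvection_prod_regular pSp x by fastforce
    have "continuous_on {0..1} (\<lambda>t. det (p t ** transvection_prod l - mat 1))"
      using p(1) unfolding path_def by (intro continuous_intros)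
    then obtain d where d: "d > 0"
      "\<And>t. t \<in> {0..1} \<Longrightarrow> dist t x < d \<Longrightarrow> dist (det (p t ** transvection_prod l - mat 1)) (det (p x ** transvection_prod l - mat 1)) < \<bar>det (p x ** transvection_prod l - mat 1)\<bar>"
      using l x unfolding continuous_on_iff by (metis atLeastAtMost_iff zero_less_abs_iff)
    have reg: "det (p t ** transvection_prod l - mat 1) \<noteq> 0" if "t \<in> {0..1}" "\<bar>t - x\<bar> < d" for t
      using d(2)[of t] that by (auto simp: dist_real_def)
    have "P a b" if "a \<le> x" "x \<le> b" "b - a < d" for a b
      unfolding P_def
    proof (intro impI allI, elim conjE)
      fix c c'
      assume ab: "a \<in> {0..1}" "b \<in> {0..1}" and c: "elementary c" "elementary c'" "pathfinish c = p a"
        "pathstart c' = p b" "det (pathstart c - mat 1) \<noteq> 0" "det (pathfinish c' - mat 1) \<noteq> 0"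
      define t1 where "t1 = transvection_path l (p a)"
      define t2 where "t2 = reversepath (transvection_path l (p b))"
      define m where "m = (\<lambda>t. subpath a b p t ** transvection_prod l)"
      have t1: "elementary t1" "pathstart t1 = p a" "pathfinish t1 = p a ** transvection_prod l"
        using elementary_transvection_path[OF pSp[OF ab(1)]] by (simp_all add: t1_def)
      have t2: "elementary t2" "pathstart t2 = p b ** transvection_prod l" "pathfinish t2 = p b"
        using elementary_reverse[OF elementary_transvection_path[OF pSp[OF ab(2)]]] by (simp_all add: t2_def)
      have m: "path m" "path_image m \<subseteq> Sp" "pathstart m = p a ** transvection_prod l" "pathfinish m = p b ** transvection_prod l"
        using sub[OF ab] transvection_prod_in_Sp[of l] unfolding m_def path_def path_image_def
        by (auto intro!: continuous_intros Sp_mult simp: pathstart_def pathfinish_def subpath_def)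
      have "m t = p (a + (b - a) * t) ** transvection_prod l" for t by (simp add: m_def subpath_def add.commute)
      moreover have "a + (b - a) * t \<in> {0..1} \<and> \<bar>a + (b - a) * t - x\<bar> < d" if t: "t \<in> {0..1}" for t
      proof -
        have "0 \<le> (b - a) * t" "(b - a) * t \<le> (b - a) * 1"
          using t \<open>a \<le> x\<close> \<open>x \<le> b\<close> by (auto intro!: mult_left_mono simp del: mult_1_right)
        then show ?thesis using ab \<open>a \<le> x\<close> \<open>x \<le> b\<close> \<open>b - a < d\<close> by auto
      qed
      ultimately have mt: "transverse_path 1 m" using reg by (intro no_crossing_transverse) auto
      have "\<bar>a - x\<bar> < d" "\<bar>b - x\<bar> < d" using \<open>a \<le> x\<close> \<open>x \<le> b\<close> \<open>b - a < d\<close> by auto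
      note rege = reg[OF ab(1) this(1)] reg[OF ab(2) this(2)]
      obtain q1 where q1: "homotopic_paths Sp (c +++ t1) q1" "transverse_path 1 q1"
        using elementary_homotopic_transverse[OF elementary_join[OF c(1) t1(1)]] c t1 rege by auto
      obtain q2 where q2: "homotopic_paths Sp (t2 +++ c') q2" "transverse_path 1 q2"
        using elementary_homotopic_transverse[OF elementary_join[OF t2(1) c(2)]] c t2 rege by auto
      note ep = elementary_path[OF c(1)] elementary_path[OF c(2)] elementary_path[OF t1(1)] elementary_path[OF t2(1)]
      have "homotopic_paths Sp (c +++ (subpath a b p +++ c')) (c +++ ((t1 +++ (m +++ t2)) +++ c'))"
        using subpath_homotopic_translate[OF p ab, of l, folded m_def t1_def t2_def] c ep
        by (intro homotopic_paths_join_left homotopic_paths_join) auto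
      also have "homotopic_paths Sp (c +++ ((t1 +++ (m +++ t2)) +++ c')) ((c +++ t1) +++ (m +++ (t2 +++ c')))"
        using ep m t1 t2 c by (intro homotopic_paths_reassoc) auto
      also have "homotopic_paths Sp ((c +++ t1) +++ (m +++ (t2 +++ c'))) (q1 +++ (m +++ q2))"
        using m t1 t2 by (intro homotopic_paths_join[OF q1(1)] homotopic_paths_join_left q2) auto
      finally have h: "homotopic_paths Sp (c +++ (subpath a b p +++ c')) (q1 +++ (m +++ q2))" .
      have "homotopic_paths Sp m m" using m by simp
      from join[OF this q2(1) mt q2(2)] have mq: "transverse_path 1 (m +++ q2)" using m t2 by simp
      have "homotopic_paths Sp (m +++ (t2 +++ c')) (m +++ q2)"
        using m t2 by (intro homotopic_paths_join_left q2) auto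
      from join[OF q1(1) this q1(2) mq] h
      show "\<exists>q. homotopic_paths Sp (c +++ (subpath a b p +++ c')) q \<and> transverse_path 1 q"
        using m t1 by auto
    qed
    then show "\<exists>d>0. \<forall>a b. a \<le> x \<and> x \<le> b \<and> b - a < d \<longrightarrow> P a b" using d(1) by blast
  qed simp
  \<comment> \<open>With constant connectors the claim for the whole interval concerns
    \<open>p\<close> itself up to homotopy.\<close>
  moreover have "elementary (\<lambda>_. p 0)" "elementary (\<lambda>_. p 1)" by (auto intro!: elementary_const pSp)
  ultimately obtain q where q: "homotopic_paths Sp ((\<lambda>_. p 0) +++ (p +++ (\<lambda>_. p 1))) q" "transverse_path 1 q"
    unfolding P_def using e by (force simp: pathstart_def pathfinish_def)
  have "homotopic_paths Sp ((\<lambda>_. p 0) +++ (p +++ (\<lambda>_. p 1))) ((\<lambda>_. p 0) +++ p)"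
    using p elementary_path[OF elementary_const[OF pSp[of 0]]]
    by (intro homotopic_paths_join_left homotopic_paths_rid_const)
      (auto simp: pathstart_def pathfinish_def joinpaths_def)
  also have "homotopic_paths Sp ((\<lambda>_. p 0) +++ p) p"
    using p by (intro homotopic_paths_lid_const) (auto simp: pathstart_def)
  finally have "homotopic_paths Sp p q"
    using q(1) homotopic_paths_trans homotopic_paths_sym by blast
  with q(2) show ?thesis by blast
qed

lemma intersection_number_crossing_index:
  fixes p :: "real \<Rightarrow> ('d::finite) mat2"
  assumes "path p" "path_image p \<subseteq> Sp" "det (p 0 - mat 1) \<noteq> 0" "det (p 1 - mat 1) \<noteq> 0"
  shows "real_of_int (intersection_number 1 p) = crossing_index p"
  using ex_transverse[OF assms] intersection_number_eq_crossing_index[OF assms(3,4)] by blast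

section \<open>The Maslov-type index of a fundamental solution\<close>

lemma bounded_linear_transpose: "bounded_linear (transpose :: real ^ 'n ^ 'm \<Rightarrow> _)"
  by (simp add: linear_conv_bounded_linear[symmetric] linearI transpose_add transpose_scaleR)

text \<open>Symmetry of \<open>B\<close> makes the derivative vanish. Two solutions are allowed
  because the identity serves twice: for equal ones it gives symplecticity, for arbitrary ones
  uniqueness, without a Gronwall estimate.\<close>

lemma fundamental_solutions_form:
  fixes B \<gamma> \<gamma>' :: "real \<Rightarrow> ('d::finite) mat2"
  assumes B: "\<And>t. transpose (B t) = B t"
    and f: "is_fundamental_solution B \<gamma>" and f': "is_fundamental_solution B \<gamma>'"
  shows "transpose (\<gamma> t) ** J_mat ** \<gamma>' t = J_mat"
proof -
  have JJ: "J_mat ** (J_mat ** X) = - X" for X :: "'d mat2"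
    by (simp add: matrix_mul_assoc J_mat_mult_J_mat matrix_minus_left)
  note mult = bounded_bilinear.has_vector_derivative[OF bounded_bilinear_matrix_mult]
  have "((\<lambda>t. transpose (\<gamma> t) ** (J_mat ** \<gamma>' t)) has_vector_derivative 0) (at t)" for t
  proof -
    have "((\<lambda>t. transpose (\<gamma> t)) has_vector_derivative transpose (J_mat ** B t ** \<gamma> t)) (at t)"
      using f by (intro bounded_linear.has_vector_derivative[OF bounded_linear_transpose])
        (simp add: is_fundamental_solution_def)
    moreover have "((\<lambda>t. J_mat ** \<gamma>' t) has_vector_derivative J_mat ** (J_mat ** B t ** \<gamma>' t)) (at t)"
      using f' mult[OF has_vector_derivative_const, of \<gamma>' _ t UNIV J_mat]
      by (simp add: is_fundamental_solution_def)
    ultimately have "((\<lambda>t. transpose (\<gamma> t) ** (J_mat ** \<gamma>' t)) has_vector_derivative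
        transpose (\<gamma> t) ** (J_mat ** (J_mat ** B t ** \<gamma>' t)) +
        transpose (J_mat ** B t ** \<gamma> t) ** (J_mat ** \<gamma>' t)) (at t)" by (rule mult)
    moreover have "transpose (\<gamma> t) ** (J_mat ** (J_mat ** B t ** \<gamma>' t)) = - (transpose (\<gamma> t) ** B t ** \<gamma>' t)"
    proof -
      have "J_mat ** (J_mat ** B t ** \<gamma>' t) = - (B t ** \<gamma>' t)"
        by (simp add: matrix_mul_assoc J_mat_mult_J_mat matrix_minus_left)
      then show ?thesis by (simp add: matrix_minus_right matrix_mul_assoc)
    qed
    moreover have "transpose (J_mat ** B t ** \<gamma> t) ** (J_mat ** \<gamma>' t) = transpose (\<gamma> t) ** B t ** \<gamma>' t"
    proof -
      have "transpose (J_mat ** B t ** \<gamma> t) = - (transpose (\<gamma> t) ** B t ** J_mat)"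
        by (simp add: matrix_transpose_mul B transpose_J_mat matrix_minus_right matrix_mul_assoc)
      moreover have "transpose (\<gamma> t) ** B t ** J_mat ** (J_mat ** \<gamma>' t) = - (transpose (\<gamma> t) ** B t ** \<gamma>' t)"
        by (simp add: matrix_mul_assoc[symmetric] JJ matrix_minus_right)
      ultimately show ?thesis by (simp add: matrix_minus_left)
    qed
    ultimately show ?thesis by simp
  qed
  then obtain c where "\<And>t. transpose (\<gamma> t) ** (J_mat ** \<gamma>' t) = c"
    using has_vector_derivative_zero_constant[of UNIV "\<lambda>t. transpose (\<gamma> t) ** (J_mat ** \<gamma>' t)"] by auto
  from this[of t] this[of 0] show ?thesis
    using f f' by (simp add: is_fundamental_solution_def transpose_mat matrix_mul_assoc)
qed

lemma fundamental_solution_Sp: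
  assumes "\<And>t. transpose (B t) = B t" "is_fundamental_solution B \<gamma>"
  shows "\<gamma> t \<in> Sp"
  using fundamental_solutions_form[OF assms(1,2,2)] by (simp add: Sp_iff)

lemma fundamental_solution_eq:
  assumes B: "\<And>t. transpose (B t) = B t" and f: "is_fundamental_solution B \<gamma>"
  shows "fundamental_solution B = \<gamma>"
  unfolding fundamental_solution_def
proof (rule the_equality)
  show "is_fundamental_solution B \<gamma>" by (rule f)
  fix \<gamma>' assume f': "is_fundamental_solution B \<gamma>'"
  show "\<gamma>' = \<gamma>"
  proof
    fix t
    have S: "\<gamma> t \<in> Sp" by (rule fundamental_solution_Sp[OF B f])
    let ?A = "transpose (\<gamma> t) ** J_mat"
    have "?A ** \<gamma>' t = ?A ** \<gamma> t"
      using fundamental_solutions_form[OF B f f'] S by (simp add: Sp_iff)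
    moreover have "(\<gamma> t ** (- J_mat)) ** ?A ** X = - (\<gamma> t ** J_mat ** transpose (\<gamma> t) ** J_mat) ** X" for X
      by (simp add: matrix_minus_left matrix_minus_right matrix_mul_assoc)
    then have "(\<gamma> t ** (- J_mat)) ** ?A ** X = X" for X
      by (simp add: Sp_transpose[OF S] J_mat_mult_J_mat)
    ultimately show "\<gamma>' t = \<gamma> t" by (metis matrix_mul_assoc)
  qed
qed

section \<open>The index as a change of argument\<close>

lemma matrix_inv_mat_1: "matrix_inv (mat 1 :: real ^ 'n ^ 'n) = mat 1"
  unfolding matrix_inv_def by (rule some_equality) auto

text \<open>For all small positive rotations the end points are regular, so the crossing index does
  not depend on the rotation. This evaluates both definite descriptions, that of the intersection
  number and that of its eventual value.\<close>

lemma iota_eq_crossing_index: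
  fixes \<gamma> :: "real \<Rightarrow> ('d::finite) mat2"
  assumes c: "continuous_on UNIV \<gamma>" and Sp: "\<And>t. \<gamma> t \<in> Sp" and g0: "\<gamma> 0 = mat 1"
  obtains e where "det (mexp (- e *\<^sub>R J_mat) ** \<gamma> 0 - mat 1) \<noteq> 0" "det (mexp (- e *\<^sub>R J_mat) ** \<gamma> T - mat 1) \<noteq> 0"
    "real_of_int (iota 1 (mat 1) \<gamma> 0 T) = crossing_index (\<lambda>t. mexp (- e *\<^sub>R J_mat) ** \<gamma> (T * t))"
proof -
  have "\<forall>\<^sub>F e in at_right 0. det (mexp (- e *\<^sub>R J_mat) ** \<gamma> 0 - mat 1) \<noteq> 0 \<and>
     det (mexp (- e *\<^sub>R J_mat) ** \<gamma> T - mat 1) \<noteq> 0"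
    by (intro eventually_conj eventually_rot_notin_Sp0 Sp)
  then obtain e0 where e0: "e0 > 0" "\<And>e. 0 < e \<Longrightarrow> e < e0 \<Longrightarrow> det (mexp (- e *\<^sub>R J_mat) ** \<gamma> 0 - mat 1) \<noteq> 0 \<and>
     det (mexp (- e *\<^sub>R J_mat) ** \<gamma> T - mat 1) \<noteq> 0"
    by (auto simp: eventually_at_right_field)
  define H where "H z = mexp (- fst z *\<^sub>R J_mat) ** \<gamma> (T * snd z)" for z
  have cH: "continuous_on S H" for S
    unfolding H_def mexp_J
    by (intro continuous_intros continuous_on_compose2[OF c]) auto
  have HSp: "H z \<in> Sp" for z unfolding H_def by (intro Sp_mult mexp_J_in_Sp Sp)
  have const: "crossing_index (\<lambda>t. H (e, t)) = crossing_index (\<lambda>t. H (e0/2, t))" if "0 < e" "e < e0" for e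
  proof (rule crossing_index_homotopy[of "{0<..<e0}" e "e0/2" H])
    show "H ` ({0<..<e0} \<times> {0..1}) \<subseteq> Sp" using HSp by blast
    show "det (H (s, 0) - mat 1) \<noteq> 0" "det (H (s, 1) - mat 1) \<noteq> 0" if "s \<in> {0<..<e0}" for s
      using e0(2)[of s] that by (auto simp: H_def)
  qed (use that e0(1) cH in auto)
  have int: "real_of_int (intersection_number 1 (\<lambda>t. H (e, t))) = crossing_index (\<lambda>t. H (e, t))" if "0 < e" "e < e0" for e
  proof (rule intersection_number_crossing_index)
    show "path (\<lambda>t. H (e, t))" unfolding path_def
      by (intro continuous_on_compose2[OF cH[of UNIV]] continuous_intros) auto
    show "path_image (\<lambda>t. H (e, t)) \<subseteq> Sp" using HSp by (auto simp: path_image_def)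
  qed (use e0(2)[OF that] in \<open>auto simp: H_def\<close>)
  define n where "n = intersection_number 1 (\<lambda>t. H (e0/2, t))"
  have n: "intersection_number 1 (\<lambda>t. H (e, t)) = n" if "0 < e" "e < e0" for e
  proof -
    have "0 < e0 / 2" "e0 / 2 < e0" using e0(1) by auto
    from int[OF that] int[OF this] const[OF that]
    have "real_of_int (intersection_number 1 (\<lambda>t. H (e, t))) = real_of_int n" unfolding n_def by simp
    then show ?thesis by simp
  qed
  have sub: "subpath 0 T (\<lambda>t. mexp (- e *\<^sub>R J_mat) ** \<gamma> t ** matrix_inv (mat 1)) = (\<lambda>t. H (e, t))" for e
    by (rule ext) (simp add: subpath_def H_def matrix_inv_mat_1)
  have ev: "\<forall>\<^sub>F e in at_right 0. intersection_number 1 (\<lambda>t. H (e, t)) = n"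
    using e0(1) n by (auto simp: eventually_at_right_field)
  have "iota 1 (mat 1) \<gamma> 0 T = n"
    unfolding iota_def sub
  proof (rule the_equality)
    show "\<forall>\<^sub>F e in at_right 0. intersection_number 1 (\<lambda>t. H (e, t)) = n" by (rule ev)
    fix n' assume "\<forall>\<^sub>F e in at_right 0. intersection_number 1 (\<lambda>t. H (e, t)) = n'"
    with ev have "\<forall>\<^sub>F e in at_right (0::real). n' = n" by eventually_elim simp
    then show "n' = n" by simp
  qed
  then have "real_of_int (iota 1 (mat 1) \<gamma> 0 T) = crossing_index (\<lambda>t. H (e0/2, t))"
    using int[of "e0/2"] e0(1) by (simp add: n_def)
  then show ?thesis
    using that[of "e0/2"] e0(2)[of "e0/2"] e0(1) by (simp add: H_def)
qed

text \<open>A root \<open>z\<close> contributes the factor \<open>- z (1 - r / z)\<close>, where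
  \<open>|z| \<ge> 1\<close> and \<open>z \<noteq> 1\<close>. For \<open>r\<close> in the unit
  interval \<open>1 - r / z\<close> stays in the open right half-plane, so its principal logarithm
  is continuous and turns by at most pi.\<close>

lemma poly_log_bound:
  fixes p :: "complex poly"
  assumes "\<And>z. norm z < 1 \<Longrightarrow> poly p z \<noteq> 0" "poly p 1 \<noteq> 0"
  shows "\<exists>l. continuous_on {0..1} l \<and> (\<forall>r\<in>{0..1}. poly p (of_real r) = exp (l r)) \<and>
    \<bar>Im (l 1) - Im (l 0)\<bar> \<le> degree p * pi"
  using assms
proof (induction "degree p" arbitrary: p)
  case 0
  then obtain a where p: "p = [:a:]" by (metis degree_0_id)
  have "a \<noteq> 0" using 0 p by auto
  then have "continuous_on {0..1::real} (\<lambda>_. Ln a)" "\<forall>r\<in>{0..1::real}. poly p (of_real r) = exp (Ln a)"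
    "\<bar>Im (Ln a) - Im (Ln a)\<bar> \<le> degree p * pi" by (auto simp: p)
  then show ?case by blast
next
  case (Suc n)
  then have "\<not> constant (poly p)" by (simp add: constant_degree)
  then obtain z where z: "poly p z = 0" using fundamental_theorem_of_algebra by blast
  have z1: "norm z \<ge> 1" "z \<noteq> 1" using Suc.prems z by force+
  obtain q where q: "p = [:- z, 1:] * q" using z poly_eq_0_iff_dvd by blast
  have "q \<noteq> 0" using Suc.prems(2) q by auto
  then have "degree p = 1 + degree q" unfolding q by (subst degree_mult_eq) auto
  then have "degree q = n" using Suc(2) by simp
  then obtain l where l: "continuous_on {0..1} l" "\<And>r. r\<in>{0..1} \<Longrightarrow> poly q (of_real r) = exp (l r)"
    "\<bar>Im (l 1) - Im (l 0)\<bar> \<le> degree q * pi"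
    using Suc(1)[of q] Suc.prems unfolding q by (auto simp: q)
  have pos: "Re (1 - of_real r / z) > 0" if "r \<in> {0..1}" for r :: real
  proof -
    have "norm (of_real r / z) \<le> 1" using that z1 by (simp add: norm_divide divide_le_eq)
    then have "Re (of_real r / z) \<le> 1" using complex_Re_le_cmod order_trans by blast
    moreover have "Re (of_real r / z) \<noteq> 1"
    proof
      assume R: "Re (of_real r / z) = 1"
      then have "(Im (of_real r / z))\<^sup>2 \<le> 0"
        using \<open>norm (of_real r / z) \<le> 1\<close> cmod_power2[of "of_real r / z"]
        by (metis add_le_same_cancel1 norm_ge_zero one_power2 power_mono)
      with R have "of_real r / z = 1" by (simp add: complex_eq_iff)
      then have "of_real r = z" using z1 by (auto simp: divide_eq_eq split: if_splits)
      with z1 that have "r = 1" by auto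
      with \<open>of_real r = z\<close> z1 show False by simp
    qed
    ultimately show ?thesis by simp
  qed
  let ?l = "\<lambda>r. Ln (- z) + Ln (1 - of_real r / z) + l r"
  have "continuous_on {0..1} ?l"
  proof -
    have "1 - of_real r / z \<notin> \<real>\<^sub>\<le>\<^sub>0" if "r \<in> {0..1}" for r
      using pos[OF that] by (auto simp: complex_nonpos_Reals_iff)
    then show ?thesis using z1 by (intro continuous_intros l) auto
  qed
  moreover have "poly p (of_real r) = exp (?l r)" if "r \<in> {0..1}" for r
  proof -
    have "1 - of_real r / z \<noteq> 0" "z \<noteq> 0" using pos[OF that] z1 by auto
    then show ?thesis using l(2)[OF that] by (simp add: q exp_add field_simps)
  qed
  moreover have "\<bar>Im (?l 1) - Im (?l 0)\<bar> \<le> degree p * pi"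
  proof -
    have "1 - complex_of_real 1 / z \<noteq> 0" using pos[of 1] by auto
    from mpi_less_Im_Ln[OF this] Im_Ln_le_pi[OF this]
    have "\<bar>Im (Ln (1 - of_real 1 / z))\<bar> \<le> pi" by (simp add: abs_le_iff)
    moreover have "real (degree p) * pi = pi + degree q * pi"
      using Suc(2) \<open>degree q = n\<close> by (simp add: algebra_simps flip: Suc(2))
    ultimately show ?thesis using l(3) by simp
  qed
  ultimately show ?case by blast
qed

lemma radial_det_log_bound:
  fixes M :: "('d::finite) mat2"
  assumes M: "M \<in> Sp" "det (M - mat 1) \<noteq> 0"
    and l: "continuous_on {0..1} l" "\<And>r. r \<in> {0..1} \<Longrightarrow> radial_det (of_real r) M = exp (l r)"
  shows "\<bar>Im (l 1) - Im (l 0)\<bar> \<le> CARD('d + 'd) * pi"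
proof -
  obtain p where p: "degree p \<le> CARD('d + 'd)" "\<And>r. radial_det r M = poly p r" using radial_det_polynomial[of M] by blast
  have "\<And>z. norm z < 1 \<Longrightarrow> poly p z \<noteq> 0" "poly p 1 \<noteq> 0"
    using radial_det_nonzero[OF M(1)] radial_det_nonzero_le1[OF M(1), of 1] M(2) p(2) by auto
  then obtain l' where l': "continuous_on {0..1} l'" "\<And>r. r\<in>{0..1} \<Longrightarrow> poly p (of_real r) = exp (l' r)"
    "\<bar>Im (l' 1) - Im (l' 0)\<bar> \<le> degree p * pi" using poly_log_bound by blast
  have "(\<lambda>r. l r - l' r) constant_on {0..1}"
  proof (rule exp_const_imp_constant_on)
    have "exp (l r - l' r) = 1" if "r \<in> {0..1}" for r
      using l(2)[OF that] l'(2)[OF that] p(2) by (simp add: exp_diff)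
    then show "\<And>x y. x \<in> {0..1} \<Longrightarrow> y \<in> {0..1} \<Longrightarrow> exp (l x - l' x) = exp (l y - l' y)" by simp
  qed (auto intro!: continuous_intros l l')
  then obtain c where "\<And>r. r \<in> {0..1} \<Longrightarrow> l r - l' r = c" unfolding constant_on_def by blast
  from this[of 0] this[of 1] have "l 0 = l' 0 + c" "l 1 = l' 1 + c" by (auto simp: algebra_simps)
  then have "\<bar>Im (l 1) - Im (l 0)\<bar> \<le> degree p * pi" using l'(3) by simp
  also have "\<dots> \<le> CARD('d + 'd) * pi"
    using p(1) by (intro mult_right_mono of_nat_mono) auto
  finally show ?thesis .
qed

text \<open>The crossing index is read off at the corners with \<open>r = 1\<close>. Descending to
  \<open>r = 0\<close> along the two sides turns the argument by at most
  \<open>CARD('d + 'd)\<close> times pi each, which gives the constant; at \<open>r = 0\<close> the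
  rotation is a constant factor and only the variation of \<open>\<psi>\<close> remains.\<close>

lemma iota_log_bound:
  fixes \<gamma> :: "real \<Rightarrow> ('d::finite) mat2"
  assumes c: "continuous_on UNIV \<gamma>" and Sp: "\<And>t. \<gamma> t \<in> Sp" and g0: "\<gamma> 0 = mat 1"
    and \<psi>: "continuous_on UNIV \<psi>" "\<And>t. radial_det 0 (\<gamma> t) = exp (\<psi> t)"
  shows "\<bar>real_of_int (iota 1 (mat 1) \<gamma> 0 T) + (Im (\<psi> T) - Im (\<psi> 0)) / pi\<bar> \<le> 2 * CARD('d + 'd)"
proof -
  obtain e where e: "det (mexp (- e *\<^sub>R J_mat) ** \<gamma> 0 - mat 1) \<noteq> 0" "det (mexp (- e *\<^sub>R J_mat) ** \<gamma> T - mat 1) \<noteq> 0"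
    and iota: "real_of_int (iota 1 (mat 1) \<gamma> 0 T) = crossing_index (\<lambda>t. mexp (- e *\<^sub>R J_mat) ** \<gamma> (T * t))"
    using iota_eq_crossing_index[OF c Sp g0] by blast
  define q where "q t = mexp (- e *\<^sub>R J_mat) ** \<gamma> (T * t)" for t
  have qSp: "q t \<in> Sp" for t unfolding q_def by (intro Sp_mult mexp_J_in_Sp Sp)
  have "path q" unfolding path_def q_def
    by (intro continuous_intros continuous_on_compose2[OF c]) auto
  then obtain L where L: "is_radial_log {0, 1} q L"
    by (rule ex_log[of q "{0, 1}"]) (use qSp e in \<open>auto simp: q_def path_image_def\<close>)
  have b: "\<bar>Im (L (1, t)) - Im (L (0, t))\<bar> \<le> CARD('d + 'd) * pi" if t: "t \<in> {0, 1}" for t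
  proof (rule radial_det_log_bound[OF qSp])
    have sub: "(r, t) \<in> slit_square {0, 1}" if "r \<in> {0..1}" for r using t that by (auto simp: slit_square_def)
    show "det (q t - mat 1) \<noteq> 0" using t e by (auto simp: q_def)
    show "continuous_on {0..1} (\<lambda>r. L (r, t))"
      by (rule continuous_on_compose2[of "slit_square {0, 1}" L])
        (use L sub in \<open>auto simp: is_radial_log_def intro!: continuous_intros\<close>)
    show "radial_det (complex_of_real r) (q t) = exp (L (r, t))" if "r \<in> {0..1}" for r
      using is_radial_logD[OF L sub[OF that]] .
  qed
  have "(\<lambda>t. L (0, t) - \<psi> (T * t)) constant_on {0..1}"
  proof (rule exp_const_imp_constant_on)
    have sub: "(0, t) \<in> slit_square {0, 1}" if "t \<in> {0..1}" for t using that by (auto simp: slit_square_def)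
    have "continuous_on {0..1} (\<lambda>t. L (0, t))"
      by (rule continuous_on_compose2[of "slit_square {0, 1}" L])
        (use L sub in \<open>auto simp: is_radial_log_def intro!: continuous_intros\<close>)
    then show "continuous_on {0..1} (\<lambda>t. L (0, t) - \<psi> (T * t))"
      by (intro continuous_intros continuous_on_compose2[OF \<psi>(1)]) auto
    have "exp (L (0, t) - \<psi> (T * t)) = det (Pplus + (1 / cis (- e)) *m Pminus :: complex ^ ('d + 'd) ^ ('d + 'd))"
      if "t \<in> {0..1}" for t
      using is_radial_logD[OF L sub[OF that]] \<psi>(2)[of "T * t"] radial_det_0_rot[of "- e" "\<gamma> (T * t)"]
      by (simp add: exp_diff q_def)
    then show "\<And>x y. x \<in> {0..1} \<Longrightarrow> y \<in> {0..1} \<Longrightarrow> exp (L (0, x) - \<psi> (T * x)) = exp (L (0, y) - \<psi> (T * y))"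
      by simp
  qed simp
  then obtain k where "\<And>t. t \<in> {0..1} \<Longrightarrow> L (0, t) - \<psi> (T * t) = k" unfolding constant_on_def by blast
  from this[of 0] this[of 1] have "L (0, 0) = \<psi> 0 + k" "L (0, 1) = \<psi> T + k" by (auto simp: algebra_simps)
  then have "\<bar>(Im (L (1, 0)) - Im (L (1, 1))) + (Im (\<psi> T) - Im (\<psi> 0))\<bar> \<le> 2 * CARD('d + 'd) * pi"
    using b[of 0] b[of 1] by (simp del: card_sum)
  then show ?thesis
    unfolding iota q_def[symmetric] crossing_index_eq[OF L] add_divide_distrib[symmetric] abs_divide
    by (simp add: divide_le_eq del: card_sum)
qed

section \<open>Lipschitz continuity of the argument\<close>

lemma norm_matrix_le:
  fixes Q :: "'a::real_normed_field ^ 'n ^ 'm"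
  assumes "\<And>i j. norm (Q $ i $ j) \<le> c"
  shows "norm Q \<le> real CARD('m) * (real CARD('n) * c)"
proof -
  have "norm (Q $ i) \<le> real CARD('n) * c" for i
  proof -
    have "norm (Q $ i) \<le> (\<Sum>j\<in>UNIV. norm (Q $ i $ j))"
      unfolding norm_vec_def by (rule L2_set_le_sum) simp
    also have "\<dots> \<le> (\<Sum>j\<in>(UNIV :: 'n set). c)" by (intro sum_mono assms)
    finally show ?thesis by simp
  qed
  moreover have "norm Q \<le> (\<Sum>i\<in>UNIV. norm (Q $ i))"
    unfolding norm_vec_def[of Q] by (rule L2_set_le_sum) simp
  ultimately have "norm Q \<le> (\<Sum>i\<in>(UNIV :: 'm set). real CARD('n) * c)"
    using sum_mono order_trans by meson
  then show ?thesis by simp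
qed

lemma radial_matrix_0: "radial_matrix 0 M = Pplus + Pminus ** cmat M"
  by (simp add: radial_matrix_def cscale_zero)

text \<open>For \<open>x = A v\<close> and \<open>y = M x\<close> one has
  \<open>Pplus x = Pplus v\<close> and \<open>Pminus y = Pminus v\<close>. Invariance of the form
  then bounds the one unknown component \<open>Pplus y\<close>, because \<open>Pminus x\<close>
  enters its squared norm with a negative sign.\<close>

lemma radial_matrix_0_inverse_bound:
  "\<exists>c\<ge>0. \<forall>(M :: ('d::finite) mat2) A. M \<in> Sp \<longrightarrow> radial_matrix 0 M ** A = mat 1 \<longrightarrow> norm (cmat M ** A) \<le> c"
proof -
  obtain a where a: "a > 0" "\<And>v. norm ((Pplus :: complex ^ ('d + 'd) ^ ('d + 'd)) *v v) \<le> norm v * a"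
    using bounded_linear.pos_bounded[OF matrix_vector_mul_bounded_linear[of "Pplus :: complex ^ ('d + 'd) ^ ('d + 'd)"]] by blast
  obtain b where b: "b > 0" "\<And>v. norm ((Pminus :: complex ^ ('d + 'd) ^ ('d + 'd)) *v v) \<le> norm v * b"
    using bounded_linear.pos_bounded[OF matrix_vector_mul_bounded_linear[of "Pminus :: complex ^ ('d + 'd) ^ ('d + 'd)"]] by blast
  let ?n = "real CARD('d + 'd)"
  have "norm (cmat M ** A) \<le> ?n * (?n * (a + 2 * b))" if M: "M \<in> Sp" and A: "radial_matrix 0 M ** A = mat 1"
    for M :: "'d mat2" and A
  proof (rule norm_matrix_le)
    fix i j :: "'d + 'd"
    define v :: "complex ^ ('d + 'd)" where "v = axis j 1"
    define x where "x = A *v v"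
    define y where "y = cmat M *v x"
    have v: "Pplus *v x + Pminus *v y = v"
    proof -
      have "(radial_matrix 0 M ** A) *v v = v" by (simp add: A)
      then show ?thesis
        by (simp add: radial_matrix_0 x_def y_def matrix_vector_mul_assoc[symmetric] matrix_vector_mult_add_rdistrib)
    qed
    have px: "Pplus *v v = Pplus *v x" "Pminus *v v = Pminus *v y"
      unfolding v[symmetric]
      by (simp_all add: matrix_vector_right_distrib matrix_vector_mul_assoc Pplus_idem Pplus_Pminus
          Pminus_idem Pminus_Pplus)
    have nv: "norm v = 1" by (simp add: v_def)
    have "(norm (Pplus *v y))\<^sup>2 = (norm (Pplus *v v))\<^sup>2 - (norm (Pminus *v x))\<^sup>2 + (norm (Pminus *v v))\<^sup>2"
      using P_form_Sp[OF M, of x] by (simp add: y_def[symmetric] px)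
    also have "\<dots> \<le> (norm (Pplus *v v))\<^sup>2 + (norm (Pminus *v v))\<^sup>2" by simp
    also have "\<dots> \<le> (norm (Pplus *v v) + norm (Pminus *v v))\<^sup>2"
      by (simp add: power2_eq_square algebra_simps)
    finally have "norm (Pplus *v y) \<le> norm (Pplus *v v) + norm (Pminus *v v)"
      by (rule power2_le_imp_le) simp
    moreover have "y = Pplus *v y + Pminus *v y"
      by (simp add: matrix_vector_mult_add_rdistrib[symmetric] Pplus_add_Pminus)
    then have "norm y \<le> norm (Pplus *v y) + norm (Pminus *v y)"
      by (metis norm_triangle_ineq)
    ultimately have "norm y \<le> a + 2 * b"
      using a(2)[of v] b(2)[of v] nv by (simp add: px)
    moreover have "(cmat M ** A) $ i $ j = y $ i"
      unfolding y_def x_def v_def matrix_vector_mul_assoc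
      by (simp add: matrix_vector_mult_def axis_def if_distrib[of "\<lambda>x. _ * x"] cong: if_cong)
    ultimately show "norm ((cmat M ** A) $ i $ j) \<le> a + 2 * b"
      using Finite_Cartesian_Product.norm_nth_le[of y i] by simp
  qed
  then show ?thesis using a(1) b(1) by (intro exI[of _ "?n * (?n * (a + 2 * b))"]) simp
qed

text \<open>By continuity \<open>\<psi> s\<close> differs from \<open>\<psi> t\<close> by less than
  pi near \<open>t\<close>, so there it equals \<open>Ln (f s / f t) + \<psi> t\<close>, and
  \<open>Ln\<close> is differentiable at 1.\<close>

lemma log_derivative:
  fixes \<psi> :: "real \<Rightarrow> complex"
  assumes "isCont \<psi> t" and "\<And>s. f s = exp (\<psi> s)" and f: "(f has_vector_derivative f t * c) (at t)"
  shows "(\<psi> has_vector_derivative c) (at t)"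
proof -
  have "((\<lambda>s. f s / f t) has_vector_derivative f t * c / f t) (at t)"
    by (intro has_vector_derivative_divide f)
  then have "((\<lambda>s. f s / f t) has_vector_derivative c) (at t)" using assms(2) by simp
  moreover have "(Ln has_field_derivative 1) (at (f t / f t))"
    using has_field_derivative_Ln[of "1 :: complex"] assms(2) by simp
  ultimately have "((\<lambda>s. Ln (f s / f t)) has_vector_derivative c) (at t)"
    using field_vector_diff_chain_at[of "\<lambda>s. f s / f t" c t Ln 1] by (simp add: o_def)
  then have "((\<lambda>s. Ln (f s / f t) + \<psi> t) has_vector_derivative c) (at t)"
    by (auto intro!: derivative_eq_intros)
  moreover have "\<forall>\<^sub>F s in at t. dist (\<psi> s) (\<psi> t) < pi"
    using assms(1) unfolding isCont_def by (rule tendstoD) simp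
  then have "\<forall>\<^sub>F s in at t. Ln (f s / f t) + \<psi> t = \<psi> s"
  proof eventually_elim
    case (elim s)
    have "\<bar>Im (\<psi> s - \<psi> t)\<bar> < pi"
      using abs_Im_le_cmod[of "\<psi> s - \<psi> t"] elim by (simp add: dist_norm)
    then have "Ln (exp (\<psi> s - \<psi> t)) = \<psi> s - \<psi> t" by (intro Ln_exp) auto
    then show ?case by (simp add: assms(2) exp_diff)
  qed
  ultimately show ?thesis unfolding has_vector_derivative_def
    by (rule has_derivative_transform_eventually) (simp_all add: assms(2))
qed

lemma log_lipschitz:
  fixes B \<gamma> :: "real \<Rightarrow> ('d::finite) mat2"
  assumes B: "B \<in> E_bound K" and f: "is_fundamental_solution B \<gamma>"
    and \<psi>: "continuous_on UNIV \<psi>" "\<And>t. radial_det 0 (\<gamma> t) = exp (\<psi> t)"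
  shows "\<exists>C. \<forall>s t. norm (\<psi> s - \<psi> t) \<le> C * \<bar>s - t\<bar>"
proof -
  have sym: "transpose (B t) = B t" and BK: "onorm ((*v) (B t)) \<le> K" for t
    using B by (auto simp: E_bound_def)
  have Sp: "\<gamma> t \<in> Sp" for t by (rule fundamental_solution_Sp[OF sym f])
  obtain D where D: "(det has_derivative D) (at (mat 1 :: complex ^ ('d + 'd) ^ ('d + 'd)))"
    using det_has_derivative by blast
  obtain k1 where k1: "k1 > 0" "\<And>Y. norm (D Y) \<le> norm Y * k1"
    using bounded_linear.pos_bounded[OF has_derivative_bounded_linear[OF D]] by blast
  obtain c where c: "c \<ge> 0" "\<And>(M :: 'd mat2) A. M \<in> Sp \<Longrightarrow> radial_matrix 0 M ** A = mat 1 \<Longrightarrow> norm (cmat M ** A) \<le> c"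
    using radial_matrix_0_inverse_bound by blast
  obtain k2 where k2: "k2 > 0" "\<And>(X :: complex ^ ('d + 'd) ^ ('d + 'd)) (Y :: complex ^ ('d + 'd) ^ ('d + 'd)).
      norm (X ** Y) \<le> norm X * norm Y * k2"
    using bounded_bilinear.pos_bounded[OF bounded_bilinear_matrix_mult] by blast
  have "bounded_linear (\<lambda>X :: 'd mat2. (J_mat :: 'd mat2) ** X)"
    "bounded_linear (\<lambda>X :: complex ^ ('d + 'd) ^ ('d + 'd). (Pminus :: complex ^ ('d + 'd) ^ ('d + 'd)) ** X)"
    by (rule bounded_bilinear.bounded_linear_right[OF bounded_bilinear_matrix_mult])+
  from bounded_linear_compose[OF this(2) bounded_linear_compose[OF bounded_linear_cmat this(1)]]
  have lin: "bounded_linear (\<lambda>X :: 'd mat2. Pminus ** cmat (J_mat ** X))" .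
  have lin2: "bounded_linear (\<lambda>X :: 'd mat2. Pminus ** cmat X ** A)" for A :: "complex ^ ('d + 'd) ^ ('d + 'd)"
    using bounded_linear_compose[OF bounded_bilinear.bounded_linear_left[OF bounded_bilinear_matrix_mult, of A]
        bounded_linear_compose[OF bounded_bilinear.bounded_linear_right[OF bounded_bilinear_matrix_mult, of Pminus]
          bounded_linear_cmat]] .
  obtain k3 where k3: "k3 > 0" "\<And>X :: 'd mat2. norm (Pminus ** cmat (J_mat ** X)) \<le> norm X * k3"
    using bounded_linear.pos_bounded[OF lin] by blast
  define b where "b = real CARD('d + 'd) * (real CARD('d + 'd) * K)"
  have Bb: "norm (B t) \<le> b" for t
    unfolding b_def using order_trans[OF matrix_component_le_onorm BK] by (intro norm_matrix_le) simp
  then have b0: "b \<ge> 0" using norm_ge_zero order_trans by blast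
  \<comment> \<open>\<open>b\<close> bounds \<open>B\<close>, \<open>k3\<close> the multiplication
    by \<open>J\<close> and \<open>Pminus\<close>, \<open>c\<close> the product of
    \<open>\<gamma>\<close> with the inverse \<open>A\<close>, \<open>k2\<close> the matrix product
    and \<open>k1\<close> the derivative of \<open>det\<close> at the identity.\<close>
  define C where "C = b * k3 * c * k2 * k1"
  have "\<exists>d. norm d \<le> C \<and> (\<psi> has_vector_derivative d) (at t)" for t
  proof -
    have "det (radial_matrix 0 (\<gamma> t)) \<noteq> 0" using radial_det_nonzero[OF Sp, of 0] by (simp add: radial_det_def)
    then obtain A where A: "radial_matrix 0 (\<gamma> t) ** A = mat 1"
      unfolding invertible_det_nz[symmetric] invertible_def by blast
    define Y where "Y = Pminus ** cmat (J_mat ** B t ** \<gamma> t) ** A"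
    have Y: "Y = (Pminus ** cmat (J_mat ** B t)) ** (cmat (\<gamma> t) ** A)"
      by (simp add: Y_def cmat_mult matrix_mul_assoc)
    have "norm Y \<le> norm (Pminus ** cmat (J_mat ** B t)) * norm (cmat (\<gamma> t) ** A) * k2"
      unfolding Y by (rule k2)
    also have "\<dots> \<le> (b * k3) * c * k2"
    proof (intro mult_right_mono mult_mono)
      show "norm (Pminus ** cmat (J_mat ** B t)) \<le> b * k3"
        by (rule order_trans[OF k3(2) mult_right_mono[OF Bb less_imp_le[OF k3(1)]]])
      show "norm (cmat (\<gamma> t) ** A) \<le> c" by (rule c(2)[OF Sp A])
    qed (use b0 k3 k2 c in auto)
    finally have "norm Y * k1 \<le> C" unfolding C_def by (rule mult_right_mono) (use k1(1) in simp)
    with k1(2)[of Y] have "norm (D Y) \<le> C" by (rule order_trans)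
    moreover have "(\<psi> has_vector_derivative D Y) (at t)"
    proof (rule log_derivative)
      show "isCont \<psi> t" using \<psi>(1) by (simp add: continuous_on_eq_continuous_at)
      show "\<And>s. radial_det 0 (\<gamma> s) = exp (\<psi> s)" by (rule \<psi>)
      have "(\<gamma> has_vector_derivative J_mat ** B t ** \<gamma> t) (at t)"
        using f by (simp add: is_fundamental_solution_def)
      from has_vector_derivative_add[OF has_vector_derivative_const[of "Pplus ** A"]
          bounded_linear.has_vector_derivative[OF lin2[of A] this]]
      have "((\<lambda>s. radial_matrix 0 (\<gamma> s) ** A) has_vector_derivative Y) (at t)"
        by (simp add: radial_matrix_0 Y_def matrix_add_rdistrib)
      moreover have "(det has_derivative D) (at (radial_matrix 0 (\<gamma> t) ** A) within S)" for S
        using D by (simp add: A has_derivative_at_withinI)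
      ultimately have "((\<lambda>s. det (radial_matrix 0 (\<gamma> s) ** A)) has_vector_derivative D Y) (at t)"
        using vector_derivative_diff_chain_within[of "\<lambda>s. radial_matrix 0 (\<gamma> s) ** A" Y t UNIV det D] by (simp only: o_def)
      then have "((\<lambda>s. radial_det 0 (\<gamma> t) * det (radial_matrix 0 (\<gamma> s) ** A)) has_vector_derivative radial_det 0 (\<gamma> t) * D Y) (at t)"
        by (rule has_vector_derivative_mult_right)
      moreover have "radial_det 0 (\<gamma> t) * det (radial_matrix 0 (\<gamma> s) ** A) = radial_det 0 (\<gamma> s)" for s
      proof -
        have "radial_det 0 (\<gamma> t) * det A = 1" using A unfolding radial_det_def det_mul[symmetric] by simp
        then show ?thesis by (simp add: det_mul radial_det_def mult_ac)
      qed
      ultimately show "((\<lambda>s. radial_det 0 (\<gamma> s)) has_vector_derivative radial_det 0 (\<gamma> t) * D Y) (at t)" by simp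
    qed
    ultimately show ?thesis by blast
  qed
  then obtain d where d: "\<And>t. norm (d t) \<le> C" "\<And>t. (\<psi> has_vector_derivative d t) (at t)" by metis
  have "norm (\<psi> s - \<psi> t) \<le> C * norm (s - t)" for s t
  proof (rule differentiable_bound[where f'="\<lambda>t h. h *\<^sub>R d t" and S=UNIV])
    show "(\<psi> has_derivative (\<lambda>h. h *\<^sub>R d x)) (at x within UNIV)" for x
      using d(2)[of x] by (simp add: has_vector_derivative_def)
    show "onorm (\<lambda>h. h *\<^sub>R d x) \<le> C" for x
      by (rule onorm_le) (use d(1)[of x] in \<open>auto simp: mult.commute[of C] intro: mult_left_mono\<close>)
  qed auto
  then show ?thesis by auto
qed

text \<open>The index jumps, hence the summand 1: each of the two values is compared with the
  Lipschitz function \<open>g\<close>, at the price of a bounded error.\<close>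

lemma maslov_index_lipschitz:
  fixes B \<gamma> :: "real \<Rightarrow> ('d::finite) mat2"
  assumes B: "B \<in> E_bound K" and f: "is_fundamental_solution B \<gamma>"
  shows "\<exists>C\<ge>0. \<forall>S T. \<bar>maslov_index 1 \<gamma> S - maslov_index 1 \<gamma> T\<bar> \<le> C * (1 + \<bar>S - T\<bar>)"
proof -
  have sym: "transpose (B t) = B t" for t using B by (auto simp: E_bound_def)
  have Sp: "\<gamma> t \<in> Sp" for t by (rule fundamental_solution_Sp[OF sym f])
  have c: "continuous_on UNIV \<gamma>"
    using f unfolding is_fundamental_solution_def
    by (meson continuous_at_imp_continuous_on has_vector_derivative_continuous)
  have g0: "\<gamma> 0 = mat 1" using f by (simp add: is_fundamental_solution_def)
  obtain \<psi> where \<psi>: "continuous_on UNIV \<psi>" "\<And>t. radial_det 0 (\<gamma> t) = exp (\<psi> t)"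
  proof (rule continuous_logarithm_on_contractible[of UNIV "\<lambda>t. radial_det 0 (\<gamma> t)"])
    show "continuous_on UNIV (\<lambda>t. radial_det 0 (\<gamma> t))" by (intro continuous_intros c)
    show "contractible (UNIV :: real set)" by (simp add: convex_imp_contractible)
    show "radial_det 0 (\<gamma> t) \<noteq> 0" for t using radial_det_nonzero[OF Sp, of 0] by simp
  qed (use that in auto)
  obtain C where C: "\<And>s t. norm (\<psi> s - \<psi> t) \<le> C * \<bar>s - t\<bar>"
    using log_lipschitz[OF B f \<psi>] by blast
  have C0: "C \<ge> 0" using order_trans[OF norm_ge_zero C[of 0 1]] by simp
  let ?n = "real (2 * CARD('d + 'd))"
  define i where "i T = real_of_int (iota 1 (mat 1) \<gamma> 0 T)" for T
  define g where "g T = (Im (\<psi> T) - Im (\<psi> 0)) / pi" for T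
  have ig: "\<bar>i T + g T\<bar> \<le> ?n" for T
    unfolding i_def g_def using iota_log_bound[OF c Sp g0 \<psi>] .
  have gg: "\<bar>g S - g T\<bar> \<le> C * \<bar>S - T\<bar>" for S T
  proof -
    have "\<bar>g S - g T\<bar> = \<bar>Im (\<psi> S - \<psi> T)\<bar> / pi" by (simp add: g_def diff_divide_distrib[symmetric])
    also have "\<dots> \<le> \<bar>Im (\<psi> S - \<psi> T)\<bar> / 1"
      using pi_gt3 by (intro divide_left_mono) auto
    also have "\<dots> \<le> C * \<bar>S - T\<bar>" using abs_Im_le_cmod C order_trans by (metis div_by_1)
    finally show ?thesis .
  qed
  have "\<bar>maslov_index 1 \<gamma> S - maslov_index 1 \<gamma> T\<bar> \<le> (2 * ?n + C) * (1 + \<bar>S - T\<bar>)" for S T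
  proof -
    have "\<bar>maslov_index 1 \<gamma> S - maslov_index 1 \<gamma> T\<bar> = \<bar>i S - i T\<bar>" by (simp add: maslov_index_def i_def)
    also have "\<dots> \<le> 2 * ?n + C * \<bar>S - T\<bar>" using ig[of S] ig[of T] gg[of S T] by linarith
    also have "\<dots> \<le> (2 * ?n + C) * (1 + \<bar>S - T\<bar>)" using C0 by (simp add: algebra_simps)
    finally show ?thesis .
  qed
  then show ?thesis using C0 by (intro exI[of _ "2 * ?n + C"]) simp
qed

section \<open>Limits along arithmetic progressions\<close>

lemma discrete_intermediate_limit:
  fixes a :: "nat \<Rightarrow> real"
  assumes step: "(\<lambda>m. a (Suc m) - a m) \<longlonglongrightarrow> 0"
    and low: "\<And>e N. e > 0 \<Longrightarrow> \<exists>m\<ge>N. a m < v + e" and high: "\<And>e N. e > 0 \<Longrightarrow> \<exists>m\<ge>N. v - e < a m"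
  shows "\<exists>m :: nat \<Rightarrow> nat. filterlim m at_top sequentially \<and> (\<lambda>k. a (m k)) \<longlonglongrightarrow> v"
proof -
  \<comment> \<open>A discrete intermediate value argument: if all late terms were at distance at
    least \<open>e\<close> from \<open>v\<close>, steps shorter than \<open>e\<close> could not
    cross the gap of width \<open>2 e\<close>, so a late term above \<open>v - e\<close> would keep
    all its successors above \<open>v + e\<close>, against \<open>low\<close>.\<close>
  have near: "\<exists>m\<ge>N. \<bar>a m - v\<bar> < e" if e: "e > 0" for e N
  proof (rule ccontr)
    assume "\<not> (\<exists>m\<ge>N. \<bar>a m - v\<bar> < e)"
    then have far: "\<bar>a m - v\<bar> \<ge> e" if "m \<ge> N" for m using that by force
    obtain N' where N': "\<And>m. m \<ge> N' \<Longrightarrow> \<bar>a (Suc m) - a m\<bar> < e"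
      using LIMSEQ_D[OF step e] by auto
    obtain m where m: "m \<ge> max N N'" "v - e < a m" using high[OF e] by blast
    have "a n \<ge> v + e" if "n \<ge> m" for n
      using that
    proof (induction n rule: dec_induct)
      case base then show ?case using far[of m] m by auto
    next
      case (step n)
      then show ?case using far[of "Suc n"] N'[of n] m by auto
    qed
    moreover obtain n where "n \<ge> m" "a n < v + e" using low[OF e] by blast
    ultimately show False by force
  qed
  have "\<forall>k. \<exists>m\<ge>k. \<bar>a m - v\<bar> < inverse (real (Suc k))" by (intro allI near) simp
  then obtain m where m: "\<And>k. m k \<ge> k" "\<And>k. \<bar>a (m k) - v\<bar> < inverse (real (Suc k))" by metis
  have "filterlim m at_top sequentially"
    by (rule filterlim_at_top_mono[OF filterlim_ident]) (simp add: m)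
  moreover have "(\<lambda>k. a (m k) - v) \<longlonglongrightarrow> 0"
    by (rule Lim_null_comparison[OF _ LIMSEQ_inverse_real_of_nat]) (use m(2) in \<open>auto intro!: always_eventually less_imp_le\<close>)
  then have "(\<lambda>k. a (m k)) \<longlonglongrightarrow> v" by (simp add: LIM_zero_iff)
  ultimately show ?thesis by blast
qed

lemma quasi_lipschitz_sampling:
  fixes f :: "real \<Rightarrow> real"
  assumes C: "C \<ge> 0" "\<And>S T. \<bar>f S - f T\<bar> \<le> C * (1 + \<bar>S - T\<bar>)" and u: "u > 0"
    and v: "Liminf at_top (\<lambda>l. ereal (f l / l)) \<le> ereal v" "ereal v \<le> Limsup at_top (\<lambda>l. ereal (f l / l))"
  shows "\<exists>m :: nat \<Rightarrow> nat. filterlim m at_top sequentially \<and> (\<lambda>k. f (u * real (m k)) / (u * real (m k))) \<longlonglongrightarrow> v"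
proof -
  define a where "a m = f (u * real m) / (u * real m)" for m
  \<comment> \<open>The constant of linear growth at the samples with \<open>m \<ge> 1\<close>,
    where \<open>\<bar>f 0\<bar> + C\<close> is at most \<open>(\<bar>f 0\<bar> + C) / u\<close>
    times \<open>u m\<close>.\<close>
  define A where "A = (\<bar>f 0\<bar> + C) / u + C"
  have A: "\<bar>f (u * real m)\<bar> \<le> A * (u * real m)" if "m \<ge> 1" for m
  proof -
    have "\<bar>f (u * real m)\<bar> \<le> \<bar>f 0\<bar> + C * (1 + u * real m)" using C(2)[of "u * real m" 0] u by simp
    also have "\<dots> = (\<bar>f 0\<bar> + C) * 1 + C * (u * real m)" by (simp add: algebra_simps)
    also have "\<dots> \<le> (\<bar>f 0\<bar> + C) * real m + C * (u * real m)"
      using that C(1) by (intro add_right_mono mult_left_mono) auto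
    also have "\<dots> = A * (u * real m)" using u by (simp add: A_def field_simps)
    finally show ?thesis .
  qed
  have A0: "A \<ge> 0" using C(1) u by (simp add: A_def)
  \<comment> \<open>\<open>C * (1 + u)\<close> accounts for the change of the numerator over one
    sampling interval, \<open>A * u\<close> for that of the denominator.\<close>
  define E where "E = C * (1 + u) + A * u"
  have E0: "E \<ge> 0" using C(1) u A0 by (simp add: E_def)
  have near: "\<bar>f l / l - a m\<bar> \<le> E / l" if m: "m \<ge> 1" and l: "u * real m \<le> l" "l \<le> u * real m + u" for l m
  proof -
    have um: "u * real m > 0" using u m by simp
    then have l0: "l > 0" using l by linarith
    have "f l / l - a m = (f l - f (u * real m)) / l - f (u * real m) * (l - u * real m) / (l * (u * real m))"
    proof -
      have "F * (l - x) / (l * x) = F / x - F / l" if "x > 0" for F x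
        using that l0 by (simp add: field_simps)
      from this[OF um] show ?thesis by (simp add: a_def diff_divide_distrib)
    qed
    also have "\<bar>\<dots>\<bar> \<le> \<bar>(f l - f (u * real m)) / l\<bar> + \<bar>f (u * real m) * (l - u * real m) / (l * (u * real m))\<bar>"
      by (rule abs_triangle_ineq4)
    also have "\<dots> \<le> C * (1 + u) / l + A * u / l"
    proof (rule add_mono)
      have "\<bar>f l - f (u * real m)\<bar> \<le> C * (1 + \<bar>l - u * real m\<bar>)" by (rule C(2))
      also have "\<dots> \<le> C * (1 + u)" using l C(1) by (intro mult_left_mono) auto
      finally show "\<bar>(f l - f (u * real m)) / l\<bar> \<le> C * (1 + u) / l"
        using l0 by (simp add: abs_divide divide_right_mono)
      have "\<bar>f (u * real m) * (l - u * real m)\<bar> \<le> (A * (u * real m)) * u"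
        unfolding abs_mult using A[OF m] l A0 um by (intro mult_mono) auto
      then have "\<bar>f (u * real m) * (l - u * real m)\<bar> / (l * (u * real m)) \<le> A * (u * real m) * u / (l * (u * real m))"
        using l0 um by (intro divide_right_mono) auto
      also have "\<dots> = A * u / l"
      proof -
        have "A * x * u / (l * x) = A * u / l" if "x > 0" for x
          using that l0 by (simp add: field_simps)
        from this[OF um] show ?thesis .
      qed
      also have "\<bar>f (u * real m) * (l - u * real m)\<bar> / (l * (u * real m)) = \<bar>f (u * real m) * (l - u * real m) / (l * (u * real m))\<bar>"
        using mult_pos_pos[OF l0 um] by (simp only: abs_divide abs_of_pos)
      finally show "\<bar>f (u * real m) * (l - u * real m) / (l * (u * real m))\<bar> \<le> A * u / l" .
    qed
    finally show ?thesis by (simp add: E_def add_divide_distrib)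
  qed
  have El: "E / l < e" if "e > 0" "l > E / e" for e l
  proof -
    have "l > 0" using that E0 divide_nonneg_pos[of E e] by linarith
    with that show ?thesis by (simp add: field_simps)
  qed
  \<comment> \<open>The additional 1 in \<open>real N + 1\<close> makes up for rounding down and
    yields \<open>m > N\<close>, hence also \<open>m \<ge> 1\<close>, as \<open>near\<close>
    requires.\<close>
  have floor: "\<exists>m\<ge>N. m \<ge> 1 \<and> \<bar>f l / l - a m\<bar> < e" if "e > 0" "l > E / e" "l \<ge> u * (real N + 1) " for e l N
  proof -
    define m where "m = nat \<lfloor>l / u\<rfloor>"
    have lu: "l / u \<ge> real N + 1" using that u by (simp add: field_simps)
    then have m: "real m \<le> l / u" "l / u < real m + 1" unfolding m_def by (simp_all add: of_nat_nat)
    then have "real m > real N" using lu by linarith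
    then have "m \<ge> N" "m \<ge> 1" by auto
    moreover have "u * real m \<le> l" "l \<le> u * real m + u" using m u by (simp_all add: field_simps)
    ultimately show ?thesis
      using le_less_trans[OF near El[OF that(1,2)]] by blast
  qed
  have ex: "\<exists>l. l > E / e \<and> l \<ge> u * (real N + 1) \<and> P l" if nP: "\<not> (\<forall>\<^sub>F l in at_top. \<not> P l)" for P e N
  proof -
    obtain l where "l \<ge> max (E / e + 1) (u * (real N + 1))" "P l"
      using nP unfolding eventually_at_top_linorder by blast
    then show ?thesis by (intro exI[of _ l]) auto
  qed
  show ?thesis
    unfolding a_def[symmetric]
  proof (rule discrete_intermediate_limit)
    fix e :: real and N :: nat assume e: "e > 0"
    have "\<not> (\<forall>\<^sub>F l in at_top. \<not> f l / l < v + e / 2)"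
    proof
      assume "\<forall>\<^sub>F l in at_top. \<not> f l / l < v + e / 2"
      then have "\<forall>\<^sub>F l in at_top. ereal (v + e / 2) \<le> ereal (f l / l)" by eventually_elim simp
      from Liminf_bounded[OF this] v(1) have "ereal (v + e / 2) \<le> ereal v" by (rule order_trans)
      then show False using e by simp
    qed
    from ex[OF this, of "e / 2" N] obtain l where l: "l > E / (e / 2)" "l \<ge> u * (real N + 1)" "f l / l < v + e / 2" by blast
    from floor[OF _ l(1,2)] e obtain m where m: "m \<ge> N" "\<bar>f l / l - a m\<bar> < e / 2" by auto
    have "a m < v + e" using m(2) l(3) unfolding abs_less_iff by linarith
    with m(1) show "\<exists>m\<ge>N. a m < v + e" by blast
  next
    fix e :: real and N :: nat assume e: "e > 0"
    have "\<not> (\<forall>\<^sub>F l in at_top. \<not> f l / l > v - e / 2)"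
    proof
      assume "\<forall>\<^sub>F l in at_top. \<not> f l / l > v - e / 2"
      then have "\<forall>\<^sub>F l in at_top. ereal (f l / l) \<le> ereal (v - e / 2)" by eventually_elim simp
      from v(2) Limsup_bounded[OF this] have "ereal v \<le> ereal (v - e / 2)" by (rule order_trans)
      then show False using e by simp
    qed
    from ex[OF this, of "e / 2" N] obtain l where l: "l > E / (e / 2)" "l \<ge> u * (real N + 1)" "f l / l > v - e / 2" by blast
    from floor[OF _ l(1,2)] e obtain m where m: "m \<ge> N" "\<bar>f l / l - a m\<bar> < e / 2" by auto
    have "v - e < a m" using m(2) l(3) unfolding abs_less_iff by linarith
    with m(1) show "\<exists>m\<ge>N. v - e < a m" by blast
  next
    have "\<forall>\<^sub>F m in sequentially. norm (a (Suc m) - a m) \<le> E / u * inverse (real (Suc m))"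
      using eventually_ge_at_top[of "1::nat"]
    proof eventually_elim
      case (elim m)
      \<comment> \<open>The intervals in \<open>near\<close> are closed, so it applies at the right
        end, which is the next sample.\<close>
      have "\<bar>a (Suc m) - a m\<bar> \<le> E / (u * real (Suc m))"
        using near[of m "u * real (Suc m)"] elim u by (simp add: a_def algebra_simps)
      then show ?case by (simp add: field_simps)
    qed
    moreover have "(\<lambda>m. E / u * inverse (real (Suc m))) \<longlonglongrightarrow> 0"
      using tendsto_mult_right_zero[OF LIMSEQ_inverse_real_of_nat] .
    ultimately show "(\<lambda>m. a (Suc m) - a m) \<longlonglongrightarrow> 0" by (rule Lim_null_comparison)
  qed
qed

theorem lemma2p6:
  fixes B \<gamma> :: "real \<Rightarrow> ('d::finite) mat2" and K u v :: real
  assumes "K > 0" and "B \<in> E_bound K"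
    and "is_fundamental_solution B \<gamma>"
    and "ereal v \<in> {mean_index_L B..mean_index_U B}"
    and "u > 0"
  shows "\<exists>m :: nat \<Rightarrow> int. filterlim m at_top sequentially \<and>
           (\<lambda>k. maslov_index 1 \<gamma> (u * real_of_int (m k)) / (u * real_of_int (m k)))
             \<longlonglongrightarrow> v"
proof -
  \<comment> \<open>The mean indices refer to the definite description of the fundamental solution,
    which uniqueness identifies with \<open>\<gamma>\<close>.\<close>
  have "fundamental_solution B = \<gamma>"
    using assms(2,3) by (intro fundamental_solution_eq) (auto simp: E_bound_def)
  moreover obtain C where "C \<ge> 0" "\<And>S T. \<bar>maslov_index 1 \<gamma> S - maslov_index 1 \<gamma> T\<bar> \<le> C * (1 + \<bar>S - T\<bar>)"
    using maslov_index_lipschitz[OF assms(2,3)] by blast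
  ultimately obtain m :: "nat \<Rightarrow> nat" where m: "filterlim m at_top sequentially"
    "(\<lambda>k. maslov_index 1 \<gamma> (u * real (m k)) / (u * real (m k))) \<longlonglongrightarrow> v"
    using quasi_lipschitz_sampling[of C "maslov_index 1 \<gamma>" u v] assms(4,5)
    by (auto simp: mean_index_L_def mean_index_U_def)
  have "filterlim (\<lambda>k. int (m k)) at_top sequentially"
    using filterlim_compose[OF filterlim_int_sequentially m(1)] .
  with m(2) show ?thesis by (intro exI[of _ "\<lambda>k. int (m k)"]) simp
qed

end
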